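(* Let $\alpha\in\mathbb{C}$ with $0<|\alpha|<1$ satisfy $\int_{\mathbb{T}}\ln|1+\alpha\cos(2\pi u)|\,du=\ln\left|\frac{1+\sqrt{1-\alpha^2}}{2}\right|<0$. Let $u_0,u_1\in\mathbb{T}$ be such that $$\ln|Df_{u_0}(0)|<0,\quad \ln|Df_{u_0}(1)|>0,\quad \ln|Df_{u_1}(0)|>0,\quad \ln|Df_{u_1}(1)|<0,$$ and, for $p=0,1$, $\ \ln|Df_{u_0}(p)|/\ln|Df_{u_1}(p)|\notin\mathbb{Q}$. If $\alpha$ is non-real, assume in addition that for $p=0,1$ the real numbers $\arg(Df_{u_0}(p))$, $\arg(Df_{u_1}(p))$, $2\pi$ are incommensurable. Then for all large enough odd $L$ such that $u_0$ and $u_1$ are fixed points of $E$ (i.e. $E(u_0)=u_0$, $E(u_1)=u_1$), the following holds for the skew product map $F:\mathbb{T}\times\hat{\mathbb{C}}\to\mathbb{T}\times\hat{\mathbb{C}}$, $F(u,z)=(E(u),f_u(z))$: (1) For $p=0,1,\infty$, $B^s(p)=\mathbb{T}\times\hat{\mathbb{C}}$, so that $\mathbb{T}\times\{0\}$, $\mathbb{T}\times\{1\}$ and $\mathbb{T}\times\{\infty\}$ are metric attractors with intermingled basins. (2) $F$ is topologically mixing.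
   Context: $\mathbb{T}=\mathbb{R}/\mathbb{Z}$ with Lebesgue measure; $\hat{\mathbb{C}}$ is the Riemann sphere; $\mathbb{T}\times\hat{\mathbb{C}}$ carries its standard volume (product of Lebesgue and spherical area). For a natural number $L>1$, $E:\mathbb{T}\to\mathbb{T}$ is $E(u)=Lu \pmod 1$. For $\alpha\in\mathbb{C}$ and $u\in\mathbb{T}$, $f_u:\hat{\mathbb{C}}\to\hat{\mathbb{C}}$ is $f_u(z)=z+\alpha\cos(2\pi u)z(1-z)$, with $f_u(\infty)=\infty$ (in particular $f_{1/4}=f_{3/4}=\mathrm{id}$). Thus $Df_u(0)=1+\alpha\cos(2\pi u)$ and $Df_u(1)=1-\alpha\cos(2\pi u)$. Write $F^n(u,z)=(E^n(u),f_u^n(z))$ with $f_u^n=f_{E^{n-1}(u)}\circ\cdots\circ f_u$. The square root is the principal branch. Real numbers $a,b,c$ are incommensurable if the quotients $a/b$, $a/c$, $b/c$ are irrational. For $p\in\{0,1,\infty\}$, the basin of $\mathbb{T}\times\{p\}$ is $W^s(p)=\{(u,z)\in\mathbb{T}\times\hat{\mathbb{C}}: \lim_{n\to\infty}f_u^n(z)=p\}$. $B^s(p)$ is the support of the volume restricted to $W^s(p)$: the closed set of all points of $\mathbb{T}\times\hat{\mathbb{C}}$ every open neighborhood of which meets $W^s(p)$ in a set of positive measure. Metric attractor (in the sense of Milnor): a closed set $A$ such that the set of points whose $\omega$-limit set is contained in $A$ has positive measure, and no strictly smaller closed subset $A'\subset A$ has a basin (defined in the same way) that coincides with that of $A$ up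 to measure zero. The basins are intermingled if every nonempty open set intersects each of the basins in a set of positive measure. $F$ is topologically mixing if for all nonempty open sets $U,V$ there is $N$ with $F^n(U)\cap V\neq\emptyset$ for all $n\geq N$. *)

theory Defs
  imports "HOL-Analysis.Analysis"
begin

section \<open>The circle \<open>\<real>/\<int>\<close>\<close>

quotient_type circle = real / "\<lambda>x y. x - y \<in> \<int>"
  morphisms rep_circle to_circle
proof (rule equivpI)
  show "reflp (\<lambda>x y :: real. x - y \<in> \<int>)"
    by (simp add: reflp_def)
  show "symp (\<lambda>x y :: real. x - y \<in> \<int>)"
  proof (rule sympI)
    fix x y :: real
    assume "x - y \<in> \<int>"
    then have "- (x - y) \<in> \<int>" by (rule Ints_minus)
    then show "y - x \<in> \<int>" by simp
  qed
  show "transp (\<lambda>x y :: real. x - y \<in> \<int>)"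
  proof (rule transpI)
    fix x y z :: real
    assume "x - y \<in> \<int>" "y - z \<in> \<int>"
    then have "(x - y) + (y - z) \<in> \<int>" by (rule Ints_add)
    then show "x - z \<in> \<int>" by simp
  qed
qed

text \<open>The topology is the quotient topology.\<close>

instantiation circle :: topological_space
begin

definition open_circle :: "circle set \<Rightarrow> bool" where
  "open_circle U \<longleftrightarrow> open (to_circle -` U)"

instance
proof
  show "open (UNIV :: circle set)"
    by (simp add: open_circle_def)
  show "open (S \<inter> T)" if "open S" "open T" for S T :: "circle set"
    using that by (simp add: open_circle_def open_Int vimage_Int)
  show "open (\<Union>K)" if "\<forall>S\<in>K. open S" for K :: "circle set set"
    using that by (auto simp: open_circle_def vimage_Union)
qed

end

definition circle_lebesgue :: "circle measure" where
  "circle_lebesgue = distr (restrict_space lborel {0..<1}) borel to_circle"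

lift_definition cos_2pi :: "circle \<Rightarrow> real" is "\<lambda>u. cos (2 * pi * u)"
proof -
  fix x y :: real
  assume "x - y \<in> \<int>"
  then obtain k where "x - y = of_int k"
    by (rule Ints_cases)
  then have "x = y + of_int k" by simp
  then show "cos (2 * pi * x) = cos (2 * pi * y)"
    using cos_int_2pin[of k] sin_int_2pin[of k]
    by (simp add: distrib_left cos_add mult.assoc)
qed

lift_definition circle_expand :: "nat \<Rightarrow> circle \<Rightarrow> circle" is "\<lambda>L u. real L * u"
proof -
  fix L :: nat and x y :: real
  assume "x - y \<in> \<int>"
  then have "real L * (x - y) \<in> \<int>" by (intro Ints_mult Ints_of_nat)
  then show "real L * x - real L * y \<in> \<int>" by (simp add: right_diff_distrib)
qed


section \<open>The Riemann sphere\<close>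

datatype riemann_sphere = Fin complex | Infty

text \<open>The topology is that of the one-point compactification of the plane.\<close>

instantiation riemann_sphere :: topological_space
begin

definition open_riemann_sphere :: "riemann_sphere set \<Rightarrow> bool" where
  "open_riemann_sphere U \<longleftrightarrow> open (Fin -` U) \<and> (Infty \<in> U \<longrightarrow> compact (- (Fin -` U)))"

instance
proof
  show "open (UNIV :: riemann_sphere set)"
    by (simp add: open_riemann_sphere_def)
  show "open (S \<inter> T)" if "open S" "open T" for S T :: "riemann_sphere set"
    using that by (auto simp: open_riemann_sphere_def open_Int Compl_Int)
  show "open (\<Union>K)" if K: "\<forall>S\<in>K. open S" for K :: "riemann_sphere set set"
    unfolding open_riemann_sphere_def
  proof
    show op: "open (Fin -` \<Union>K)"
      using K by (auto simp: open_riemann_sphere_def vimage_Union)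
    show "Infty \<in> \<Union>K \<longrightarrow> compact (- (Fin -` \<Union>K))"
    proof
      assume "Infty \<in> \<Union>K"
      then obtain S where S: "S \<in> K" "Infty \<in> S" by blast
      then have "compact (- (Fin -` S))"
        using K by (auto simp: open_riemann_sphere_def)
      moreover have "closed (- (Fin -` \<Union>K))"
        using op by (simp add: closed_def)
      ultimately have "compact (- (Fin -` S) \<inter> - (Fin -` \<Union>K))"
        by (rule compact_Int_closed)
      moreover have "- (Fin -` S) \<inter> - (Fin -` \<Union>K) = - (Fin -` \<Union>K)"
        using S by auto
      ultimately show "compact (- (Fin -` \<Union>K))" by simp
    qed
  qed
qed

end

text \<open>
  Spherical area: under stereographic projection the area form of the unit sphere is
  \<open>4 dx dy / (1 + |z|\<^sup>2)\<^sup>2\<close>, and the point at infinity is a null set.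
\<close>

definition spherical_area :: "riemann_sphere measure" where
  "spherical_area =
     distr (density lborel (\<lambda>z. ennreal (4 / (1 + (cmod z)\<^sup>2)\<^sup>2))) borel Fin"

definition std_volume :: "(circle \<times> riemann_sphere) measure" where
  "std_volume = circle_lebesgue \<Otimes>\<^sub>M spherical_area"


section \<open>Attractors, intermingled basins and mixing\<close>

definition restricted_support :: "'a::topological_space measure \<Rightarrow> 'a set \<Rightarrow> 'a set" where
  "restricted_support M W = {x. \<forall>U. open U \<and> x \<in> U \<longrightarrow> emeasure M (U \<inter> W) > 0}"

definition omega_limit :: "('a::topological_space \<Rightarrow> 'a) \<Rightarrow> 'a \<Rightarrow> 'a set" where
  "omega_limit F x = (\<Inter>n. closure {(F ^^ k) x | k. k \<ge> n})"

definition attraction_basin :: "('a::topological_space \<Rightarrow> 'a) \<Rightarrow> 'a set \<Rightarrow> 'a set" where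
  "attraction_basin F A = {x. omega_limit F x \<subseteq> A}"

definition metric_attractor ::
    "'a::topological_space measure \<Rightarrow> ('a \<Rightarrow> 'a) \<Rightarrow> 'a set \<Rightarrow> bool" where
  "metric_attractor M F A \<longleftrightarrow>
     closed A \<and> emeasure M (attraction_basin F A) > 0 \<and>
     \<not> (\<exists>A'. closed A' \<and> A' \<subset> A \<and>
          (AE x in M. x \<in> attraction_basin F A' \<longleftrightarrow> x \<in> attraction_basin F A))"

definition intermingled :: "'a::topological_space measure \<Rightarrow> 'a set set \<Rightarrow> bool" where
  "intermingled M \<B> \<longleftrightarrow>
     (\<forall>U. open U \<and> U \<noteq> {} \<longrightarrow> (\<forall>B\<in>\<B>. emeasure M (U \<inter> B) > 0))"

definition topologically_mixing :: "('a::topological_space \<Rightarrow> 'a) \<Rightarrow> bool" where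
  "topologically_mixing F \<longleftrightarrow>
     (\<forall>U V. open U \<and> U \<noteq> {} \<and> open V \<and> V \<noteq> {} \<longrightarrow>
        (\<exists>N. \<forall>n\<ge>N. (F ^^ n) ` U \<inter> V \<noteq> {}))"


section \<open>The skew product\<close>

definition fibre_poly :: "complex \<Rightarrow> circle \<Rightarrow> complex \<Rightarrow> complex" where
  "fibre_poly \<alpha> u z = z + \<alpha> * complex_of_real (cos_2pi u) * z * (1 - z)"

fun fibre_map :: "complex \<Rightarrow> circle \<Rightarrow> riemann_sphere \<Rightarrow> riemann_sphere" where
  "fibre_map \<alpha> u (Fin z) = Fin (fibre_poly \<alpha> u z)"
| "fibre_map \<alpha> u Infty = Infty"

definition skew_product ::
    "complex \<Rightarrow> nat \<Rightarrow> circle \<times> riemann_sphere \<Rightarrow> circle \<times> riemann_sphere" where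
  "skew_product \<alpha> L = (\<lambda>(u, z). (circle_expand L u, fibre_map \<alpha> u z))"

primrec fibre_iterate ::
    "complex \<Rightarrow> nat \<Rightarrow> nat \<Rightarrow> circle \<Rightarrow> riemann_sphere \<Rightarrow> riemann_sphere" where
  "fibre_iterate \<alpha> L 0 u z = z"
| "fibre_iterate \<alpha> L (Suc n) u z =
     fibre_map \<alpha> ((circle_expand L ^^ n) u) (fibre_iterate \<alpha> L n u z)"

lemma skew_product_funpow:
  "(skew_product \<alpha> L ^^ n) (u, z) = ((circle_expand L ^^ n) u, fibre_iterate \<alpha> L n u z)"
  by (induction n) (simp_all add: skew_product_def)

lemma deriv_fibre_poly_0: "deriv (fibre_poly \<alpha> u) 0 = 1 + \<alpha> * complex_of_real (cos_2pi u)"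
  unfolding fibre_poly_def by (rule DERIV_imp_deriv) (auto intro!: derivative_eq_intros)

lemma deriv_fibre_poly_1: "deriv (fibre_poly \<alpha> u) 1 = 1 - \<alpha> * complex_of_real (cos_2pi u)"
  unfolding fibre_poly_def by (rule DERIV_imp_deriv) (auto intro!: derivative_eq_intros)

definition stable_set ::
    "complex \<Rightarrow> nat \<Rightarrow> riemann_sphere \<Rightarrow> (circle \<times> riemann_sphere) set" where
  "stable_set \<alpha> L p = {(u, z). (\<lambda>n. fibre_iterate \<alpha> L n u z) \<longlonglongrightarrow> p}"

text \<open>
  As \<open>x / 0 = 0\<close>, incommensurable numbers are in particular nonzero.
\<close>

definition incommensurable :: "real \<Rightarrow> real \<Rightarrow> real \<Rightarrow> bool" where
  "incommensurable a b c \<longleftrightarrow> a / b \<notin> \<rat> \<and> a / c \<notin> \<rat> \<and> b / c \<notin> \<rat>"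

end

theory Submission
  imports Defs "HOL-Complex_Analysis.Complex_Analysis"
begin

text \<open>
  Write \<open>q\<^sub>b z = z + b z (1 - z)\<close> for the fibre maps. Over almost every fibre
  the basin of infinity contains a neighbourhood of infinity, and for large \<open>L\<close> the basins of 0 and
  1 contain neighbourhoods of 0 and 1, because the Lyapunov exponents there are negative; the sizes
  of these neighbourhoods are uniform outside a set of fibres of small measure. Everything else
  reduces to showing that every nonempty open set has a forward orbit through \<open>(u, 0)\<close> for some \<open>u\<close>:
  over the fixed point \<open>u1\<close> the fixed point 0 is repelling, so by Montel's theorem a neighbourhood
  of \<open>(u1, 0)\<close> is blown up over every bounded set, and mixing follows by pulling points back along
  the inverse branch of \<open>E\<close> at \<open>u1\<close>.

  To hit 0, follow a point over a shrinking interval around \<open>u1\<close>. As \<open>L\<close> is large, its orbits form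
  almost constant curves over the whole circle as long as they are bounded. If they stayed bounded
  forever, they would form a bounded set that is nearly invariant under all \<open>q\<^sub>b\<close> with
  \<open>b = \<alpha> cos (2 \<pi> u)\<close>. The point \<open>z\<close> is the midpoint of its images under \<open>b\<close> and \<open>- b\<close>, so the extreme
  points of the convex hull of an invariant set are 0 and 1, and the orbits remain near \<open>[0, 1]\<close>. For
  non-real \<open>\<alpha>\<close> this is absurd; for real \<open>\<alpha>\<close> the argument of \<open>z / (1 - z)\<close> grows under every \<open>q\<^sub>b\<close>, which
  is again a contradiction. Hence orbits over \<open>u1\<close> escape towards infinity, where \<open>q\<^sub>b\<close> doubles
  arguments: by Bloch's theorem images of discs contain annuli, and an annulus over a fibre close to
  \<open>u = 1/4\<close> contains the second zero \<open>1 + 1/b\<close> of \<open>q\<^sub>b\<close>.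
\<close>

section \<open>Orbits over real lifts\<close>

text \<open>Large \<open>L\<close> enters in three ways. A cylinder of order n is stretched over the
  whole circle while the orbit of a fixed z varies over it by only O(1/L), so the base point can be
  prescribed anew at every time at small cost in the fibre: the dynamics becomes a controlled one.
  Next, a negative exponent makes the mean of |1 + b|^t less than 1 for some t > 0, and for large
  \<open>L\<close> successive multipliers are nearly independent, so their products decay off a
  small set of fibres. Finally, fibres along a cylinder at \<open>u1\<close> have almost constant
  parameter. Odd \<open>L\<close> provides two symmetries: u -> u + 1/2 commutes with
  \<open>E\<close> and together with z -> 1 - z exchanges 0 and 1, and {1/4, 3/4} is invariant, so
  that orbits can linger where the fibre maps are almost the identity. The obstacle is that F is
  discontinuous at infinity: the zeros 1 + 1/b run off to infinity as u tends to 1/4. This is what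
  lets far points return to 0, and it is why measurability and omega limits are treated without
  continuity. Good sets of fibres have measure close to 1 but unknown position; invariance of
  Lebesgue measure places their preimages in a given interval.\<close>

definition quad :: "complex \<Rightarrow> complex \<Rightarrow> complex" where
  "quad b z = z + b * z * (1 - z)"

definition param :: "complex \<Rightarrow> real \<Rightarrow> complex" where
  "param \<alpha> x = \<alpha> * complex_of_real (cos (2 * pi * x))"

text \<open>The base coordinate is a real lift that is never reduced mod 1, so distances and limits
  in it are those of the line; by \<open>orb_cong\<close> only its class matters.\<close>

primrec orb :: "complex \<Rightarrow> nat \<Rightarrow> nat \<Rightarrow> real \<Rightarrow> complex \<Rightarrow> complex" where
  "orb \<alpha> L 0 x z = z"
| "orb \<alpha> L (Suc n) x z = quad (param \<alpha> (real L ^ n * x)) (orb \<alpha> L n x z)"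

lemma quad_0 [simp]: "quad b 0 = 0"
  and quad_1 [simp]: "quad b 1 = 1"
  by (simp_all add: quad_def)

lemma quad_factor: "quad b z = z * (1 + b - b * z)"
  and quad_minus_1: "quad b z - 1 = (z - 1) * (1 - b * z)"
  by (simp_all add: quad_def algebra_simps)

text \<open>The involution z -> 1 - z exchanges the two fixed points at the price of the sign of b.
  Facts about 1 are derived from facts about 0 in this way.\<close>

lemma quad_reflect: "quad (- b) z = 1 - quad b (1 - z)"
  by (simp add: quad_def algebra_simps)

lemma cos_2pi_cong:
  assumes "x - y \<in> \<int>"
  shows "cos (2 * pi * x) = cos (2 * pi * y)"
proof -
  obtain k where "x - y = of_int k"
    using assms by (rule Ints_cases)
  then have "x = y + of_int k" by simp
  then show ?thesis
    using cos_int_2pin[of k] sin_int_2pin[of k]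
    by (simp add: distrib_left cos_add mult.assoc)
qed

lemma param_cong: "x - y \<in> \<int> \<Longrightarrow> param \<alpha> x = param \<alpha> y"
  using cos_2pi_cong[of x y] by (simp add: param_def)

lemma norm_param_le: "cmod (param \<alpha> x) \<le> cmod \<alpha>"
  by (simp add: param_def norm_mult mult_left_le)

lemma cos_lipschitz: "\<bar>cos x - cos y\<bar> \<le> \<bar>x - y\<bar>" for x y :: real
proof -
  have "\<bar>cos x - cos y\<bar> = \<bar>2 * sin ((x + y) / 2) * sin ((y - x) / 2)\<bar>"
    by (simp add: cos_diff_cos)
  also have "\<dots> \<le> 2 * \<bar>sin ((y - x) / 2)\<bar>"
    by (simp add: abs_mult mult_right_le_one_le mult_left_le_one_le)
  also have "\<dots> \<le> 2 * \<bar>(y - x) / 2\<bar>"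
    by (intro mult_left_mono abs_sin_x_le_abs_x) auto
  finally show ?thesis by simp
qed

text \<open>The 7 is a round bound for 2 pi; it reappears in the later estimates in the base
  direction.\<close>

lemma norm_param_diff_le: "cmod (param \<alpha> x - param \<alpha> y) \<le> cmod \<alpha> * (7 * \<bar>x - y\<bar>)"
proof -
  have "cmod (param \<alpha> x - param \<alpha> y) = cmod \<alpha> * \<bar>cos (2 * pi * x) - cos (2 * pi * y)\<bar>"
    by (simp add: param_def norm_mult flip: right_diff_distrib of_real_diff)
  also have "\<bar>cos (2 * pi * x) - cos (2 * pi * y)\<bar> \<le> \<bar>2 * pi * x - 2 * pi * y\<bar>"
    by (rule cos_lipschitz)
  also have "\<dots> = 2 * pi * \<bar>x - y\<bar>"
    by (simp add: abs_mult flip: right_diff_distrib)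
  also have "\<dots> \<le> 7 * \<bar>x - y\<bar>"
    using pi_less_4 pi_approx by (intro mult_right_mono) auto
  finally show ?thesis by (simp add: mult_left_mono)
qed

lemma orb_0 [simp]: "orb \<alpha> L n x 0 = 0"
  and orb_1 [simp]: "orb \<alpha> L n x 1 = 1"
  by (induction n) simp_all

lemma orb_add: "orb \<alpha> L (m + n) x z = orb \<alpha> L n (real L ^ m * x) (orb \<alpha> L m x z)"
  by (induction n) (simp_all add: power_add mult_ac)

lemma Ints_of_nat_power_mult: "d \<in> \<int> \<Longrightarrow> real L ^ n * d \<in> \<int>"
  by (intro Ints_mult Ints_power) auto

lemma orb_cong:
  assumes "x - y \<in> \<int>"
  shows "orb \<alpha> L n x z = orb \<alpha> L n y z"
proof (induction n)
  case (Suc n)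
  have "real L ^ n * x - real L ^ n * y \<in> \<int>"
    using assms Ints_of_nat_power_mult[of "x - y"] by (simp add: right_diff_distrib)
  then show ?case
    using Suc param_cong[of "real L ^ n * x"] by simp
qed simp

lemma orb_reflect: "orb (- \<alpha>) L n x z = 1 - orb \<alpha> L n x (1 - z)"
proof (induction n)
  case (Suc n)
  have "param (- \<alpha>) y = - param \<alpha> y" for y
    by (simp add: param_def)
  with Suc show ?case
    by (simp add: quad_reflect)
qed simp

lemma fixed_power:
  assumes "real L * x - x \<in> \<int>"
  shows "real L ^ n * x - x \<in> \<int>"
proof (induction n)
  case (Suc n)
  have "real L * (real L ^ n * x - x) \<in> \<int>"
    using Suc by (intro Ints_mult) auto
  from Ints_add[OF this assms] show ?case
    by (simp add: algebra_simps)
qed simp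

lemma orb_fixed:
  assumes "real L * x - x \<in> \<int>" "y - x \<in> \<int>"
  shows "orb \<alpha> L n y z = (quad (param \<alpha> x) ^^ n) z"
proof -
  have "orb \<alpha> L n x z = (quad (param \<alpha> x) ^^ n) z"
    by (induction n) (simp_all add: param_cong[OF fixed_power[OF assms(1)]])
  with orb_cong[OF assms(2)] show ?thesis by simp
qed

lemma continuous_on_orb [continuous_intros]:
  fixes f :: "'a::t2_space \<Rightarrow> real"
  assumes "continuous_on A f" "continuous_on A g"
  shows "continuous_on A (\<lambda>p. orb \<alpha> L n (f p) (g p))"
proof (induction n)
  case (Suc n)
  then show ?case
    unfolding orb.simps quad_def param_def by (intro continuous_intros assms)
qed (simp add: assms)

lemma holomorphic_on_orb: "orb \<alpha> L n x holomorphic_on A"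
proof (induction n)
  case 0
  have "orb \<alpha> L 0 x = (\<lambda>z. z)" by auto
  then show ?case by simp
next
  case (Suc n)
  have "orb \<alpha> L (Suc n) x = (\<lambda>z. orb \<alpha> L n x z +
      param \<alpha> (real L ^ n * x) * orb \<alpha> L n x z * (1 - orb \<alpha> L n x z))"
    by (auto simp: quad_def)
  with Suc show ?case by (auto intro!: holomorphic_intros)
qed

lemma quad_surj: "\<exists>z. quad b z = w"
proof (cases "b = 0")
  case True
  then show ?thesis by (auto simp: quad_def)
next
  case False
  define s where "s = csqrt ((1 + b)\<^sup>2 - 4 * b * w)"
  have s: "s * s = (1 + b)\<^sup>2 - 4 * b * w"
    unfolding s_def by (metis power2_csqrt power2_eq_square)
  have "quad b ((1 + b - s) / (2 * b)) = ((1 + b)\<^sup>2 - s * s) / (4 * b)"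
    using False by (simp add: quad_def field_simps power2_eq_square)
  also have "\<dots> = w" using False s by simp
  finally show ?thesis by blast
qed

lemma orb_surj: "\<exists>z. orb \<alpha> L n x z = w"
proof (induction n arbitrary: w)
  case (Suc n)
  obtain v where v: "quad (param \<alpha> (real L ^ n * x)) v = w" using quad_surj by blast
  obtain z where "orb \<alpha> L n x z = v" using Suc by blast
  with v show ?case by auto
qed simp

section \<open>Stability of images under perturbation of holomorphic maps\<close>

text \<open>Hurwitz's argument: on a small circle about \<open>z0\<close> the map \<open>f x\<close>
  keeps a distance m from its value at the centre. For y near x and w near that value,
  \<open>f y - w\<close> is still smaller at the centre than on the circle, so it has a zero
  inside.\<close>

lemma ball_subset_image_stable:
  fixes f :: "real \<Rightarrow> complex \<Rightarrow> complex"
  assumes cont: "continuous_on UNIV (\<lambda>p. f (fst p) (snd p))"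
    and hol: "\<And>y. f y holomorphic_on UNIV"
    and nc: "f x z1 \<noteq> f x z0" and D: "open D" "z0 \<in> D"
  shows "\<exists>e>0. \<forall>\<^sub>F y in nhds x. ball (f x z0) e \<subseteq> f y ` D"
proof -
  have "(\<lambda>z. f x z - f x z0) holomorphic_on UNIV"
    by (intro holomorphic_intros hol)
  then obtain r where r: "0 < r" "\<And>z. z \<in> ball z0 r - {z0} \<Longrightarrow> f x z - f x z0 \<noteq> 0"
    using isolated_zeros[of "\<lambda>z. f x z - f x z0" UNIV z0 z1] nc by auto
  obtain r' where r': "0 < r'" "cball z0 r' \<subseteq> D"
    using D open_contains_cball by blast
  define s where "s = min (r/2) r'"
  have s: "0 < s" "s < r" "cball z0 s \<subseteq> D"
    using r r' by (auto simp: s_def)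
  have cf: "continuous_on UNIV (f y)" for y
    using hol holomorphic_on_imp_continuous_on by blast
  have ne: "sphere z0 s \<noteq> {}" using s by auto
  have "continuous_on (sphere z0 s) (\<lambda>z. cmod (f x z - f x z0))"
    by (intro continuous_intros continuous_on_subset[OF cf]) auto
  then obtain z2 where z2: "z2 \<in> sphere z0 s"
      "\<And>z. z \<in> sphere z0 s \<Longrightarrow> cmod (f x z2 - f x z0) \<le> cmod (f x z - f x z0)"
    using continuous_attains_inf[OF compact_sphere ne] by blast
  define m where "m = cmod (f x z2 - f x z0)"
  have m: "m > 0"
  proof -
    have "z2 \<in> ball z0 r - {z0}" using z2(1) s by auto
    from r(2)[OF this] show ?thesis by (simp add: m_def)
  qed
  have "compact (cball x 1 \<times> cball z0 s)" by (intro compact_Times) auto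
  then have "uniformly_continuous_on (cball x 1 \<times> cball z0 s) (\<lambda>p. f (fst p) (snd p))"
    by (intro compact_uniformly_continuous continuous_on_subset[OF cont]) auto
  then obtain d where d: "d > 0" "\<And>p q. p \<in> cball x 1 \<times> cball z0 s \<Longrightarrow>
      q \<in> cball x 1 \<times> cball z0 s \<Longrightarrow> dist q p < d \<Longrightarrow>
      dist (f (fst q) (snd q)) (f (fst p) (snd p)) < m/4"
    unfolding uniformly_continuous_on_def using m by (metis zero_less_divide_iff zero_less_numeral)
  have ev: "\<forall>\<^sub>F y in nhds x. dist y x < min d 1"
    using d(1) by (intro eventually_nhds_metric[THEN iffD2]) (auto intro!: exI[of _ "min d 1"])
  show ?thesis
  \<comment> \<open>One quarter of \<open>m\<close> for the change of y and one for w: the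
    difference is below m/2 at the centre and above m/2 on the circle.\<close>
  proof (intro exI[of _ "m/4"] conjI eventually_mono[OF ev] subsetI)
    show "m/4 > 0" using m by simp
    fix y w assume y: "dist y x < min d 1" and w: "w \<in> ball (f x z0) (m/4)"
    have close: "dist (f y z) (f x z) < m/4" if "z \<in> cball z0 s" for z
      using d(2)[of "(x, z)" "(y, z)"] that y by (auto simp: dist_Pair_Pair dist_commute)
    have "\<exists>z\<in>ball z0 s. f y z - w = 0"
    proof (rule holomorphic_contract_to_zero[of z0 s "\<lambda>z. f y z - w"])
      show "continuous_on (cball z0 s) (\<lambda>z. f y z - w)"
        by (intro continuous_intros continuous_on_subset[OF cf]) auto
      show "(\<lambda>z. f y z - w) holomorphic_on ball z0 s"
        by (intro holomorphic_intros holomorphic_on_subset[OF hol]) auto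
      show "cmod (f y z0 - w) < cmod (f y z - w)" if z: "cmod (z0 - z) = s" for z
      proof -
        have zs: "z \<in> sphere z0 s" using z by (simp add: dist_norm)
        have 1: "dist (f y z0) (f x z0) < m/4" using close s by auto
        have 2: "dist (f y z) (f x z) < m/4" using close zs by auto
        have 3: "m \<le> dist (f x z) (f x z0)" using z2(2)[OF zs] by (simp add: m_def dist_norm)
        have 4: "dist (f x z0) w < m/4" using w by simp
        have "dist (f y z0) w < m/2"
          using 1 4 dist_triangle[of "f y z0" w "f x z0"] by linarith
        moreover have "m \<le> dist (f x z) (f y z) + dist (f y z) w + dist w (f x z0)"
          using 3 dist_triangle[of "f x z" "f x z0" "f y z"]
            dist_triangle[of "f y z" "f x z0" w] by linarith
        ultimately have "dist (f y z0) w < dist (f y z) w"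
          using 2 4 by (simp add: dist_commute)
        then show ?thesis by (simp add: dist_norm)
      qed
    qed (use s in auto)
    then obtain z where "z \<in> ball z0 s" "w = f y z" by auto
    moreover have "ball z0 s \<subseteq> D" using s(3) ball_subset_cball by blast
    ultimately show "w \<in> f y ` D" by blast
  qed
qed

text \<open>Surjectivity supplies the second value that the local lemma asks for, at every point of
  \<open>K\<close>; compactness makes the neighbourhood of x uniform.\<close>

lemma compact_subset_image_stable:
  fixes f :: "real \<Rightarrow> complex \<Rightarrow> complex"
  assumes cont: "continuous_on UNIV (\<lambda>p. f (fst p) (snd p))"
    and hol: "\<And>y. f y holomorphic_on UNIV"
    and nc: "surj (f x)" and D: "open D" and K: "compact K" "K \<subseteq> f x ` D"
  shows "\<forall>\<^sub>F y in nhds x. K \<subseteq> f y ` D"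
proof -
  have "\<exists>e>0. \<forall>\<^sub>F y in nhds x. ball w e \<subseteq> f y ` D" if "w \<in> K" for w
  proof -
    have "w \<in> f x ` D" using K(2) \<open>w \<in> K\<close> by blast
    then obtain z0 where z0: "z0 \<in> D" "f x z0 = w" by blast
    obtain z1 where "f x z1 = w + 1" using nc by (metis surjD)
    then have "f x z1 \<noteq> f x z0" using z0 by simp
    from ball_subset_image_stable[OF cont hol this D z0(1)] z0(2) show ?thesis by simp
  qed
  then obtain e where e: "\<And>w. w \<in> K \<Longrightarrow> e w > 0"
      "\<And>w. w \<in> K \<Longrightarrow> \<forall>\<^sub>F y in nhds x. ball w (e w) \<subseteq> f y ` D"
    by metis
  have "K \<subseteq> (\<Union>w\<in>K. ball w (e w))" using e(1) by force
  then obtain C where C: "C \<subseteq> K" "finite C" "K \<subseteq> (\<Union>w\<in>C. ball w (e w))"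
    using compactE_image[OF K(1), of K "\<lambda>w. ball w (e w)"] by blast
  have "\<forall>\<^sub>F y in nhds x. \<forall>w\<in>C. ball w (e w) \<subseteq> f y ` D"
    using C e(2) by (intro eventually_ball_finite) auto
  then show ?thesis
    by eventually_elim (use C(3) in blast)
qed

lemma compact_subset_orb_image:
  assumes "open D" "compact K" "K \<subseteq> orb \<alpha> L n x ` D"
  shows "\<forall>\<^sub>F y in nhds x. K \<subseteq> orb \<alpha> L n y ` D"
proof (rule compact_subset_image_stable)
  show "surj (orb \<alpha> L n x)" using orb_surj[of \<alpha> L n x] by (metis surjI)
qed (use assms in \<open>auto intro!: continuous_intros holomorphic_on_orb\<close>)

lemma open_orb_image:
  assumes "open D"
  shows "open (orb \<alpha> L n x ` D)"
proof -
  have "\<exists>e>0. ball w e \<subseteq> orb \<alpha> L n x ` D" if "w \<in> orb \<alpha> L n x ` D" for w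
  proof -
    obtain z0 where z0: "z0 \<in> D" "w = orb \<alpha> L n x z0" using \<open>w \<in> orb \<alpha> L n x ` D\<close> by auto
    obtain z1 where "orb \<alpha> L n x z1 = w + 1" using orb_surj by blast
    then have ne: "orb \<alpha> L n x z1 \<noteq> orb \<alpha> L n x z0" using z0 by simp
    have "\<exists>e>0. \<forall>\<^sub>F y in nhds x. ball (orb \<alpha> L n x z0) e \<subseteq> orb \<alpha> L n y ` D"
      by (rule ball_subset_image_stable[where f = "orb \<alpha> L n", OF _ _ ne assms z0(1)])
        (auto intro!: continuous_intros holomorphic_on_orb)
    then show ?thesis using z0(2) by (auto dest: eventually_nhds_x_imp_x)
  qed
  then show ?thesis by (auto simp: open_contains_ball)
qed

section \<open>Nearly invariant bounded sets\<close>

text \<open>As \<open>z\<close> is the midpoint of its images under \<open>quad \<alpha>\<close> and \<open>quad (- \<alpha>)\<close>, an extreme point of the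
  convex hull of an invariant set is a common fixed point, i.e. 0 or 1.\<close>

lemma compact_invariant_subset_segment:
  assumes B: "compact B" and a: "\<alpha> \<noteq> 0"
    and inv: "\<And>z. z \<in> B \<Longrightarrow> quad \<alpha> z \<in> B" "\<And>z. z \<in> B \<Longrightarrow> quad (- \<alpha>) z \<in> B"
  shows "B \<subseteq> closed_segment 0 1"
proof -
  have "e \<in> {0, 1}" if e: "e extreme_point_of (convex hull B)" for e
  proof (rule ccontr)
    assume ne: "e \<notin> {0, 1}"
    have eB: "e \<in> B" using e extreme_points_of_convex_hull by blast
    then have "quad \<alpha> e \<in> convex hull B" "quad (- \<alpha>) e \<in> convex hull B"
      by (auto intro: hull_inc inv)
    moreover have "e = midpoint (quad \<alpha> e) (quad (- \<alpha>) e)"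
      by (simp add: midpoint_def quad_def scaleR_conv_of_real)
    moreover have "quad \<alpha> e - quad (- \<alpha>) e = 2 * (\<alpha> * e * (1 - e))"
      by (simp add: quad_def algebra_simps)
    with ne a have "quad \<alpha> e \<noteq> quad (- \<alpha>) e" by auto
    ultimately show False
      using e midpoint_in_open_segment[of "quad \<alpha> e" "quad (- \<alpha>) e"]
      unfolding extreme_point_of_def by metis
  qed
  then have "{e. e extreme_point_of (convex hull B)} \<subseteq> {0, 1}" by blast
  then have "convex hull {e. e extreme_point_of (convex hull B)} \<subseteq> convex hull {0, 1}"
    by (rule hull_mono)
  then have "convex hull B \<subseteq> closed_segment 0 1"
    using Krein_Milman_Minkowski[of "convex hull B"] B compact_convex_hull[OF B]
    by (simp add: segment_convex_hull)
  then show ?thesis using hull_subset[of B convex] by blast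
qed

definition near_unit :: "real \<Rightarrow> complex \<Rightarrow> bool" where
  "near_unit \<eta> z \<longleftrightarrow> (\<exists>s\<in>{0..1}. cmod (z - of_real s) < \<eta>)"

text \<open>By compactness: counterexamples with errors tending to 0 would accumulate at a compact,
  exactly invariant set. It lies in the segment, although it contains a limit of points at distance
  at least \<open>\<eta>\<close> from it.\<close>

lemma near_unit_approx:
  assumes a: "\<alpha> \<noteq> 0" and \<eta>: "\<eta> > 0"
  shows "\<exists>\<delta>>0. \<forall>A \<subseteq> cball 0 R.
    (\<forall>z\<in>A. \<forall>b\<in>{\<alpha>, - \<alpha>}. \<exists>z'\<in>A. dist z' (quad b z) \<le> \<delta>) \<longrightarrow> (\<forall>z\<in>A. near_unit \<eta> z)"
proof (rule ccontr)
  assume "\<not> ?thesis"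
  then have "\<And>n::nat. \<exists>A \<subseteq> cball 0 R.
    (\<forall>z\<in>A. \<forall>b\<in>{\<alpha>, - \<alpha>}. \<exists>z'\<in>A. dist z' (quad b z) \<le> inverse (real (Suc n))) \<and>
      (\<exists>z\<in>A. \<not> near_unit \<eta> z)"
    by (smt (verit) inverse_positive_iff_positive of_nat_0_less_iff zero_less_Suc)
  then obtain A where A: "\<And>n::nat. A n \<subseteq> cball 0 R"
      "\<And>n z b. z \<in> A n \<Longrightarrow> b \<in> {\<alpha>, - \<alpha>} \<Longrightarrow> \<exists>z'\<in>A n. dist z' (quad b z) \<le> inverse (real (Suc n))"
      "\<And>n. \<exists>z\<in>A n. \<not> near_unit \<eta> z"
    by metis
  obtain a where a': "\<And>n. a n \<in> A n" "\<And>n. \<not> near_unit \<eta> (a n)" using A(3) by metis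
  \<comment> \<open>The upper limit of the sets \<open>A n\<close>: the points all of whose
    neighbourhoods meet infinitely many of them. It is closed, and the errors 1/(n+1) vanish in
    it.\<close>
  define B where "B = {z. \<forall>\<epsilon>>0. \<forall>N. \<exists>n\<ge>N. \<exists>y\<in>A n. dist y z < \<epsilon>}"
  have BD: "\<exists>n\<ge>N. \<exists>y\<in>A n. dist y z < \<epsilon>" if "z \<in> B" "\<epsilon> > 0" for z \<epsilon> N
    using that by (auto simp: B_def)
  have "closed B"
    unfolding closed_sequential_limits
  proof (intro allI impI, elim conjE)
    fix x l assume x: "\<forall>n. x n \<in> B" "x \<longlonglongrightarrow> l"
    show "l \<in> B"
      unfolding B_def
    proof (intro CollectI allI impI)
      fix \<epsilon> :: real and N assume "\<epsilon> > 0"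
      then obtain k where k: "dist (x k) l < \<epsilon>/2"
        using x(2) by (metis half_gt_zero lim_sequentially order_refl)
      obtain n y where "n \<ge> N" "y \<in> A n" "dist y (x k) < \<epsilon>/2"
        using BD[of "x k" "\<epsilon>/2" N] x(1) \<open>\<epsilon> > 0\<close> by auto
      then show "\<exists>n\<ge>N. \<exists>y\<in>A n. dist y l < \<epsilon>"
        using k dist_triangle_half_r[of "x k" y \<epsilon> l] by (metis dist_commute)
    qed
  qed
  moreover have "B \<subseteq> cball 0 (R + 1)"
  proof
    fix z assume "z \<in> B"
    then obtain n y where "y \<in> A n" "dist y z < 1"
      using BD[of z 1 0] by auto
    then show "z \<in> cball 0 (R + 1)"
      using A(1)[of n] dist_triangle[of 0 z y] by fastforce
  qed
  ultimately have "compact B"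
    by (meson bounded_cball bounded_subset compact_eq_bounded_closed)
  have inv: "quad b z \<in> B" if z: "z \<in> B" and b: "b \<in> {\<alpha>, - \<alpha>}" for z b
    unfolding B_def
  proof (intro CollectI allI impI)
    fix \<epsilon> :: real and N assume e: "\<epsilon> > 0"
    have "isCont (quad b) z" unfolding quad_def by (intro continuous_intros)
    then obtain d where d: "d > 0" "\<And>y. dist y z < d \<Longrightarrow> dist (quad b y) (quad b z) < \<epsilon>/2"
      unfolding continuous_at_eps_delta using e by (metis half_gt_zero)
    obtain M where M: "inverse (real (Suc M)) < \<epsilon>/2"
      using e reals_Archimedean half_gt_zero by blast
    obtain n y where n: "n \<ge> max N M" "y \<in> A n" "dist y z < d"
      using BD[OF z d(1), of "max N M"] by blast
    obtain z' where z': "z' \<in> A n" "dist z' (quad b y) \<le> inverse (real (Suc n))"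
      using A(2)[OF n(2) b] by blast
    have "inverse (real (Suc n)) \<le> inverse (real (Suc M))"
      using n(1) by (intro le_imp_inverse_le) auto
    then have "dist z' (quad b z) < \<epsilon>"
      using z'(2) d(2)[OF n(3)] M dist_triangle[of z' "quad b z" "quad b y"] by linarith
    then show "\<exists>n\<ge>N. \<exists>y\<in>A n. dist y (quad b z) < \<epsilon>"
      using n(1) z'(1) by auto
  qed
  have "B \<subseteq> closed_segment 0 1"
    using \<open>compact B\<close> a inv by (intro compact_invariant_subset_segment[of B \<alpha>]) auto
  obtain l r where l: "strict_mono r" "(a \<circ> r) \<longlonglongrightarrow> l"
  proof -
    have "\<forall>n. a n \<in> cball 0 R" using a'(1) A(1) by blast
    then show ?thesis using that compact_cball[of "0::complex" R] unfolding compact_def by metis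
  qed
  have "l \<in> B"
    unfolding B_def
  proof (intro CollectI allI impI)
    fix \<epsilon> :: real and N assume "\<epsilon> > 0"
    then obtain M where "\<And>n. n \<ge> M \<Longrightarrow> dist (a (r n)) l < \<epsilon>"
      using l(2) unfolding lim_sequentially by auto
    then have "dist (a (r (max M N))) l < \<epsilon>" by simp
    moreover have "r (max M N) \<ge> N"
      using seq_suble[OF l(1), of "max M N"] by simp
    ultimately show "\<exists>n\<ge>N. \<exists>y\<in>A n. dist y l < \<epsilon>" using a'(1) by blast
  qed
  then obtain s where s: "s \<in> {0..1}" "l = of_real s"
    using \<open>B \<subseteq> closed_segment 0 1\<close> by (auto simp: closed_segment_def scaleR_conv_of_real)
  obtain n where "dist (a (r n)) l < \<eta>"
    using l(2) \<eta> unfolding lim_sequentially by auto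
  then have "near_unit \<eta> (a (r n))" using s by (auto simp: near_unit_def dist_norm)
  with a'(2) show False by blast
qed

section \<open>Cylinders\<close>

text \<open>For positive \<open>L\<close>, a half-open interval of length L^(-n) that the n-th
  iterate of \<open>E\<close> maps bijectively onto the circle. The floor makes membership an
  equivalence relation.\<close>

definition cyl :: "nat \<Rightarrow> nat \<Rightarrow> real \<Rightarrow> real set" where
  "cyl L n x = {y. \<lfloor>real L ^ n * y\<rfloor> = \<lfloor>real L ^ n * x\<rfloor>}"

lemma cyl_self [simp]: "x \<in> cyl L n x"
  by (simp add: cyl_def)

lemma cyl_dist: "y \<in> cyl L n x \<Longrightarrow> real L ^ n * \<bar>x - y\<bar> \<le> 1"
proof -
  assume "y \<in> cyl L n x"
  then have "\<lfloor>real L ^ n * y\<rfloor> = \<lfloor>real L ^ n * x\<rfloor>" by (simp add: cyl_def)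
  then have "\<bar>real L ^ n * x - real L ^ n * y\<bar> \<le> 1" by linarith
  then show ?thesis by (simp add: abs_mult flip: right_diff_distrib)
qed

lemma cyl_dist_le:
  assumes "y \<in> cyl L n x" "k \<le> n" "L > 0"
  shows "real L ^ k * \<bar>x - y\<bar> \<le> 1 / real L ^ (n - k)"
proof -
  have "real L ^ n = real L ^ k * real L ^ (n - k)"
    using assms by (simp flip: power_add)
  then show ?thesis
    using cyl_dist[OF assms(1)] assms(3) by (simp add: field_simps)
qed

lemma floor_mult_nat_eqD:
  fixes a b :: real
  assumes "\<lfloor>real m * a\<rfloor> = \<lfloor>real m * b\<rfloor>" "m > 0"
  shows "\<lfloor>a\<rfloor> = \<lfloor>b\<rfloor>"
proof -
  have "\<lfloor>real m * a\<rfloor> div int m = \<lfloor>a\<rfloor>" for a :: real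
    using floor_divide_real_eq_div[of "int m" "real m * a"] assms(2) by simp
  with assms(1) show ?thesis by metis
qed

lemma cyl_mono:
  assumes "y \<in> cyl L n x" "k \<le> n" "L > 0"
  shows "y \<in> cyl L k x"
proof -
  have "real L ^ n = real (L ^ (n - k)) * real L ^ k"
    using assms by (simp flip: power_add)
  then have "\<lfloor>real (L ^ (n - k)) * (real L ^ k * y)\<rfloor> = \<lfloor>real (L ^ (n - k)) * (real L ^ k * x)\<rfloor>"
    using assms(1) by (simp add: cyl_def mult.assoc)
  from floor_mult_nat_eqD[OF this] show ?thesis using assms by (simp add: cyl_def)
qed

lemma cyl_trans: "y \<in> cyl L n x \<Longrightarrow> w \<in> cyl L n y \<Longrightarrow> w \<in> cyl L n x"
  by (simp add: cyl_def)

text \<open>Every branch is full: inside any cylinder of order n the base point at time n can be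
  prescribed.\<close>

lemma cyl_target:
  fixes x t :: real and n L :: nat
  assumes "L > 0" "0 \<le> t" "t < 1"
  defines "y \<equiv> (of_int \<lfloor>real L ^ n * x\<rfloor> + t) / real L ^ n"
  shows "y \<in> cyl L n x" "real L ^ n * y - t \<in> \<int>"
proof -
  have e: "real L ^ n * y = of_int \<lfloor>real L ^ n * x\<rfloor> + t"
    using assms by (simp add: y_def)
  show "real L ^ n * y - t \<in> \<int>" by (simp add: e)
  show "y \<in> cyl L n x" using assms(2,3) by (simp add: cyl_def e floor_eq_iff)
qed

lemma small_cyl:
  assumes "\<epsilon> > 0" "L \<ge> 2"
  obtains q where "q \<ge> k" "\<And>y. y \<in> cyl L q x \<Longrightarrow> \<bar>y - x\<bar> < \<epsilon>"
proof -
  obtain p where p: "1 / \<epsilon> < real L ^ p" using real_arch_pow[of "real L"] assms by auto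
  have "\<bar>y - x\<bar> < \<epsilon>" if "y \<in> cyl L (max p k) x" for y
  proof -
    have "y \<in> cyl L p x" using cyl_mono[OF that] assms by auto
    from cyl_dist[OF this] have "real L ^ p * \<bar>y - x\<bar> \<le> 1" by (simp add: abs_minus_commute)
    also have "1 < real L ^ p * \<epsilon>" using p assms by (simp add: field_simps)
    finally show ?thesis using assms by simp
  qed
  with that[of "max p k"] show ?thesis by auto
qed

section \<open>Confined orbits\<close>

lemma quad_diff: "quad b z - quad b w = (z - w) * (1 + b * (1 - z - w))"
  by (simp add: quad_def algebra_simps)

lemma quad_lipschitz:
  assumes "cmod b \<le> 1" "cmod z \<le> R" "cmod w \<le> R"
  shows "cmod (quad b z - quad b w) \<le> (2 + 2 * R) * cmod (z - w)"
proof -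
  have "cmod (1 + b * (1 - z - w)) \<le> 1 + cmod b * cmod (1 - z - w)"
    by (metis norm_mult norm_one norm_triangle_ineq)
  also have "cmod (1 - z - w) \<le> 1 + R + R"
    using norm_triangle_ineq4[of "1 - z" w] norm_triangle_ineq4[of 1 z] assms by simp
  then have "cmod b * cmod (1 - z - w) \<le> 1 * (1 + R + R)"
    using assms by (intro mult_mono) auto
  finally show ?thesis
    unfolding quad_diff norm_mult by (simp add: mult.commute mult_left_mono)
qed

text \<open>The Lipschitz constants in the base direction satisfy k(n+1) <= (2 + 2R) k(n) + 7 R (1 +
  R) L^n, hence grow like L^n once \<open>L\<close> beats the fibre expansion 2 + 2R. Cylinders of
  order n have length L^(-n), so orbits vary over them by at most \<open>\<kappa>\<close>, which can
  be taken of order 1/L.\<close>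

lemma orb_lipschitz:
  assumes a: "cmod \<alpha> \<le> 1" and R: "R \<ge> 0" and \<kappa>: "\<kappa> \<ge> 0" "7 * R * (1 + R) + (2 + 2 * R) * \<kappa> \<le> \<kappa> * real L"
    and bd: "\<And>k y. k < n \<Longrightarrow> y \<in> J \<Longrightarrow> cmod (orb \<alpha> L k y z) \<le> R"
    and xy: "x \<in> J" "y \<in> J"
  shows "cmod (orb \<alpha> L n x z - orb \<alpha> L n y z) \<le> \<kappa> * (real L ^ n * \<bar>x - y\<bar>)"
  using bd
proof (induction n)
  case (Suc n)
  let ?d = "real L ^ n * \<bar>x - y\<bar>"
  let ?b = "\<lambda>x. param \<alpha> (real L ^ n * x)"
  let ?z = "\<lambda>x. orb \<alpha> L n x z"
  have IH: "cmod (?z x - ?z y) \<le> \<kappa> * ?d" using Suc by auto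
  have R1: "cmod (?z x) \<le> R" "cmod (?z y) \<le> R" using Suc.prems xy by auto
  have "quad (?b x) (?z x) - quad (?b y) (?z y) =
      (quad (?b x) (?z x) - quad (?b x) (?z y)) + (?b x - ?b y) * (?z y * (1 - ?z y))"
    by (simp add: quad_def algebra_simps)
  then have "cmod (quad (?b x) (?z x) - quad (?b y) (?z y)) \<le>
      cmod (quad (?b x) (?z x) - quad (?b x) (?z y)) + cmod (?b x - ?b y) * (cmod (?z y) * cmod (1 - ?z y))"
    by (metis norm_mult norm_triangle_ineq)
  moreover have "cmod (quad (?b x) (?z x) - quad (?b x) (?z y)) \<le> (2 + 2 * R) * (\<kappa> * ?d)"
  proof -
    have "cmod (quad (?b x) (?z x) - quad (?b x) (?z y)) \<le> (2 + 2 * R) * cmod (?z x - ?z y)"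
      using order_trans[OF norm_param_le a] R1 by (intro quad_lipschitz)
    also have "\<dots> \<le> (2 + 2 * R) * (\<kappa> * ?d)" using IH R by (intro mult_left_mono) auto
    finally show ?thesis .
  qed
  moreover have "cmod (?b x - ?b y) * (cmod (?z y) * cmod (1 - ?z y)) \<le> (7 * ?d) * (R * (1 + R))"
  proof (intro mult_mono)
    have "cmod (?b x - ?b y) \<le> cmod \<alpha> * (7 * \<bar>real L ^ n * x - real L ^ n * y\<bar>)"
      by (rule norm_param_diff_le)
    also have "\<bar>real L ^ n * x - real L ^ n * y\<bar> = ?d"
      by (simp add: abs_mult flip: right_diff_distrib)
    also have "cmod \<alpha> * (7 * ?d) \<le> 1 * (7 * ?d)" using a by (intro mult_right_mono) auto
    finally show "cmod (?b x - ?b y) \<le> 7 * ?d" by simp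
    show "cmod (1 - ?z y) \<le> 1 + R" using norm_triangle_ineq4[of 1 "?z y"] R1 by simp
  qed (use R R1 in auto)
  ultimately have "cmod (quad (?b x) (?z x) - quad (?b y) (?z y)) \<le>
      (7 * R * (1 + R) + (2 + 2 * R) * \<kappa>) * ?d" by (simp add: algebra_simps)
  also have "\<dots> \<le> \<kappa> * real L * ?d" using \<kappa> by (intro mult_right_mono) auto
  finally show ?case by (simp add: mult_ac)
qed (use \<kappa> in simp)

text \<open>Below r the norm grows by the factor \<open>\<mu>\<close>, so it must reach r; at the
  first such time it comes from below r and cannot overshoot 3r.\<close>

lemma expel:
  fixes g :: "'a \<Rightarrow> 'a" and N :: "'a \<Rightarrow> real"
  assumes \<mu>: "\<mu> > 1" and grow: "\<And>w. N w < r \<Longrightarrow> N (g w) \<ge> \<mu> * N w"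
    and slow: "\<And>w. N w < r \<Longrightarrow> N (g w) \<le> 3 * r" and w: "N w > 0" "N w \<le> 3 * r"
  shows "\<exists>j. r \<le> N ((g ^^ j) w) \<and> N ((g ^^ j) w) \<le> 3 * r"
proof -
  have "\<exists>j. r \<le> N ((g ^^ j) w)"
  proof (rule ccontr)
    assume "\<not> ?thesis"
    then have lt: "N ((g ^^ j) w) < r" for j by (simp add: not_le)
    have "N ((g ^^ j) w) \<ge> \<mu> ^ j * N w" for j
    proof (induction j)
      case (Suc j)
      have "\<mu> ^ Suc j * N w = \<mu> * (\<mu> ^ j * N w)" by simp
      also have "\<dots> \<le> \<mu> * N ((g ^^ j) w)" using Suc \<mu> by (intro mult_left_mono) auto
      also have "\<dots> \<le> N ((g ^^ Suc j) w)" using grow[OF lt] by simp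
      finally show ?case .
    qed simp
    moreover obtain j where "r / N w < \<mu> ^ j" using real_arch_pow[OF \<mu>] by blast
    ultimately have "r / N w * N w < N ((g ^^ j) w)"
      using mult_strict_right_mono[of "r / N w" "\<mu> ^ j" "N w"] w(1) less_le_trans by blast
    with lt[of j] w show False by simp
  qed
  then obtain j where j: "r \<le> N ((g ^^ j) w)" "\<And>i. i < j \<Longrightarrow> N ((g ^^ i) w) < r"
    using exists_least_iff[of "\<lambda>j. r \<le> N ((g ^^ j) w)"] by (metis not_le)
  show ?thesis
  proof (cases j)
    case 0
    then show ?thesis using j(1) w by (intro exI[of _ 0]) auto
  next
    case (Suc i)
    then show ?thesis using j slow[OF j(2)[of i]] by (intro exI[of _ j]) auto
  qed
qed

text \<open>
  The situation to be refuted: over a whole cylinder around \<open>x1\<close>, the orbits of a single point \<open>z\<close>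
  stay bounded and never meet the fixed points 0 and 1.
\<close>

locale confined =
  fixes \<alpha> :: complex and L q :: nat and x0 x1 \<kappa> R r \<mu> :: real and z :: complex
  assumes L: "L \<ge> 14" and a: "\<alpha> \<noteq> 0" "cmod \<alpha> < 1" and R: "R \<ge> 0"
    and \<kappa>: "\<kappa> \<ge> 0" "7 * R * (1 + R) + (2 + 2 * R) * \<kappa> \<le> \<kappa> * real L" "\<kappa> \<le> r / 2"
    and x0: "0 \<le> x0" "x0 < 1" "real L * x0 - x0 \<in> \<int>"
    and x1: "0 \<le> x1" "x1 < 1" "real L * x1 - x1 \<in> \<int>"
    and r: "0 < r" "r < 1/4" and \<mu>: "\<mu> > 1"
    and expel0: "\<And>w. cmod w < r \<Longrightarrow> cmod (quad (param \<alpha> x1) w) \<ge> \<mu> * cmod w"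
    and expel1: "\<And>w. cmod (w - 1) < r \<Longrightarrow> cmod (quad (param \<alpha> x0) w - 1) \<ge> \<mu> * cmod (w - 1)"
    and bd: "\<And>k x. x \<in> cyl L q x1 \<Longrightarrow> cmod (orb \<alpha> L k x z) \<le> R"
    and no_hit: "\<And>k x. x \<in> cyl L q x1 \<Longrightarrow> orb \<alpha> L k x z \<noteq> 0 \<and> orb \<alpha> L k x z \<noteq> 1"
begin

lemma param_le1: "cmod (param \<alpha> x) \<le> 1"
  using norm_param_le[of \<alpha> x] a by simp

lemma orb_cyl_close:
  assumes "x \<in> cyl L q x1" "y \<in> cyl L q x1" "y \<in> cyl L k x"
  shows "dist (orb \<alpha> L k x z) (orb \<alpha> L k y z) \<le> \<kappa>"
proof -
  have "cmod (orb \<alpha> L k x z - orb \<alpha> L k y z) \<le> \<kappa> * (real L ^ k * \<bar>x - y\<bar>)"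
    using assms a R \<kappa> bd by (intro orb_lipschitz[where J = "cyl L q x1"]) auto
  also have "\<dots> \<le> \<kappa>" using cyl_dist[OF assms(3)] \<kappa>(1) by (simp add: mult_left_le)
  finally show ?thesis by (simp add: dist_norm)
qed

text \<open>Steering: from time q on, the base point may be moved anywhere while the value in the
  fibre changes by at most \<open>\<kappa>\<close>.\<close>

lemma orb_target:
  assumes "x \<in> cyl L q x1" "k \<ge> q" "0 \<le> t" "t < 1"
  obtains y where "y \<in> cyl L k x" "y \<in> cyl L q x1" "real L ^ k * y - t \<in> \<int>"
    "dist (orb \<alpha> L k x z) (orb \<alpha> L k y z) \<le> \<kappa>"
proof -
  obtain y where y: "y \<in> cyl L k x" "real L ^ k * y - t \<in> \<int>"
    using cyl_target[of L t k x] assms L by auto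
  have "y \<in> cyl L q x1"
    using cyl_mono[OF y(1) assms(2)] cyl_trans[OF assms(1)] L by auto
  with that y orb_cyl_close assms show ?thesis by blast
qed

text \<open>Only times from \<open>q\<close> on count: from then on a cylinder of order k stays
  inside the given one, so steering is unrestricted.\<close>

definition reach :: "complex set" where
  "reach = {orb \<alpha> L k x z | k x. q \<le> k \<and> x \<in> cyl L q x1}"

lemma reach_almost_invariant:
  assumes "w \<in> reach" "b \<in> {\<alpha>, - \<alpha>}"
  shows "\<exists>w'\<in>reach. dist w' (quad b w) \<le> (2 + 2 * R) * \<kappa>"
proof -
  obtain k x where kx: "w = orb \<alpha> L k x z" "q \<le> k" "x \<in> cyl L q x1"
    using assms by (auto simp: reach_def)
  \<comment> \<open>The parameters \<open>\<alpha>\<close> and \<open>- \<alpha>\<close> occur over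
    0 and 1/2.\<close>
  obtain t where t: "0 \<le> t" "t < 1" "param \<alpha> t = b"
  proof (cases "b = \<alpha>")
    case True
    with that[of 0] show ?thesis by (simp add: param_def)
  next
    case False
    with that[of "1/2"] assms show ?thesis by (simp add: param_def)
  qed
  obtain y where y: "y \<in> cyl L q x1" "real L ^ k * y - t \<in> \<int>"
      "dist (orb \<alpha> L k x z) (orb \<alpha> L k y z) \<le> \<kappa>"
    using orb_target[OF kx(3,2) t(1,2)] by blast
  have "orb \<alpha> L (Suc k) y z = quad b (orb \<alpha> L k y z)"
    using param_cong[OF y(2)] t by simp
  moreover have "orb \<alpha> L (Suc k) y z \<in> reach"
    using y kx unfolding reach_def by (intro CollectI exI[of _ "Suc k"] exI[of _ y]) auto
  moreover have "dist (quad b (orb \<alpha> L k y z)) (quad b w) \<le> (2 + 2 * R) * \<kappa>"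
  proof -
    have "cmod b \<le> 1" using param_le1[of t] t by simp
    then have "dist (quad b (orb \<alpha> L k y z)) (quad b w) \<le> (2 + 2 * R) * dist (orb \<alpha> L k y z) w"
      unfolding dist_norm kx(1) using bd kx y by (intro quad_lipschitz) auto
    also have "\<dots> \<le> (2 + 2 * R) * \<kappa>"
      using y(3) R by (intro mult_left_mono) (auto simp: kx dist_commute)
    finally show ?thesis .
  qed
  ultimately show ?thesis by metis
qed

lemma orb_at_fixed:
  assumes "real L ^ k * y - t \<in> \<int>" "real L * t - t \<in> \<int>"
  shows "orb \<alpha> L (k + j) y z = (quad (param \<alpha> t) ^^ j) (orb \<alpha> L k y z)"
  using orb_fixed[OF assms(2,1)] by (simp add: orb_add)

lemma cyl_deep: "y \<in> cyl L k x \<Longrightarrow> x \<in> cyl L q x1 \<Longrightarrow> q \<le> k \<Longrightarrow> y \<in> cyl L q x1"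
  using cyl_mono[of y L k x q] cyl_trans L by auto

text \<open>A point close to 0 is steered onto the fixed fibre \<open>x1\<close>, where 0 repels,
  and a point close to 1 onto \<open>x0\<close>, where 1 repels; there it is iterated until it
  leaves the r-ball. By \<open>no_hit\<close> it does not sit on the fixed point.\<close>

lemma reach_middle:
  assumes x: "x \<in> cyl L q x1" and k: "k \<ge> q"
  obtains k' x' where "k' \<ge> k" "x' \<in> cyl L k x"
    "r \<le> cmod (orb \<alpha> L k' x' z)" "r \<le> cmod (orb \<alpha> L k' x' z - 1)"
proof -
  let ?w = "orb \<alpha> L k x z"
  \<comment> \<open>The threshold 2r leaves room for the steering error, at most r/2, within the 3r
    that \<open>expel\<close> admits. As r < 1/4, points within 3r of one fixed point stay at
    distance at least r from the other.\<close>
  consider "cmod ?w < 2 * r" | "cmod (?w - 1) < 2 * r" | "r \<le> cmod ?w" "r \<le> cmod (?w - 1)"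
    using r by linarith
  then show ?thesis
  proof cases
    case 1
    obtain y where y: "y \<in> cyl L k x" "y \<in> cyl L q x1" "real L ^ k * y - x1 \<in> \<int>"
        "dist ?w (orb \<alpha> L k y z) \<le> \<kappa>"
      using orb_target[OF x k x1(1,2)] by blast
    let ?v = "orb \<alpha> L k y z"
    have "cmod ?v \<le> 3 * r"
      using norm_triangle_ineq2[of ?v ?w] 1 y(4) \<kappa> r by (simp add: dist_norm norm_minus_commute)
    moreover have "cmod (quad (param \<alpha> x1) w) \<le> 3 * r" if "cmod w < r" for w
    proof -
      have "cmod (quad (param \<alpha> x1) w - quad (param \<alpha> x1) 0) \<le> (2 + 2 * r) * cmod (w - 0)"
        using param_le1 that r by (intro quad_lipschitz) auto
      also have "\<dots> \<le> 3 * r" using that r by (intro mult_mono) auto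
      finally show ?thesis by simp
    qed
    ultimately obtain j where j: "r \<le> cmod ((quad (param \<alpha> x1) ^^ j) ?v)"
        "cmod ((quad (param \<alpha> x1) ^^ j) ?v) \<le> 3 * r"
      using expel[of \<mu> cmod r "quad (param \<alpha> x1)" ?v] \<mu> expel0 no_hit[OF y(2)] by auto
    have "r \<le> cmod ((quad (param \<alpha> x1) ^^ j) ?v - 1)"
      using norm_triangle_ineq3[of "(quad (param \<alpha> x1) ^^ j) ?v" 1] j(2) r by auto
    with j(1) that[of "k + j" y] y(1) show ?thesis
      by (auto simp: orb_at_fixed[OF y(3) x1(3)])
  next
    case 2
    obtain y where y: "y \<in> cyl L k x" "y \<in> cyl L q x1" "real L ^ k * y - x0 \<in> \<int>"
        "dist ?w (orb \<alpha> L k y z) \<le> \<kappa>"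
      using orb_target[OF x k x0(1,2)] by blast
    let ?v = "orb \<alpha> L k y z"
    have "cmod (?v - 1) \<le> 3 * r"
      using norm_triangle_ineq[of "?v - ?w" "?w - 1"] 2 y(4) \<kappa> r
      by (simp add: dist_norm norm_minus_commute)
    moreover have "cmod (quad (param \<alpha> x0) w - 1) \<le> 3 * r" if w: "cmod (w - 1) < r" for w
    proof -
      have "cmod (1 - param \<alpha> x0 * w) \<le> 1 + 1 * (1 + r)"
      proof -
        have "cmod w \<le> 1 + r" using w norm_triangle_ineq[of "w - 1" 1] by simp
        then have "cmod (param \<alpha> x0) * cmod w \<le> 1 * (1 + r)"
          using param_le1 r by (intro mult_mono) auto
        then show ?thesis using norm_triangle_ineq4[of 1 "param \<alpha> x0 * w"] by (simp add: norm_mult)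
      qed
      then have "cmod (w - 1) * cmod (1 - param \<alpha> x0 * w) \<le> r * 3"
        using w r by (intro mult_mono) auto
      then show ?thesis by (simp add: quad_minus_1 norm_mult mult.commute)
    qed
    ultimately obtain j where j: "r \<le> cmod ((quad (param \<alpha> x0) ^^ j) ?v - 1)"
        "cmod ((quad (param \<alpha> x0) ^^ j) ?v - 1) \<le> 3 * r"
      using expel[of \<mu> "\<lambda>w. cmod (w - 1)" r "quad (param \<alpha> x0)" ?v] \<mu> expel1 no_hit[OF y(2)] by auto
    have "r \<le> cmod ((quad (param \<alpha> x0) ^^ j) ?v)"
      using norm_triangle_ineq[of "1 - (quad (param \<alpha> x0) ^^ j) ?v" "(quad (param \<alpha> x0) ^^ j) ?v"]
        j(2) r by (simp add: norm_minus_commute)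
    with j(1) that[of "k + j" y] y(1) show ?thesis
      by (auto simp: orb_at_fixed[OF y(3) x0(3)])
  next
    case 3
    with that[of k x] show ?thesis by auto
  qed
qed

end

lemma near_unit_imp:
  assumes "near_unit \<eta> w"
  shows "\<bar>Im w\<bar> < \<eta>" "- \<eta> < Re w" "Re w < 1 + \<eta>"
proof -
  obtain s where s: "0 \<le> s" "s \<le> 1" "cmod (w - of_real s) < \<eta>"
    using assms by (auto simp: near_unit_def)
  have "\<bar>Re (w - of_real s)\<bar> < \<eta>" "\<bar>Im (w - of_real s)\<bar> < \<eta>"
    using s(3) abs_Re_le_cmod abs_Im_le_cmod le_less_trans by blast+
  then show "\<bar>Im w\<bar> < \<eta>" "- \<eta> < Re w" "Re w < 1 + \<eta>" using s by auto
qed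

lemma near_unit_middle:
  assumes "near_unit \<eta> w" "r \<le> cmod w" "r \<le> cmod (w - 1)" "\<eta> \<le> r / 2" "0 < r"
  obtains s where "cmod (w - of_real s) < \<eta>" "0 \<le> s" "s \<le> 1" "r / 4 \<le> s * (1 - s)"
proof -
  obtain s where s: "0 \<le> s" "s \<le> 1" "cmod (w - of_real s) < \<eta>"
    using assms by (auto simp: near_unit_def)
  have "cmod w \<le> cmod (w - of_real s) + s"
    using norm_triangle_ineq[of "w - of_real s" "of_real s"] s by simp
  then have 1: "s \<ge> r / 2" using assms s by linarith
  have "cmod (w - 1) \<le> cmod (w - of_real s) + (1 - s)"
    using norm_triangle_ineq[of "w - of_real s" "of_real (s - 1)"] s
    by (simp add: norm_of_real abs_if del: of_real_diff) (auto simp: algebra_simps split: if_splits)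
  then have 2: "1 - s \<ge> r / 2" using assms s by linarith
  have "r / 4 \<le> s * (1 - s)"
  proof (cases "s \<le> 1/2")
    case True
    then have "(r/2) * (1/2) \<le> s * (1 - s)" using 1 s assms by (intro mult_mono) auto
    then show ?thesis by simp
  next
    case False
    then have "(1/2) * (r/2) \<le> s * (1 - s)" using 2 s assms by (intro mult_mono) auto
    then show ?thesis by simp
  qed
  with that s show ?thesis by blast
qed

section \<open>Quadratic maps with real parameter near the unit interval\<close>

text \<open>
  If \<open>Im z > 0\<close> then \<open>cot_angle z = cot (arg (z / (1 - z)))\<close>; the argument increases under every
  quadratic map with real parameter.
\<close>

definition unit_power :: "complex \<Rightarrow> real" where
  "unit_power z = Re z - (Re z)\<^sup>2 - (Im z)\<^sup>2"

text \<open>Numerator and denominator are the real and imaginary parts of z * cnj (1 - z), which for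
  z other than 1 is a positive multiple of z / (1 - z).\<close>

definition cot_angle :: "complex \<Rightarrow> real" where
  "cot_angle z = unit_power z / Im z"

lemma Im_quad_real:
  "Im (quad (of_real b) z) = Im z * (1 + b - 2 * b * Re z)"
  by (simp add: quad_def algebra_simps)

lemma unit_power_quad_real:
  "unit_power (quad (of_real b) z) =
     unit_power z * ((1 + b - b * Re z) * (1 - b * Re z) + (b * Im z)\<^sup>2) - (b * Im z)\<^sup>2"
  by (simp add: quad_def unit_power_def) algebra

text \<open>Near [0, 1] the factor multiplying the imaginary part stays positive, so the upper
  half-plane is preserved. Cross-multiplying the two cotangents leaves minus a product of
  nonnegative terms.\<close>

lemma quad_real_near_unit:
  assumes "\<bar>b\<bar> \<le> a" "a < 1" "near_unit \<eta> z" "\<eta> \<le> (1 - a) / 4" "Im z > 0"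
  shows "Im (quad (of_real b) z) > 0" "cot_angle (quad (of_real b) z) \<le> cot_angle z"
proof -
  note z = near_unit_imp[OF assms(3)]
  have "\<bar>b * (1 - 2 * Re z)\<bar> \<le> a * (1 + 2 * \<eta>)"
    unfolding abs_mult using assms z by (intro mult_mono) auto
  also have "\<dots> < 1"
  proof -
    have "a * (1 + 2 * \<eta>) \<le> a * (1 + (1 - a) / 2)"
      using assms by (intro mult_left_mono) auto
    also have "\<dots> < 1"
    proof -
      have "0 < (1 - a) * (2 - a)" using assms by simp
      then show ?thesis by (simp add: field_simps)
    qed
    finally show ?thesis .
  qed
  finally have pos: "0 < 1 + b - 2 * b * Re z" by (simp add: algebra_simps abs_less_iff)
  with assms show im: "Im (quad (of_real b) z) > 0" by (simp add: Im_quad_real)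
  have "unit_power (quad (of_real b) z) * Im z - unit_power z * Im (quad (of_real b) z) =
      - (Im z * b\<^sup>2 * ((Im z)\<^sup>2 + (unit_power z)\<^sup>2))"
    unfolding unit_power_quad_real Im_quad_real
    by (simp add: unit_power_def) algebra
  also have "\<dots> \<le> 0" using assms by simp
  finally show "cot_angle (quad (of_real b) z) \<le> cot_angle z"
    using im assms by (simp add: cot_angle_def frac_le_eq divide_le_0_iff)
qed

text \<open>Away from 0 and 1 the decrease is quantitative: numerator and denominator of the new
  cotangent share the factor \<open>P\<close>, and the denominator gains b^2 times
  \<open>unit_power z\<close>.\<close>

lemma quad_real_contracts:
  assumes b: "\<bar>b\<bar> \<le> 1" and near: "near_unit \<eta> z" "\<eta> \<le> 1 / 10"
    and im: "Im z > 0" "Im (quad (of_real b) z) > 0" and X: "0 < X" "X \<le> unit_power z"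
  shows "cot_angle (quad (of_real b) z) \<le> cot_angle z / (1 + b\<^sup>2 * X / 5)"
proof -
  note z = near_unit_imp[OF near(1)]
  define P where "P = (1 + b - b * Re z) * (1 - b * Re z) + (b * Im z)\<^sup>2"
  have imq: "Im (quad (of_real b) z) = Im z * (P + b\<^sup>2 * unit_power z)"
    unfolding Im_quad_real P_def unit_power_def by algebra
  have Pu: "P + b\<^sup>2 * unit_power z > 0"
    using im unfolding imq by (simp add: zero_less_mult_iff)
  have "\<bar>1 + b - b * Re z\<bar> \<le> 2.1"
  proof -
    have "\<bar>1 - Re z\<bar> \<le> 1.1" using z near(2) by linarith
    then have "\<bar>b * (1 - Re z)\<bar> \<le> 1 * 1.1" unfolding abs_mult using b by (intro mult_mono) auto
    then show ?thesis unfolding right_diff_distrib by linarith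
  qed
  moreover have "\<bar>1 - b * Re z\<bar> \<le> 2.1"
  proof -
    have "\<bar>Re z\<bar> \<le> 1.1" using z near(2) by linarith
    then have "\<bar>b * Re z\<bar> \<le> 1 * 1.1" unfolding abs_mult using b by (intro mult_mono) auto
    then show ?thesis by linarith
  qed
  ultimately have "\<bar>(1 + b - b * Re z) * (1 - b * Re z)\<bar> \<le> 2.1 * 2.1"
    unfolding abs_mult by (intro mult_mono) auto
  moreover have "(b * Im z)\<^sup>2 \<le> 0.1"
  proof -
    have "\<bar>b * Im z\<bar> \<le> 1 * 0.1" unfolding abs_mult using b z near by (intro mult_mono) auto
    then have "(b * Im z)\<^sup>2 \<le> 0.1\<^sup>2" by (metis abs_le_square_iff abs_of_nonneg mult_1 zero_le_divide_1_iff zero_le_numeral divide_nonneg_nonneg)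
    then show ?thesis by (simp add: power2_eq_square)
  qed
  \<comment> \<open>2.1 * 2.1 + 0.1 = 4.51.\<close>
  ultimately have P5: "P \<le> 5" unfolding P_def by linarith
  have "P * (5 + b\<^sup>2 * X) \<le> 5 * (P + b\<^sup>2 * unit_power z)"
  proof -
    have "P * (b\<^sup>2 * X) \<le> 5 * (b\<^sup>2 * unit_power z)"
      using P5 X by (intro mult_mono mult_left_mono) auto
    then show ?thesis by (simp add: algebra_simps)
  qed
  then have q: "P / (P + b\<^sup>2 * unit_power z) \<le> 1 / (1 + b\<^sup>2 * X / 5)"
    using Pu X by (simp add: field_simps add_pos_nonneg)
  have "cot_angle (quad (of_real b) z) = (unit_power z * P - (b * Im z)\<^sup>2) / (Im z * (P + b\<^sup>2 * unit_power z))"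
    by (simp only: cot_angle_def imq unit_power_quad_real P_def)
  also have "\<dots> \<le> (unit_power z * P) / (Im z * (P + b\<^sup>2 * unit_power z))"
    using Pu im by (intro divide_right_mono) auto
  also have "\<dots> = cot_angle z * (P / (P + b\<^sup>2 * unit_power z))"
    by (simp add: cot_angle_def)
  also have "\<dots> \<le> cot_angle z * (1 / (1 + b\<^sup>2 * X / 5))"
    using q im X by (intro mult_left_mono) (auto simp: cot_angle_def)
  finally show ?thesis by simp
qed

text \<open>At a real s the value is s (1 - s), at least r/4 in the middle; passing from s to w
  costs at most 3 \<open>\<eta>\<close>, hence at most 3r/32.\<close>

lemma unit_power_middle:
  assumes "near_unit \<eta> w" "r \<le> cmod w" "r \<le> cmod (w - 1)" "0 < r" "r \<le> 1" "\<eta> \<le> r / 32" 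
  shows "r / 16 \<le> unit_power w"
proof -
  obtain s where s: "cmod (w - of_real s) < \<eta>" "0 \<le> s" "s \<le> 1" "r / 4 \<le> s * (1 - s)"
    using near_unit_middle[OF assms(1-3)] assms by auto
  define d where "d = Re w - s"
  have d: "\<bar>d\<bar> \<le> \<eta>" using abs_Re_le_cmod[of "w - of_real s"] s by (simp add: d_def)
  have e: "\<bar>Im w\<bar> \<le> \<eta>" using abs_Im_le_cmod[of "w - of_real s"] s by simp
  have "d\<^sup>2 \<le> \<eta>\<^sup>2" "(Im w)\<^sup>2 \<le> \<eta>\<^sup>2" using d e by (metis abs_le_square_iff abs_of_nonneg abs_ge_zero order_trans)+
  moreover have "\<eta>\<^sup>2 \<le> \<eta>"
  proof -
    have "0 \<le> \<eta>" using d by linarith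
    then show ?thesis unfolding power2_eq_square using assms by (intro mult_left_le) auto
  qed
  moreover have "\<bar>d * (1 - 2 * s)\<bar> \<le> \<eta> * 1"
    unfolding abs_mult using d s by (intro mult_mono) auto
  moreover have "unit_power w = s * (1 - s) + d * (1 - 2 * s) - d\<^sup>2 - (Im w)\<^sup>2"
    unfolding unit_power_def d_def by algebra
  ultimately show ?thesis using s(4) assms by (simp add: abs_le_iff)
qed

section \<open>No orbit tube is confined to a neighbourhood of the unit interval\<close>

context confined
begin

text \<open>At a point close to a real s in the middle of [0, 1], the map with parameter
  \<open>\<alpha>\<close> produces an imaginary part close to s (1 - s) times that of
  \<open>\<alpha>\<close>, too large for \<open>near_unit\<close>.\<close>

lemma not_near_unit_nonreal:
  assumes near: "\<And>w. w \<in> reach \<Longrightarrow> near_unit \<eta> w"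
    and small: "(2 + 2 * R) * \<kappa> \<le> \<eta>" "28 * \<eta> \<le> \<bar>Im \<alpha>\<bar> * r" "\<eta> \<le> r / 2" "\<eta> \<le> 1/4"
  shows False
proof -
  obtain k x where kx: "k \<ge> q" "x \<in> cyl L q x1"
      and m: "r \<le> cmod (orb \<alpha> L k x z)" "r \<le> cmod (orb \<alpha> L k x z - 1)"
    using reach_middle[of x1 q] cyl_deep by (metis cyl_self order_refl)
  let ?w = "orb \<alpha> L k x z"
  have w: "?w \<in> reach" using kx by (auto simp: reach_def)
  have nw: "near_unit \<eta> ?w" using near w by blast
  obtain s where s: "cmod (?w - of_real s) < \<eta>" "0 \<le> s" "s \<le> 1" "r / 4 \<le> s * (1 - s)"
    using near_unit_middle[OF nw m] small r by auto
  obtain w' where w': "w' \<in> reach" "dist w' (quad \<alpha> ?w) \<le> (2 + 2 * R) * \<kappa>"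
    using reach_almost_invariant[OF w, of \<alpha>] by auto
  have "\<bar>Im w'\<bar> < \<eta>" using near_unit_imp[OF near[OF w'(1)]] by auto
  moreover have "\<bar>Im w' - Im (quad \<alpha> ?w)\<bar> \<le> \<eta>"
    using w'(2) small(1) abs_Im_le_cmod[of "w' - quad \<alpha> ?w"] by (simp add: dist_norm)
  ultimately have 1: "\<bar>Im (quad \<alpha> ?w)\<bar> < 2 * \<eta>" by linarith
  have lip: "cmod (quad \<alpha> ?w - quad \<alpha> (of_real s)) \<le> (2 + 2 * (5/4)) * cmod (?w - of_real s)"
  proof (rule quad_lipschitz)
    show "cmod ?w \<le> 5/4"
      using norm_triangle_ineq[of "?w - of_real s" "of_real s"] s small by simp
  qed (use a s in auto)
  have "cmod (quad \<alpha> ?w - quad \<alpha> (of_real s)) \<le> 9/2 * cmod (?w - of_real s)"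
    using lip by simp
  then have "\<bar>Im (quad \<alpha> ?w - quad \<alpha> (of_real s))\<bar> < 9/2 * \<eta>"
    using s(1) abs_Im_le_cmod[of "quad \<alpha> ?w - quad \<alpha> (of_real s)"] by linarith
  \<comment> \<open>2 from near invariance, 9/2 from the Lipschitz constant; the 28 of the
    hypothesis, divided by the 4 in r/4, gives 7 on the other side.\<close>
  with 1 have "\<bar>Im (quad \<alpha> (of_real s))\<bar> < 6.5 * \<eta>"
    unfolding minus_complex.sel by linarith
  moreover have "Im (quad \<alpha> (of_real s)) = Im \<alpha> * (s * (1 - s))"
    by (simp add: quad_def)
  ultimately have "\<bar>Im \<alpha>\<bar> * (s * (1 - s)) < 6.5 * \<eta>"
    using s by (simp add: abs_mult)
  moreover have "\<bar>Im \<alpha>\<bar> * (r / 4) \<le> \<bar>Im \<alpha>\<bar> * (s * (1 - s))"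
    using s by (intro mult_left_mono) auto
  moreover have "0 \<le> \<bar>Im \<alpha>\<bar> * (s * (1 - s))" using s by simp
  ultimately show False using small(2) by simp
qed

text \<open>The cotangent never increases along an orbit, and it shrinks by a fixed factor whenever
  the orbit is in the middle over a fibre whose parameter is not small. Steering produces
  arbitrarily many such events, while in the middle the cotangent is at least X /
  \<open>\<eta>\<close>, the imaginary part being below \<open>\<eta>\<close>.\<close>

lemma not_near_unit_real_upper:
  assumes near: "\<And>w. w \<in> reach \<Longrightarrow> near_unit \<eta> w"
    and real: "\<alpha> = of_real \<beta>"
    and small: "\<eta> \<le> r / 64" "\<eta> \<le> (1 - \<bar>\<beta>\<bar>) / 4"
    and start: "Im (orb \<alpha> L q x1 z) > 0"
  shows False
proof -
  let ?o = "\<lambda>k x. orb \<alpha> L k x z"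
  \<comment> \<open>The added 1 makes \<open>B\<close> positive and lets the bound at
    \<open>x1\<close> persist on a smaller cylinder.\<close>
  define B where "B = \<bar>cot_angle (?o q x1)\<bar> + 1"
  have cont: "isCont (\<lambda>x. ?o q x) x1"
    using continuous_on_orb[of UNIV "\<lambda>x. x" "\<lambda>x. z" \<alpha> L q] continuous_on_eq_continuous_at[of UNIV] by auto
  have "isCont (\<lambda>x. Im (?o q x)) x1"
    using cont by (rule continuous_Im)
  moreover have "isCont (\<lambda>x. cot_angle (?o q x)) x1"
    unfolding cot_angle_def unit_power_def by (intro continuous_intros continuous_Re continuous_Im cont) (use start in auto)
  ultimately have "\<forall>\<^sub>F x in at x1. Im (?o q x) > 0" "\<forall>\<^sub>F x in at x1. cot_angle (?o q x) < B"
    using start unfolding isCont_def by (auto intro: order_tendstoD simp: B_def)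
  then have "\<forall>\<^sub>F x in at x1. Im (?o q x) > 0 \<and> cot_angle (?o q x) < B"
    by eventually_elim auto
  then obtain \<epsilon> where \<epsilon>: "\<epsilon> > 0" "\<And>x. x \<noteq> x1 \<Longrightarrow> dist x x1 < \<epsilon> \<Longrightarrow> Im (?o q x) > 0 \<and> cot_angle (?o q x) < B"
    unfolding eventually_at by auto
  obtain p where p: "q \<le> p" "\<And>x. x \<in> cyl L p x1 \<Longrightarrow> dist x x1 < \<epsilon>"
    using small_cyl[OF \<epsilon>(1), of L q x1] L by (auto simp: dist_real_def)
  have base: "Im (?o q x) > 0 \<and> cot_angle (?o q x) \<le> B" if "x \<in> cyl L p x1" for x
    using \<epsilon>(2)[of x] p(2)[OF that] start by (cases "x = x1") (auto simp: B_def)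
  have sub: "x \<in> cyl L q x1" if "x \<in> cyl L p x1" for x
    using cyl_mono[OF that p(1)] L by auto
  have nearo: "near_unit \<eta> (?o k x)" if "x \<in> cyl L p x1" "k \<ge> q" for k x
    using sub[OF that(1)] that by (intro near) (auto simp: reach_def)
  have par: "param \<alpha> y = of_real (\<beta> * cos (2 * pi * y))" "\<bar>\<beta> * cos (2 * pi * y)\<bar> \<le> \<bar>\<beta>\<bar>" for y
    by (auto simp: param_def real abs_mult mult_left_le)
  have b1: "\<bar>\<beta>\<bar> < 1" "\<beta> \<noteq> 0" using a real by auto
  have mono_step: "Im (?o k x) > 0 \<Longrightarrow> Im (?o (Suc k) x) > 0 \<and> cot_angle (?o (Suc k) x) \<le> cot_angle (?o k x)"
    if "x \<in> cyl L p x1" "k \<ge> q" for k x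
    using quad_real_near_unit[OF par(2) b1(1) nearo[OF that] small(2)] by (simp add: par(1))
  have pos: "Im (?o k x) > 0" if "x \<in> cyl L p x1" "k \<ge> q" for k x
    using that(2) by (induction k rule: dec_induct) (use base[OF that(1)] mono_step[OF that(1)] in auto)
  have anti: "cot_angle (?o k' x) \<le> cot_angle (?o k x)" if "x \<in> cyl L p x1" "k \<ge> q" "k' \<ge> k" for k k' x
    using that(3)
  proof (induction k' rule: dec_induct)
    case (step n)
    then have "cot_angle (?o (Suc n) x) \<le> cot_angle (?o n x)"
      using mono_step[OF that(1), of n] pos[OF that(1), of n] that(2) by simp
    with step show ?case by simp
  qed simp
  \<comment> \<open>A middle point moved inside its cylinder keeps distance r/2 from 0 and 1, and
    \<open>unit_power_middle\<close> then yields (r/2)/16.\<close>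
  define X where "X = r / 32"
  have X: "X > 0" using r by (simp add: X_def)
  \<comment> \<open>This is b^2 X / 5 at |b| = |\<open>\<beta>\<close>| / 2.\<close>
  define \<gamma> where "\<gamma> = \<beta>\<^sup>2 * X / 20"
  have \<gamma>: "\<gamma> > 0" using b1 X by (simp add: \<gamma>_def)
  have mid: "X \<le> unit_power (?o k y)"
    if "y \<in> cyl L p x1" "k \<ge> q" "x \<in> cyl L q x1" "y \<in> cyl L k x" "r \<le> cmod (?o k x)" "r \<le> cmod (?o k x - 1)" for k x y
  proof -
    have "dist (?o k x) (?o k y) \<le> r / 2"
      using orb_cyl_close[OF that(3) sub[OF that(1)] that(4)] \<kappa> by linarith
    then have "r / 2 \<le> cmod (?o k y)" "r / 2 \<le> cmod (?o k y - 1)"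
      using that(5,6) norm_triangle_ineq2[of "?o k x" "?o k y"]
        norm_triangle_ineq2[of "?o k x - 1" "?o k y - 1"] by (auto simp: dist_norm)
    from unit_power_middle[OF nearo[OF that(1,2)] this] show ?thesis
      using r small by (simp add: X_def)
  qed
  \<comment> \<open>Stated for all points of a cylinder, because the next steering replaces the
    point inside it.\<close>
  have key: "\<exists>k x. k \<ge> p \<and> x \<in> cyl L p x1 \<and> (\<forall>y\<in>cyl L k x. cot_angle (?o k y) \<le> B / (1 + \<gamma>) ^ j)" for j
  proof (induction j)
    case 0
    have "cot_angle (?o p y) \<le> B" if "y \<in> cyl L p x1" for y
      using anti[OF that order_refl p(1)] base[OF that] by simp
    then show ?case by (intro exI[of _ p] exI[of _ x1]) auto
  next
    case (Suc j)
    then obtain k x where kx: "k \<ge> p" "x \<in> cyl L p x1"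
        "\<And>y. y \<in> cyl L k x \<Longrightarrow> cot_angle (?o k y) \<le> B / (1 + \<gamma>) ^ j" by blast
    obtain k' x' where k': "k' \<ge> k" "x' \<in> cyl L k x" "r \<le> cmod (?o k' x')" "r \<le> cmod (?o k' x' - 1)"
      using reach_middle[OF sub[OF kx(2)], of k] kx p by auto
    have x': "x' \<in> cyl L p x1" using cyl_mono[OF k'(2) kx(1)] cyl_trans[OF kx(2)] L by auto
    \<comment> \<open>Over 0 the cosine is 1. On the cylinder of order k' + 1 the base point at time
      k' stays within 1/L <= 1/14 of an integer, where the cosine is at least 1 - 7/14.\<close>
    obtain y0 where y0: "y0 \<in> cyl L k' x'" "real L ^ k' * y0 - 0 \<in> \<int>"
      using cyl_target[of L 0 k' x'] L by auto
    have y0p: "y0 \<in> cyl L p x1" using cyl_mono[OF y0(1), of p] cyl_trans[OF x'] L k' kx by auto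
    have "cot_angle (?o (Suc k') y) \<le> B / (1 + \<gamma>) ^ Suc j" if y: "y \<in> cyl L (Suc k') y0" for y
    proof -
      have y2: "y \<in> cyl L k' y0" using cyl_mono[OF y] L by auto
      have yx': "y \<in> cyl L k' x'" using cyl_trans[OF y0(1) y2] .
      have yx: "y \<in> cyl L k x" using cyl_mono[OF yx' k'(1)] cyl_trans[OF k'(2)] L by auto
      have yp: "y \<in> cyl L p x1" using cyl_mono[OF y2, of p] cyl_trans[OF y0p] L k' kx by auto
      have k'q: "k' \<ge> q" using k' kx p by simp
      define c where "c = \<beta> * cos (2 * pi * (real L ^ k' * y))"
      have cos: "cos (2 * pi * (real L ^ k' * y)) \<ge> 1/2"
      proof -
        have "real L ^ k' * \<bar>y0 - y\<bar> \<le> 1 / real L ^ (Suc k' - k')"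
          using cyl_dist_le[OF y, of k'] L by simp
        then have "real L ^ k' * \<bar>y0 - y\<bar> \<le> 1 / real L" by simp
        also have "\<dots> \<le> 1 / 14" using L by (intro divide_left_mono) auto
        finally have d: "\<bar>real L ^ k' * y0 - real L ^ k' * y\<bar> \<le> 1/14"
          by (simp add: abs_mult flip: right_diff_distrib)
        have "\<bar>cos (2 * pi * (real L ^ k' * y0)) - cos (2 * pi * (real L ^ k' * y))\<bar> \<le>
            \<bar>2 * pi * (real L ^ k' * y0) - 2 * pi * (real L ^ k' * y)\<bar>"
          by (rule cos_lipschitz)
        also have "\<dots> = 2 * pi * \<bar>real L ^ k' * y0 - real L ^ k' * y\<bar>"
          by (simp add: abs_mult flip: right_diff_distrib)
        also have "\<dots> \<le> 7 * (1/14)"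
          using d pi_approx by (intro mult_mono) auto
        finally have "\<bar>cos (2 * pi * (real L ^ k' * y0)) - cos (2 * pi * (real L ^ k' * y))\<bar> \<le> 1/2" by simp
        moreover have "cos (2 * pi * (real L ^ k' * y0)) = 1"
          using cos_2pi_cong[OF y0(2)] by simp
        ultimately show ?thesis by linarith
      qed
      have c2: "\<beta>\<^sup>2 / 4 \<le> c\<^sup>2"
      proof -
        have "\<beta>\<^sup>2 * (1/2)\<^sup>2 \<le> \<beta>\<^sup>2 * (cos (2 * pi * (real L ^ k' * y)))\<^sup>2"
          using cos by (intro mult_left_mono power_mono) auto
        then show ?thesis by (simp add: c_def power_mult_distrib power_divide)
      qed
      have suc: "?o (Suc k') y = quad (of_real c) (?o k' y)" by (simp add: par(1) c_def)
      have XX: "X \<le> unit_power (?o k' y)"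
        using mid[OF yp k'q sub[OF x'] yx' k'(3,4)] .
      have "cot_angle (?o (Suc k') y) \<le> cot_angle (?o k' y) / (1 + c\<^sup>2 * X / 5)"
        unfolding suc
      proof (rule quad_real_contracts)
        show "\<bar>c\<bar> \<le> 1" using par(2) b1 by (metis c_def order.trans order_less_imp_le)
        show "\<eta> \<le> 1/10" using small r by simp
        show "0 < Im (quad (of_real c) (?o k' y))" using pos[OF yp, of "Suc k'"] k'q suc by simp
      qed (use nearo[OF yp k'q] pos[OF yp k'q] X XX in auto)
      also have "\<dots> \<le> (B / (1 + \<gamma>) ^ j) / (1 + \<gamma>)"
      proof (intro frac_le)
        show "cot_angle (?o k' y) \<le> B / (1 + \<gamma>) ^ j"
          using anti[OF yp _ k'(1)] kx(1) kx(3)[OF yx] p(1) by (meson order_trans)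
        have "\<beta>\<^sup>2 / 4 * (X / 5) \<le> c\<^sup>2 * (X / 5)" using c2 X by (intro mult_right_mono) auto
        then show "1 + \<gamma> \<le> 1 + c\<^sup>2 * X / 5" by (simp add: \<gamma>_def)
      qed (use \<gamma> in \<open>auto simp: B_def\<close>)
      finally show ?thesis by (simp add: mult.commute)
    qed
    with y0p k' kx show ?case by (intro exI[of _ "Suc k'"] exI[of _ y0]) auto
  qed
  have lower: "X / \<eta> \<le> B / (1 + \<gamma>) ^ j" for j
  proof -
    obtain k x where kx: "k \<ge> p" "x \<in> cyl L p x1"
        "\<And>y. y \<in> cyl L k x \<Longrightarrow> cot_angle (?o k y) \<le> B / (1 + \<gamma>) ^ j" using key by blast
    obtain k' x' where k': "k' \<ge> k" "x' \<in> cyl L k x" "r \<le> cmod (?o k' x')" "r \<le> cmod (?o k' x' - 1)"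
      using reach_middle[OF sub[OF kx(2)], of k] kx p by auto
    have x': "x' \<in> cyl L p x1" using cyl_mono[OF k'(2) kx(1)] cyl_trans[OF kx(2)] L by auto
    have kq: "k' \<ge> q" "k \<ge> q" using kx k' p by auto
    have "X / \<eta> \<le> cot_angle (?o k' x')"
      unfolding cot_angle_def
    proof (intro frac_le)
      show "X \<le> unit_power (?o k' x')" using mid[OF x' kq(1) sub[OF x'] cyl_self k'(3,4)] .
      show "Im (?o k' x') \<le> \<eta>" using near_unit_imp(1)[OF nearo[OF x' kq(1)]] by linarith
      show "0 \<le> unit_power (?o k' x')"
        using mid[OF x' kq(1) sub[OF x'] cyl_self k'(3,4)] X by linarith
    qed (use pos[OF x' kq(1)] in auto)
    also have "\<dots> \<le> B / (1 + \<gamma>) ^ j"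
      using anti[OF x' kq(2) k'(1)] kx(3)[OF k'(2)] by linarith
    finally show ?thesis .
  qed
  have \<eta>: "\<eta> > 0"
    using near_unit_imp(1)[OF nearo[of x1 q]] by auto
  obtain j where "B / (X / \<eta>) < (1 + \<gamma>) ^ j"
    using real_arch_pow[of "1 + \<gamma>"] \<gamma> by auto
  then have "B / (1 + \<gamma>) ^ j < X / \<eta>"
    using X \<eta> \<gamma> by (simp add: field_simps)
  with lower[of j] show False by simp
qed

end

section \<open>Leaving bounded sets or hitting a fixed point\<close>

text \<open>A bound over the returns to \<open>x1\<close> spreads to the whole cylinder, since at
  time k every base point is within one unit of a returning one. The induction is on time because
  the Lipschitz estimate presupposes the bound at all earlier times.\<close>

lemma orb_bounded_of_returns:
  assumes L: "L > 0" and a: "cmod \<alpha> \<le> 1" and R: "0 \<le> R"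
    and \<kappa>: "\<kappa> \<ge> 0" "7 * R * (1 + R) + (2 + 2 * R) * \<kappa> \<le> \<kappa> * real L" "S + \<kappa> \<le> R"
    and x1: "0 \<le> x1" "x1 < 1" "real L * x1 - x1 \<in> \<int>"
    and ret: "\<And>k x. x \<in> cyl L q x1 \<Longrightarrow> real L ^ k * x - x1 \<in> \<int> \<Longrightarrow> cmod (orb \<alpha> L k x z) \<le> S"
    and x: "x \<in> cyl L q x1"
  shows "cmod (orb \<alpha> L k x z) \<le> R"
  using x
proof (induction k arbitrary: x rule: less_induct)
  case (less k)
  have "\<exists>y. y \<in> cyl L q x1 \<and> real L ^ k * y - x1 \<in> \<int> \<and> real L ^ k * \<bar>x - y\<bar> \<le> 1"
  proof (cases "k \<le> q")
    case True
    \<comment> \<open>Up to time q the fixed point \<open>x1\<close> itself is the returning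
      point.\<close>
    have "real L ^ k * \<bar>x1 - x\<bar> \<le> 1 / real L ^ (q - k)"
      using cyl_dist_le[OF less.prems True L] .
    also have "\<dots> \<le> 1" using L by simp
    finally show ?thesis
      using fixed_power[OF x1(3)] by (intro exI[of _ x1]) (auto simp: abs_minus_commute)
  next
    case False
    obtain y where y: "y \<in> cyl L k x" "real L ^ k * y - x1 \<in> \<int>"
      using cyl_target[of L x1 k x] L x1 by auto
    have "y \<in> cyl L q x1" using cyl_mono[OF y(1), of q] cyl_trans[OF less.prems] False L by auto
    with y cyl_dist[OF y(1)] show ?thesis by auto
  qed
  then obtain y where y: "y \<in> cyl L q x1" "real L ^ k * y - x1 \<in> \<int>" "real L ^ k * \<bar>x - y\<bar> \<le> 1"
    by blast
  have "cmod (orb \<alpha> L k x z - orb \<alpha> L k y z) \<le> \<kappa> * (real L ^ k * \<bar>x - y\<bar>)"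
    using less y(1) a R \<kappa> by (intro orb_lipschitz[where J = "cyl L q x1"]) auto
  also have "\<dots> \<le> \<kappa>" using y(3) \<kappa>(1) by (simp add: mult_left_le)
  finally show ?case
    using ret[OF y(1,2)] norm_triangle_ineq2[of "orb \<alpha> L k x z" "orb \<alpha> L k y z"] \<kappa>(3) by linarith
qed

text \<open>For real \<open>\<alpha>\<close> conjugation is a symmetry; it reduces starting points
  in the lower half-plane to the upper one.\<close>

lemma orb_cnj:
  assumes "\<alpha> = of_real \<beta>"
  shows "orb \<alpha> L n x (cnj z) = cnj (orb \<alpha> L n x z)"
  by (induction n) (simp_all add: quad_def param_def assms)

lemma near_unit_cnj: "near_unit \<eta> z \<Longrightarrow> near_unit \<eta> (cnj z)"
proof -
  have "cmod (cnj z - of_real s) = cmod (z - of_real s)" for s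
    by (metis complex_cnj_complex_of_real complex_cnj_diff complex_mod_cnj)
  then show "near_unit \<eta> z \<Longrightarrow> near_unit \<eta> (cnj z)" by (simp add: near_unit_def)
qed

lemma quad_expels_0:
  assumes "cmod b \<le> 1" "cmod w < r" "\<mu> \<le> cmod (1 + b) - r"
  shows "\<mu> * cmod w \<le> cmod (quad b w)"
proof -
  have "cmod (1 + b) - cmod (b * w) \<le> cmod (1 + b - b * w)" by (rule norm_triangle_ineq2)
  moreover have "cmod (b * w) \<le> 1 * r"
    unfolding norm_mult using assms by (intro mult_mono) auto
  ultimately have "\<mu> \<le> cmod (1 + b - b * w)" using assms by linarith
  from mult_right_mono[OF this, of "cmod w"] show ?thesis
    by (simp add: quad_factor norm_mult mult.commute)
qed

lemma quad_expels_1: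
  assumes "cmod b \<le> 1" "cmod (w - 1) < r" "\<mu> \<le> cmod (1 - b) - r"
  shows "\<mu> * cmod (w - 1) \<le> cmod (quad b w - 1)"
  using quad_expels_0[of "- b" "1 - w" r \<mu>] assms quad_reflect[of b "1 - w"]
  by (simp add: norm_minus_commute)

text \<open>For real \<open>\<alpha>\<close> the cotangent argument needs an orbit off the invariant
  real line.\<close>

lemma open_obtain_nonreal:
  assumes "open D" "D \<noteq> {}"
  obtains z where "z \<in> D" "Im z \<noteq> 0"
proof -
  obtain w e where w: "w \<in> D" "e > 0" "ball w e \<subseteq> D" using assms open_contains_ball by blast
  show ?thesis
  proof (cases "Im w = 0")
    case True
    have "w + \<i> * of_real (e/2) \<in> ball w e" using w by (simp add: dist_norm norm_mult)
    with that[of "w + \<i> * of_real (e/2)"] True w show ?thesis by auto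
  qed (use that w in auto)
qed

locale skew_system =
  fixes \<alpha> :: complex and x0 x1 :: real
  assumes a: "\<alpha> \<noteq> 0" "cmod \<alpha> < 1"
    and x0: "0 \<le> x0" "x0 < 1" and x1: "0 \<le> x1" "x1 < 1"
    and repel1: "cmod (1 - param \<alpha> x0) > 1"
    and repel0: "cmod (1 + param \<alpha> x1) > 1"
begin

lemma norm_param_less_1: "cmod (param \<alpha> x) < 1"
  using norm_param_le[of \<alpha> x] a by simp

text \<open>Meeting 0 or 1 is listed as an alternative because a point sitting on a fixed point is
  not expelled from it.\<close>

definition escapes :: "real \<Rightarrow> nat \<Rightarrow> bool" where
  "escapes S L \<longleftrightarrow> (\<forall>\<epsilon>>0. \<forall>D. open D \<longrightarrow> D \<noteq> {} \<longrightarrow> (\<exists>x z n. \<bar>x - x1\<bar> < \<epsilon> \<and> z \<in> D \<and>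
     (orb \<alpha> L n x z = 0 \<or> orb \<alpha> L n x z = 1 \<or>
      real L ^ n * x - x1 \<in> \<int> \<and> S < cmod (orb \<alpha> L n x z))))"

text \<open>Order of choice: r comes from the multipliers, \<open>\<eta>\<close> from r and
  \<open>\<alpha>\<close>, and \<open>\<delta>\<close> by compactness from \<open>\<eta>\<close> and
  R. None of them depends on \<open>L\<close>, so \<open>\<kappa>\<close>, of order 1/L, becomes
  small against all of them.\<close>

lemma escape:
  assumes S: "S \<ge> 0"
  shows "\<forall>\<^sub>F L in sequentially. real L * x0 - x0 \<in> \<int> \<longrightarrow> real L * x1 - x1 \<in> \<int> \<longrightarrow> escapes S L"
proof -
  define R where "R = S + 1"
  define r where "r = min (1/5) (min ((cmod (1 + param \<alpha> x1) - 1) / 2) ((cmod (1 - param \<alpha> x0) - 1) / 2))"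
  define \<mu> where "\<mu> = 1 + r"
  have r: "0 < r" "r < 1/4" using repel0 repel1 by (auto simp: r_def)
  have \<mu>: "\<mu> > 1" "\<mu> \<le> cmod (1 + param \<alpha> x1) - r" "\<mu> \<le> cmod (1 - param \<alpha> x0) - r"
    using r by (auto simp: \<mu>_def) (auto simp: r_def min_def field_simps)
  define \<eta> where "\<eta> = min (r / 64) (min ((1 - cmod \<alpha>) / 4) (if Im \<alpha> = 0 then 1 else \<bar>Im \<alpha>\<bar> * r / 28))"
  have \<eta>: "\<eta> > 0" "\<eta> \<le> r / 64" "\<eta> \<le> (1 - cmod \<alpha>) / 4"
      "\<eta> \<le> (if Im \<alpha> = 0 then 1 else \<bar>Im \<alpha>\<bar> * r / 28)"
    unfolding \<eta>_def using r a
    by (simp, simp, (meson min.cobounded1 min.cobounded2 order_trans)+)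
  have \<eta>': "28 * \<eta> \<le> \<bar>Im \<alpha>\<bar> * r" if "Im \<alpha> \<noteq> 0"
    using \<eta>(4) that by simp
  have R: "R \<ge> 0" using S by (simp add: R_def)
  obtain \<delta> where \<delta>: "\<delta> > 0" "\<And>A. A \<subseteq> cball 0 R \<Longrightarrow>
      (\<And>z b. z \<in> A \<Longrightarrow> b \<in> {\<alpha>, - \<alpha>} \<Longrightarrow> \<exists>z'\<in>A. dist z' (quad b z) \<le> \<delta>) \<Longrightarrow> (\<forall>z\<in>A. near_unit \<eta> z)"
    using near_unit_approx[OF a(1) \<eta>(1), of R] by auto
  \<comment> \<open>Half of \<open>\<kappa> L * real L\<close> pays for 7 R (1 + R), the other half
    for (2 + 2R) \<open>\<kappa> L\<close> once L >= 2 (2 + 2R).\<close>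
  define \<kappa> where "\<kappa> = (\<lambda>L::nat. 14 * R * (1 + R) / real L)"
  have lim: "\<kappa> \<longlonglongrightarrow> 0" unfolding \<kappa>_def
    by (rule lim_const_over_n)
  have lim': "(\<lambda>L. (2 + 2 * R) * \<kappa> L) \<longlonglongrightarrow> 0"
    using tendsto_mult[OF tendsto_const lim, of "2 + 2 * R"] by simp
  have "\<forall>\<^sub>F L in sequentially. \<kappa> L < r / 2" "\<forall>\<^sub>F L in sequentially. (2 + 2 * R) * \<kappa> L < min \<delta> \<eta>"
    by (rule order_tendstoD(2)[OF lim], use r in simp, rule order_tendstoD(2)[OF lim'], use \<delta> \<eta> in simp)
  moreover have "\<forall>\<^sub>F L in sequentially. L \<ge> 14" by (rule eventually_ge_at_top)
  moreover have "\<forall>\<^sub>F L in sequentially. real L \<ge> 2 * (2 + 2 * R)"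
    using filterlim_real_sequentially unfolding filterlim_at_top by blast
  ultimately show ?thesis
  proof eventually_elim
    case (elim L)
    show ?case
      unfolding escapes_def
    proof (intro impI allI, rule ccontr)
      fix \<epsilon> :: real and D :: "complex set"
      assume fixp: "real L * x0 - x0 \<in> \<int>" "real L * x1 - x1 \<in> \<int>" and e: "\<epsilon> > 0"
        and D: "open D" "D \<noteq> {}"
        and no: "\<not> (\<exists>x z n. \<bar>x - x1\<bar> < \<epsilon> \<and> z \<in> D \<and> (orb \<alpha> L n x z = 0 \<or> orb \<alpha> L n x z = 1 \<or>
          real L ^ n * x - x1 \<in> \<int> \<and> S < cmod (orb \<alpha> L n x z)))"
      obtain q where q: "\<And>y. y \<in> cyl L q x1 \<Longrightarrow> \<bar>y - x1\<bar> < \<epsilon>"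
        using small_cyl[OF e, of L 0 x1] elim by auto
      obtain z where z: "z \<in> D" "Im (orb \<alpha> L q x1 z) \<noteq> 0"
      proof -
        have "orb \<alpha> L q x1 ` D \<noteq> {}" using D(2) by simp
        then obtain w where "w \<in> orb \<alpha> L q x1 ` D" "Im w \<noteq> 0"
          using open_obtain_nonreal[OF open_orb_image[OF D(1)]] by metis
        then show ?thesis using that by auto
      qed
      have \<kappa>0: "\<kappa> L \<ge> 0" using R by (simp add: \<kappa>_def)
      have \<kappa>L: "7 * R * (1 + R) + (2 + 2 * R) * \<kappa> L \<le> \<kappa> L * real L"
      proof -
        have "2 * ((2 + 2 * R) * \<kappa> L) \<le> \<kappa> L * real L"
          using mult_right_mono[OF elim(4) \<kappa>0] by (simp add: algebra_simps)
        moreover have "2 * (7 * R * (1 + R)) = \<kappa> L * real L"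
          using elim(3) by (simp add: \<kappa>_def)
        ultimately show ?thesis by linarith
      qed
      have bd: "cmod (orb \<alpha> L k x z) \<le> R" if "x \<in> cyl L q x1" for k x
      proof (rule orb_bounded_of_returns[OF _ _ R \<kappa>0 \<kappa>L, where S = S, OF _ _ _ x1 fixp(2) _ that])
        show "cmod (orb \<alpha> L k x z) \<le> S" if "x \<in> cyl L q x1" "real L ^ k * x - x1 \<in> \<int>" for k x
        proof -
          have "\<not> S < cmod (orb \<alpha> L k x z)" using no q[OF that(1)] z(1) that(2) by blast
          then show ?thesis by simp
        qed
        show "S + \<kappa> L \<le> R" using elim(1) r by (simp add: R_def)
      qed (use elim a in auto)
      have hit: "orb \<alpha> L k x z \<noteq> 0 \<and> orb \<alpha> L k x z \<noteq> 1" if "x \<in> cyl L q x1" for k x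
        using no q[OF that] z(1) by blast
      interpret c: confined \<alpha> L q x0 x1 "\<kappa> L" R r \<mu> z
        using elim a R \<kappa>0 \<kappa>L x0 x1 fixp r \<mu>(1) bd hit
          quad_expels_0[of "param \<alpha> x1" _ r \<mu>] quad_expels_1[of "param \<alpha> x0" _ r \<mu>] \<mu>(2,3)
          less_imp_le[OF norm_param_less_1]
        by unfold_locales auto
      have "\<forall>w\<in>c.reach. near_unit \<eta> w"
      proof (rule \<delta>(2))
        show "c.reach \<subseteq> cball 0 R" using bd by (auto simp: c.reach_def)
        show "\<exists>z'\<in>c.reach. dist z' (quad b w) \<le> \<delta>" if "w \<in> c.reach" "b \<in> {\<alpha>, - \<alpha>}" for w b
          using c.reach_almost_invariant[OF that] elim(2) by (meson less_imp_le min.bounded_iff order.trans min_less_iff_conj)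
      qed
      then have near: "\<And>w. w \<in> c.reach \<Longrightarrow> near_unit \<eta> w" by blast
      show False
      proof (cases "Im \<alpha> = 0")
        case False
        then show False using c.not_near_unit_nonreal[OF near] elim(2) \<eta> \<eta>'[OF False] r by auto
      next
        case True
        then have \<beta>: "\<alpha> = of_real (Re \<alpha>)" by (simp add: complex_eq_iff)
        have sm: "\<eta> \<le> (1 - \<bar>Re \<alpha>\<bar>) / 4" using \<eta>(3) abs_Re_le_cmod[of \<alpha>] \<beta>
          by (metis norm_of_real)
        have not_pos: "\<not> 0 < Im (orb \<alpha> L q x1 z)"
          using c.not_near_unit_real_upper[OF near \<beta> \<eta>(2) sm] by blast
        interpret d: confined \<alpha> L q x0 x1 "\<kappa> L" R r \<mu> "cnj z"
        proof unfold_locales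
          show "cmod (orb \<alpha> L k x (cnj z)) \<le> R" if "x \<in> cyl L q x1" for k x
            using bd[OF that] by (simp add: orb_cnj[OF \<beta>])
          show "orb \<alpha> L k x (cnj z) \<noteq> 0 \<and> orb \<alpha> L k x (cnj z) \<noteq> 1" if "x \<in> cyl L q x1" for k x
            using hit[OF that, of k] by (simp add: orb_cnj[OF \<beta>])
        qed (use c.L c.a c.R c.\<kappa> c.x0 c.x1 c.r c.\<mu> c.expel0 c.expel1 in auto)
        have near': "near_unit \<eta> w" if w: "w \<in> d.reach" for w
        proof -
          obtain k x where "w = orb \<alpha> L k x (cnj z)" "q \<le> k" "x \<in> cyl L q x1"
            using w by (auto simp: d.reach_def)
          then have "cnj w = orb \<alpha> L k x z \<and> q \<le> k \<and> x \<in> cyl L q x1"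
            by (simp add: orb_cnj[OF \<beta>])
          then have "cnj w \<in> c.reach" unfolding c.reach_def by blast
          from near_unit_cnj[OF near[OF this]] show ?thesis by simp
        qed
        have "\<not> 0 < Im (orb \<alpha> L q x1 (cnj z))"
          using d.not_near_unit_real_upper[OF near' \<beta> \<eta>(2) sm] by blast
        then have "Im (orb \<alpha> L q x1 z) \<ge> 0" by (simp add: orb_cnj[OF \<beta>])
        with not_pos z(2) show False by simp
      qed
    qed
  qed
qed

end

section \<open>Expansion at a repelling fixed point\<close>

lemma funpow_quad_holomorphic: "(quad b ^^ n) holomorphic_on A"
proof (induction n)
  case 0
  have "quad b ^^ 0 = (\<lambda>z. z)" by auto
  then show ?case by simp
next
  case (Suc n)
  have "quad b ^^ Suc n = (\<lambda>z. (quad b ^^ n) z + b * (quad b ^^ n) z * (1 - (quad b ^^ n) z))"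
    by (auto simp: quad_def)
  with Suc show ?case by (auto intro!: holomorphic_intros)
qed

lemma funpow_quad_0 [simp]: "(quad b ^^ n) 0 = 0"
  by (induction n) simp_all

lemma deriv_funpow_quad_0: "((quad b ^^ n) has_field_derivative (1 + b) ^ n) (at 0)"
proof (induction n)
  case (Suc n)
  have "(quad b has_field_derivative (1 + b)) (at 0)"
    unfolding quad_def by (auto intro!: derivative_eq_intros)
  then have q: "(quad b has_field_derivative (1 + b)) (at ((quad b ^^ n) 0))"
    by simp
  have "(quad b ^^ Suc n) = quad b \<circ> (quad b ^^ n)" by simp
  then show ?case using DERIV_chain[OF q Suc] by (simp only: power_Suc mult.commute)
qed (simp add: id_def)

text \<open>Only 0 and 1 are fixed, and 1 has the further preimage 1/b, distinct from 1 as |b| <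
  1.\<close>

lemma quad_other_preimage:
  assumes "b \<noteq> 0" "cmod b < 1" "w \<noteq> 0"
  obtains w1 where "quad b w1 = w" "w1 \<noteq> w"
proof (cases "w = 1")
  case True
  have "1 / b \<noteq> 1" using assms(2) by auto
  moreover have "quad b (1 / b) = 1" using assms(1) by (simp add: quad_def field_simps)
  ultimately show ?thesis using that True by metis
next
  case False
  obtain w1 where w1: "quad b w1 = w" using quad_surj by blast
  have "w1 \<noteq> w"
  proof
    assume "w1 = w"
    then have "b * w * (1 - w) = 0" using w1 by (simp add: quad_def)
    then show False using assms False by simp
  qed
  with that w1 show ?thesis by blast
qed

text \<open>Montel's theorem: the iterates on a small disc at the repelling point 0 form a non-normal
  family, which would be normal if it omitted \<open>w\<close> and a further preimage of \<open>w\<close>.\<close>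

lemma quad_iterates_cover:
  assumes b: "cmod b < 1" "cmod (1 + b) > 1" and \<rho>: "\<rho> > 0"
  shows "\<exists>n z. cmod z < \<rho> \<and> (quad b ^^ n) z = w"
proof (rule ccontr)
  assume no: "\<not> ?thesis"
  have b0: "b \<noteq> 0" using b by auto
  have "w \<noteq> 0"
  proof
    assume "w = 0"
    then have "cmod 0 < \<rho> \<and> (quad b ^^ 0) 0 = w" using \<rho> by simp
    with no show False by blast
  qed
  obtain w1 where w1: "quad b w1 = w" "w1 \<noteq> w"
    using quad_other_preimage[OF b0 b(1) \<open>w \<noteq> 0\<close>] .
  \<comment> \<open>Normalised so that the two omitted values become 0 and 1.\<close>
  define h where "h = (\<lambda>n z. ((quad b ^^ n) z - w) / (w1 - w))"
  have hol: "h n holomorphic_on ball 0 \<rho>" for n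
    unfolding h_def using w1 by (intro holomorphic_intros funpow_quad_holomorphic) auto
  have "h n z \<noteq> 0 \<and> h n z \<noteq> 1" if z: "z \<in> ball 0 \<rho>" for n z
  proof -
    have "(quad b ^^ m) z \<noteq> w" for m using no z by auto
    from this[of n] this[of "Suc n"] have "(quad b ^^ n) z \<noteq> w" "(quad b ^^ Suc n) z \<noteq> w" .
    then have "(quad b ^^ n) z \<noteq> w" "(quad b ^^ n) z \<noteq> w1" using w1 by auto
    then show ?thesis using w1 by (simp add: h_def)
  qed
  note h01 = this
  obtain B Z where BZ: "0 < B" "open Z" "0 \<in> Z" "Z \<subseteq> ball 0 \<rho>"
      "\<And>f z. f \<in> range h \<Longrightarrow> z \<in> Z \<Longrightarrow> cmod (f z) \<le> B"
  proof (rule GPicard1[of "ball (0::complex) \<rho>" 0 "cmod (w / (w1 - w)) + 1" "range h" "range h"])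
    show "cmod (f 0) \<le> cmod (w / (w1 - w)) + 1" if "f \<in> range h" for f
      using that by (auto simp: h_def norm_divide)
  qed (use hol h01 \<rho> in \<open>auto simp: add_nonneg_pos\<close>)
  obtain s where s: "s > 0" "cball 0 s \<subseteq> Z" using BZ open_contains_cball by blast
  \<comment> \<open>A local bound on the family bounds all derivatives at 0, but up to a constant
    factor these are (1 + b)^n.\<close>
  have "cmod ((deriv ^^ 1) (h n) 0) \<le> fact 1 * B / s ^ 1" for n
  proof (rule Cauchy_inequality)
    show "h n holomorphic_on ball 0 s"
      using hol s BZ(4) by (meson ball_subset_cball holomorphic_on_subset order_trans)
    show "continuous_on (cball 0 s) (h n)"
      using hol s BZ(4) by (meson holomorphic_on_imp_continuous_on holomorphic_on_subset order_trans)
    show "cmod (h n x) \<le> B" if "cmod (0 - x) = s" for x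
      using BZ(5)[of "h n" x] s that by auto
  qed (use s in auto)
  moreover have "deriv (h n) 0 = (1 + b) ^ n / (w1 - w)" for n
  proof (rule DERIV_imp_deriv)
    show "(h n has_field_derivative (1 + b) ^ n / (w1 - w)) (at 0)"
      unfolding h_def using w1(2) by (auto intro!: derivative_eq_intros deriv_funpow_quad_0)
  qed
  ultimately have le: "cmod (1 + b) ^ n \<le> B / s * cmod (w1 - w)" for n
    using w1 by (simp add: norm_divide norm_power pos_divide_le_eq)
  obtain n where "B / s * cmod (w1 - w) < cmod (1 + b) ^ n"
    using real_arch_pow[OF b(2)] by blast
  with le[of n] show False by simp
qed

text \<open>The two preimages u, v of w satisfy b u + b v = 1 + b and w = b u v. If |u| <= |v|, then
  |1 + b| <= 2 |b v|, which yields the crude bound |u| < 2 \<open>\<rho>\<close>; this forces |b v|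
  >= 1, hence |u| <= |w|. Consequently the images of the ball under iteration increase.\<close>

lemma quad_ball_expands:
  assumes b: "cmod b < 1" "cmod (1 + b) > 1" and \<rho>: "\<rho> > 0" "2 * \<rho> \<le> cmod (1 + b) - 1"
  shows "ball 0 \<rho> \<subseteq> quad b ` ball 0 \<rho>"
proof
  fix w assume w: "w \<in> ball (0::complex) \<rho>"
  have b0: "b \<noteq> 0" using b by auto
  obtain z where z: "quad b z = w" using quad_surj by blast
  define z' where "z' = (1 + b) / b - z"
  have z': "b * z' = 1 + b - b * z" using b0 by (simp add: z'_def field_simps)
  have zz: "w = z * (b * z')" "w = z' * (b * z)"
    using z quad_factor[of b z] z' by (auto simp: mult_ac)
  have qz': "quad b z' = w"
  proof -
    have "1 + b - b * z' = b * z" using z' by simp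
    then show ?thesis unfolding quad_factor zz(2) by simp
  qed
  have small: "\<exists>v. v \<in> ball 0 \<rho> \<and> quad b v = w" if u: "quad b u = w" "w = u * (b * v)" "b * v = 1 + b - b * u" "cmod u \<le> cmod v" for u v
  proof -
    have "cmod (1 + b) \<le> cmod (b * u) + cmod (b * v)"
      using u(3) norm_triangle_ineq[of "b * u" "b * v"] by simp
    also have "\<dots> \<le> 2 * cmod (b * v)"
      using mult_left_mono[OF u(4), of "cmod b"] by (simp add: norm_mult)
    finally have "cmod u * cmod (1 + b) \<le> 2 * cmod w"
      using u(2) mult_left_mono[of "cmod (1 + b)" "2 * cmod (b * v)" "cmod u"] by (simp add: norm_mult)
    moreover have "cmod u * 1 \<le> cmod u * cmod (1 + b)" using b by (intro mult_left_mono) auto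
    ultimately have u2: "cmod u < 2 * \<rho>" using w by simp
    have "cmod (b * u) \<le> 1 * cmod u" unfolding norm_mult using b by (intro mult_right_mono) auto
    then have "1 \<le> cmod (b * v)"
      using norm_triangle_ineq2[of "1 + b" "b * u"] u(3) u2 \<rho> by simp
    then have "cmod u * 1 \<le> cmod w" unfolding u(2) norm_mult[of u] by (intro mult_left_mono) auto
    with u(1) w show ?thesis by (intro exI[of _ u]) auto
  qed
  show "w \<in> quad b ` ball 0 \<rho>"
  proof (cases "cmod z \<le> cmod z'")
    case True
    with small[OF z zz(1) z'] show ?thesis by blast
  next
    case False
    have "b * z = 1 + b - b * z'" using z' by simp
    with small[OF qz' zz(2)] False show ?thesis by fastforce
  qed
qed

lemma quad_iterates_cover_compact:
  assumes b: "cmod b < 1" "cmod (1 + b) > 1" and \<rho>: "\<rho> > 0" and K: "compact K"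
  shows "\<exists>n. K \<subseteq> (quad b ^^ n) ` ball 0 \<rho>"
proof -
  define \<sigma> where "\<sigma> = min \<rho> ((cmod (1 + b) - 1) / 2)"
  have \<sigma>: "\<sigma> > 0" "\<sigma> \<le> \<rho>" "2 * \<sigma> \<le> cmod (1 + b) - 1"
    using b \<rho> by (auto simp: \<sigma>_def min_def)
  define U where "U = (\<lambda>n. (quad b ^^ n) ` ball 0 \<sigma>)"
  have inc: "U n \<subseteq> U (Suc n)" for n
  proof -
    have "U n \<subseteq> (quad b ^^ n) ` (quad b ` ball 0 \<sigma>)"
      unfolding U_def using quad_ball_expands[OF b \<sigma>(1,3)] by (rule image_mono)
    also have "\<dots> = U (Suc n)" by (auto simp: U_def image_image funpow_swap1)
    finally show ?thesis .
  qed
  have mono: "U m \<subseteq> U n" if "m \<le> n" for m n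
    using that by (rule lift_Suc_mono_le[of U, OF inc])
  \<comment> \<open>Iteration of one map is the degenerate case of multiplication by 1 in the base;
    this makes \<open>open_orb_image\<close> available.\<close>
  have fp: "(quad b ^^ n) z = orb b 1 n 0 z" for n z
    using orb_fixed[of 1 0 0 b n z] by (simp add: param_def)
  have op: "open (U n)" for n
    unfolding U_def fp by (rule open_orb_image) auto
  have "K \<subseteq> (\<Union>n\<in>UNIV. U n)"
  proof
    fix w assume "w \<in> K"
    obtain n z where "cmod z < \<sigma>" "(quad b ^^ n) z = w"
      using quad_iterates_cover[OF b \<sigma>(1)] by blast
    then have "w \<in> U n" by (auto simp: U_def)
    then show "w \<in> (\<Union>n\<in>UNIV. U n)" by blast
  qed
  then obtain C where C: "finite C" "K \<subseteq> (\<Union>n\<in>C. U n)"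
    using compactE_image[OF K, of UNIV U] op by metis
  have "(\<Union>n\<in>C. U n) \<subseteq> U (Max (insert 0 C))"
    using C(1) by (intro UN_least mono Max_ge) auto
  also have "\<dots> \<subseteq> (quad b ^^ Max (insert 0 C)) ` ball 0 \<rho>"
    unfolding U_def using \<sigma>(2) by (intro image_mono subset_ball)
  finally show ?thesis using C(2) by blast
qed

section \<open>Images of discs far out contain annuli\<close>

text \<open>|b z| >= 10 against |1 + b| <= 2 gives the 8. The derivative 1 + b - 2 b z equals 2 (1 +
  b - b z) - (1 + b), so its modulus is at least 2 - 2/8 times that of 1 + b - b z.\<close>

lemma far_quad:
  assumes b: "\<beta> \<le> cmod b" "cmod b \<le> 1" "\<beta> > 0" and z: "10 / \<beta> \<le> cmod z"
  shows "cmod (1 + b - b * z) \<ge> 8" "2 * cmod z \<le> cmod (quad b z)"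
    "3/2 * cmod (1 + b - b * z) \<le> cmod (1 + b - 2 * b * z)"
proof -
  have "10 \<le> \<beta> * cmod z" using z b by (simp add: field_simps)
  also have "\<dots> \<le> cmod (b * z)" unfolding norm_mult using b by (intro mult_right_mono) auto
  finally have bz: "10 \<le> cmod (b * z)" .
  have 2: "cmod (1 + b) \<le> 2" using norm_triangle_ineq[of 1 b] b by simp
  show 8: "cmod (1 + b - b * z) \<ge> 8"
    using norm_triangle_ineq2[of "b * z" "1 + b"] bz 2 by (simp add: norm_minus_commute)
  have "2 * cmod z \<le> cmod (1 + b - b * z) * cmod z" using 8 by (intro mult_right_mono) auto
  then show "2 * cmod z \<le> cmod (quad b z)" by (simp add: quad_factor norm_mult mult.commute)
  have "2 * cmod u - cmod (1 + b) \<le> cmod (2 * u - (1 + b))" for u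
    using norm_triangle_ineq2[of "2 * u" "1 + b"] by (simp add: norm_mult)
  then have "2 * cmod (1 + b - b * z) - cmod (1 + b) \<le> cmod (2 * (1 + b - b * z) - (1 + b))" .
  also have "2 * (1 + b - b * z) - (1 + b) = 1 + b - 2 * b * z" by (simp add: algebra_simps)
  finally show "3/2 * cmod (1 + b - b * z) \<le> cmod (1 + b - 2 * b * z)" using 8 2 by linarith
qed

lemma orb_far:
  assumes \<beta>: "\<beta> > 0" "cmod \<alpha> \<le> 1" and par: "\<And>k. k < n \<Longrightarrow> \<beta> \<le> cmod (param \<alpha> (real L ^ k * x))"
    and z: "10 / \<beta> \<le> cmod z"
  shows "2 ^ n * cmod z \<le> cmod (orb \<alpha> L n x z)" 
  using par
proof (induction n)
  case (Suc n)
  then have IH: "2 ^ n * cmod z \<le> cmod (orb \<alpha> L n x z)" by auto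
  have "1 * cmod z \<le> 2 ^ n * cmod z" by (intro mult_right_mono) auto
  then have "10 / \<beta> \<le> cmod (orb \<alpha> L n x z)" using z IH by linarith
  from far_quad(2)[OF _ _ \<beta>(1) this, of "param \<alpha> (real L ^ n * x)"]
  have "2 * cmod (orb \<alpha> L n x z) \<le> cmod (orb \<alpha> L (Suc n) x z)"
    using Suc.prems order_trans[OF norm_param_le \<beta>(2)] by auto
  then show ?case using IH by simp
qed simp

lemma orb_has_deriv:
  "(orb \<alpha> L n x has_field_derivative deriv (orb \<alpha> L n x) z) (at z)"
  using holomorphic_derivI[OF holomorphic_on_orb[of \<alpha> L n x UNIV]] by auto

lemma deriv_orb_Suc:
  "deriv (orb \<alpha> L (Suc n) x) z =
     (1 + param \<alpha> (real L ^ n * x) - 2 * param \<alpha> (real L ^ n * x) * orb \<alpha> L n x z) * deriv (orb \<alpha> L n x) z"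
proof (rule DERIV_imp_deriv)
  have e: "orb \<alpha> L (Suc n) x = (\<lambda>z. orb \<alpha> L n x z + param \<alpha> (real L ^ n * x) * orb \<alpha> L n x z * (1 - orb \<alpha> L n x z))"
    by (auto simp: quad_def)
  show "(orb \<alpha> L (Suc n) x has_field_derivative
     (1 + param \<alpha> (real L ^ n * x) - 2 * param \<alpha> (real L ^ n * x) * orb \<alpha> L n x z) * deriv (orb \<alpha> L n x) z) (at z)"
    unfolding e by (auto intro!: derivative_eq_intros orb_has_deriv simp: algebra_simps)
qed

text \<open>A step multiplies the logarithmic derivative by (1 + b - 2 b w) / (1 + b - b w), of
  modulus at least 3/2; at time 0 it is 1/z.\<close>

lemma orb_far_log_deriv:
  assumes \<beta>: "\<beta> > 0" "cmod \<alpha> \<le> 1" and par: "\<And>k. k < n \<Longrightarrow> \<beta> \<le> cmod (param \<alpha> (real L ^ k * x))"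
    and z: "10 / \<beta> \<le> cmod z"
  shows "(3/2) ^ n / cmod z * cmod (orb \<alpha> L n x z) \<le> cmod (deriv (orb \<alpha> L n x) z)"
  using par
proof (induction n)
  case 0
  have "orb \<alpha> L 0 x = (\<lambda>z. z)" by auto
  moreover have "z \<noteq> 0" using z \<beta> by (auto simp: field_simps)
  ultimately show ?case by simp
next
  case (Suc n)
  let ?b = "param \<alpha> (real L ^ n * x)" and ?w = "orb \<alpha> L n x z"
  have IH: "(3/2) ^ n / cmod z * cmod ?w \<le> cmod (deriv (orb \<alpha> L n x) z)" using Suc by auto
  have "1 * cmod z \<le> 2 ^ n * cmod z" by (intro mult_right_mono) auto
  then have "10 / \<beta> \<le> cmod ?w" using z orb_far[OF \<beta> _ z, of n L x] Suc.prems by fastforce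
  from far_quad(3)[OF _ _ \<beta>(1) this, of ?b]
  have 3: "3/2 * cmod (1 + ?b - ?b * ?w) \<le> cmod (1 + ?b - 2 * ?b * ?w)"
    using Suc.prems order_trans[OF norm_param_le \<beta>(2)] by auto
  have "(3/2) ^ Suc n / cmod z * cmod (orb \<alpha> L (Suc n) x z) =
     (3/2 * cmod (1 + ?b - ?b * ?w)) * ((3/2) ^ n / cmod z * cmod ?w)"
    by (simp add: quad_factor norm_mult)
  also have "\<dots> \<le> cmod (1 + ?b - 2 * ?b * ?w) * cmod (deriv (orb \<alpha> L n x) z)"
    using 3 IH by (intro mult_mono) auto
  finally show ?case by (simp only: deriv_orb_Suc norm_mult)
qed

text \<open>A holomorphic logarithm of the orbit has large derivative, so by Bloch's theorem its image
  contains a ball of radius 5, hence a full period of the exponential function.\<close>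

lemma orb_image_annulus:
  assumes \<beta>: "\<beta> > 0" "cmod \<alpha> \<le> 1" and par: "\<And>k. k < n \<Longrightarrow> \<beta> \<le> cmod (param \<alpha> (real L ^ k * x))"
    and D: "\<And>z. z \<in> ball z0 s \<Longrightarrow> 10 / \<beta> \<le> cmod z" and s: "s > 0"
    and n: "60 * cmod z0 \<le> s * (3/2) ^ n"
  obtains \<rho> where "2 ^ n * (10 / \<beta>) \<le> \<rho>" "{w. \<rho> / 2 \<le> cmod w \<and> cmod w \<le> 2 * \<rho>} \<subseteq> orb \<alpha> L n x ` ball z0 s"
proof -
  have pos: "10 / \<beta> > 0" using \<beta> by simp
  have big: "2 ^ n * (10 / \<beta>) \<le> cmod (orb \<alpha> L n x z)" if "z \<in> ball z0 s" for z
  proof -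
    have "2 ^ n * (10 / \<beta>) \<le> 2 ^ n * cmod z" using D[OF that] by (intro mult_left_mono) auto
    also have "\<dots> \<le> cmod (orb \<alpha> L n x z)" using orb_far[OF \<beta> par D[OF that]] by blast
    finally show ?thesis .
  qed
  have "0 < 2 ^ n * (10 / \<beta>)" using \<beta> by simp
  then have nz: "orb \<alpha> L n x z \<noteq> 0" if "z \<in> ball z0 s" for z
    using big[OF that] by auto
  have z0: "z0 \<in> ball z0 s" using s by simp
  obtain g where g: "g holomorphic_on ball z0 s" "\<And>z. z \<in> ball z0 s \<Longrightarrow> exp (g z) = orb \<alpha> L n x z"
    using holomorphic_logarithm_exists[OF convex_ball open_ball holomorphic_on_orb nz z0] by metis
  have dg: "(g has_field_derivative deriv g z0) (at z0)"
    using holomorphic_derivI[OF g(1) open_ball z0] .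
  have "((\<lambda>z. exp (g z)) has_field_derivative exp (g z0) * deriv g z0) (at z0)"
    using DERIV_fun_exp[OF dg] .
  then have "(orb \<alpha> L n x has_field_derivative exp (g z0) * deriv g z0) (at z0)"
    by (rule has_field_derivative_transform_within_open[OF _ open_ball z0 g(2)])
  then have "deriv (orb \<alpha> L n x) z0 = orb \<alpha> L n x z0 * deriv g z0"
    using g(2)[OF z0] by (simp add: DERIV_imp_deriv)
  moreover have "(3/2) ^ n / cmod z0 * cmod (orb \<alpha> L n x z0) \<le> cmod (deriv (orb \<alpha> L n x) z0)"
    using par by (rule orb_far_log_deriv[OF \<beta> _ D[OF z0]])
  ultimately have "(3/2) ^ n / cmod z0 * cmod (orb \<alpha> L n x z0) \<le> cmod (orb \<alpha> L n x z0) * cmod (deriv g z0)"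
    by (simp add: norm_mult)
  then have d: "(3/2) ^ n / cmod z0 \<le> cmod (deriv g z0)"
    using mult_le_cancel_right_pos[of "cmod (orb \<alpha> L n x z0)" "(3/2) ^ n / cmod z0" "cmod (deriv g z0)"] nz[OF z0]
    by (simp add: mult.commute)
  have z0pos: "cmod z0 > 0" using D[OF z0] pos by linarith
  \<comment> \<open>The factor 1/12 in \<open>Bloch\<close> turns the 60 of the hypothesis into
    radius 5.\<close>
  have "5 \<le> s * cmod (deriv g z0) / 12"
  proof -
    have "60 \<le> s * ((3/2) ^ n / cmod z0)" using n z0pos by (simp add: field_simps)
    also have "\<dots> \<le> s * cmod (deriv g z0)" using d s by (intro mult_left_mono) auto
    finally show ?thesis by simp
  qed
  then obtain c where c: "ball c 5 \<subseteq> g ` ball z0 s"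
    using Bloch[OF g(1) s] by blast
  define \<rho> where "\<rho> = exp (Re c)"
  have img: "exp v \<in> orb \<alpha> L n x ` ball z0 s" if "v \<in> ball c 5" for v
  proof -
    obtain z where "z \<in> ball z0 s" "v = g z" using c \<open>v \<in> ball c 5\<close> by auto
    then show ?thesis using g(2)[of z] by auto
  qed
  show ?thesis
  proof (rule that[of \<rho>])
    obtain z where z: "z \<in> ball z0 s" "exp c = orb \<alpha> L n x z" using img[of c] by auto
    have "cmod (exp c) = \<rho>" by (simp add: \<rho>_def norm_exp_eq_Re)
    then show "2 ^ n * (10 / \<beta>) \<le> \<rho>" using big[OF z(1)] z(2) by simp
    show "{w. \<rho> / 2 \<le> cmod w \<and> cmod w \<le> 2 * \<rho>} \<subseteq> orb \<alpha> L n x ` ball z0 s"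
    proof
      fix w assume "w \<in> {w. \<rho> / 2 \<le> cmod w \<and> cmod w \<le> 2 * \<rho>}"
      then have w: "\<rho> / 2 \<le> cmod w" "cmod w \<le> 2 * \<rho>" by auto
      have \<rho>: "\<rho> > 0" by (simp add: \<rho>_def)
      then have wpos: "cmod w > 0" "w \<noteq> 0" using w by auto
      define u where "u = Ln (w / exp c)"
      have "exp (c + u) = w" using wpos by (simp add: u_def exp_add)
      \<comment> \<open>Points of the annulus have logarithms whose real part differs from that of c
        by at most ln 2 and whose imaginary part differs by at most pi; 1 + 4 bounds the
        sum.\<close>
      moreover have "cmod u < 5"
      proof -
        have "Re u = ln (cmod w / \<rho>)"
          using wpos by (simp add: u_def norm_divide \<rho>_def norm_exp_eq_Re)
        moreover have "1/2 \<le> cmod w / \<rho>" "cmod w / \<rho> \<le> 2" using w \<rho> by (auto simp: field_simps)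
        ultimately have "ln (1/2) \<le> Re u" "Re u \<le> ln 2" using wpos \<rho> by auto
        moreover have "ln (2::real) \<le> 1" using ln_le_minus_one[of "2::real"] by simp
        ultimately have "\<bar>Re u\<bar> \<le> 1" by (simp add: ln_div)
        moreover have "\<bar>Im u\<bar> \<le> pi"
          using mpi_less_Im_Ln[of "w / exp c"] Im_Ln_le_pi[of "w / exp c"] wpos by (simp add: u_def)
        ultimately show ?thesis using cmod_le[of u] pi_less_4 by linarith
      qed
      ultimately show "w \<in> orb \<alpha> L n x ` ball z0 s" using img[of "c + u"] by (simp add: dist_norm)
    qed
  qed
qed

section \<open>The skew product is open and its orbits hit 0\<close>

text \<open>Openness of the skew product at finite points, on lifts. A hit found later, near the
  image of a box, can thus be pulled back into the box.\<close>

lemma orb_box_image: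
  assumes L: "L > 0" and D: "open D" "z \<in> D" and e: "\<epsilon> > 0" and y: "real L ^ n * x - y \<in> \<int>"
  shows "\<exists>\<delta>>0. \<exists>\<rho>>0. \<forall>v w. \<bar>v - y\<bar> < \<delta> \<longrightarrow> dist w (orb \<alpha> L n x z) < \<rho> \<longrightarrow>
      (\<exists>x' z'. \<bar>x' - x\<bar> < \<epsilon> \<and> z' \<in> D \<and> real L ^ n * x' - v \<in> \<int> \<and> orb \<alpha> L n x' z' = w)"
proof -
  have "open (orb \<alpha> L n x ` D)" "orb \<alpha> L n x z \<in> orb \<alpha> L n x ` D"
    using open_orb_image[OF D(1)] D(2) by auto
  then obtain \<rho> where \<rho>: "\<rho> > 0" "cball (orb \<alpha> L n x z) \<rho> \<subseteq> orb \<alpha> L n x ` D"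
    using open_contains_cball by blast
  have "\<forall>\<^sub>F y in nhds x. cball (orb \<alpha> L n x z) \<rho> \<subseteq> orb \<alpha> L n y ` D"
    by (rule compact_subset_orb_image[OF D(1) compact_cball \<rho>(2)])
  then obtain d where d: "d > 0" "\<And>y. \<bar>y - x\<bar> < d \<Longrightarrow> cball (orb \<alpha> L n x z) \<rho> \<subseteq> orb \<alpha> L n y ` D"
    unfolding eventually_nhds_metric dist_real_def by blast
  have Lp: "real L ^ n > 0" using L by simp
  show ?thesis
  proof (rule exI[of _ "min \<epsilon> d * real L ^ n"], rule conjI[rotated], rule exI[of _ \<rho>], intro conjI allI impI)
    show "min \<epsilon> d * real L ^ n > 0" using e d L by simp
    fix v w assume v: "\<bar>v - y\<bar> < min \<epsilon> d * real L ^ n" and w: "dist w (orb \<alpha> L n x z) < \<rho>"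
    define x' where "x' = x + (v - y) / real L ^ n"
    have "\<bar>x' - x\<bar> = \<bar>v - y\<bar> / real L ^ n" using L by (simp add: x'_def)
    then have x': "\<bar>x' - x\<bar> < min \<epsilon> d"
      using v Lp by (simp only: pos_divide_less_eq)
    have "w \<in> cball (orb \<alpha> L n x z) \<rho>" using w by (simp add: dist_commute)
    with d(2)[of x'] x' obtain z' where "z' \<in> D" "orb \<alpha> L n x' z' = w" by fastforce
    moreover have "real L ^ n * x' - v = real L ^ n * x - y" using L by (simp add: x'_def field_simps)
    ultimately show "\<exists>x' z'. \<bar>x' - x\<bar> < \<epsilon> \<and> z' \<in> D \<and> real L ^ n * x' - v \<in> \<int> \<and> orb \<alpha> L n x' z' = w"
      using x' y by (metis min_less_iff_conj)
  qed (use \<rho> in auto)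
qed

lemma diff_self_Ints: "x - x \<in> \<int>" for x :: real
  by simp

lemma dense_preimages:
  assumes "L \<ge> 2" "0 \<le> t" "t < 1" "\<epsilon> > 0"
  shows "\<exists>N x'. \<bar>x' - x\<bar> < \<epsilon> \<and> real L ^ N * x' - t \<in> \<int>"
proof -
  obtain q where q: "\<And>y. y \<in> cyl L q x \<Longrightarrow> \<bar>y - x\<bar> < \<epsilon>"
    using small_cyl[OF assms(4,1), of 0 x] by blast
  have "L > 0" using assms by simp
  from q[OF cyl_target(1)[OF this assms(2,3)]] cyl_target(2)[OF this assms(2,3), of q x]
  show ?thesis by blast
qed

lemma orb_add_cong:
  assumes "real L ^ m * x - y \<in> \<int>"
  shows "orb \<alpha> L (m + n) x z = orb \<alpha> L n y (orb \<alpha> L m x z)"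
  using orb_cong[OF assms] by (simp add: orb_add)

lemma Ints_add_trans: "real L ^ m * x - y \<in> \<int> \<Longrightarrow> real L ^ n * y - w \<in> \<int> \<Longrightarrow> real L ^ (m + n) * x - w \<in> \<int>"
proof -
  assume a: "real L ^ m * x - y \<in> \<int>" "real L ^ n * y - w \<in> \<int>"
  have "real L ^ n * (real L ^ m * x - y) + (real L ^ n * y - w) \<in> \<int>"
    using a Ints_of_nat_power_mult by (intro Ints_add) auto
  then show ?thesis by (simp add: power_add algebra_simps)
qed

section \<open>Fibres near the zeros of the cosine\<close>

lemma half_le_sin:
  fixes x :: real
  assumes "0 \<le> x" "x \<le> 1/2"
  shows "x / 2 \<le> sin x"
proof -
  have "sin 0 - 0 / 2 \<le> sin x - x / 2"
  proof (rule DERIV_nonneg_imp_nondecreasing[of 0 x "\<lambda>x. sin x - x / 2"])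
    fix y assume y: "0 \<le> y" "y \<le> x"
    have "cos y \<ge> 1/2" using cos_lipschitz[of y 0] y assms by simp
    then show "\<exists>d. ((\<lambda>x. sin x - x / 2) has_real_derivative d) (at y) \<and> 0 \<le> d"
      by (intro exI[of _ "cos y - 1/2"]) (auto intro!: derivative_eq_intros)
  qed (use assms in auto)
  then show ?thesis by simp
qed

text \<open>Applied with p = L^j: for odd \<open>L\<close> the iterates of 1/4 remain odd quarters,
  where the cosine vanishes.\<close>

lemma abs_cos_odd_quarter:
  assumes "odd p"
  shows "\<bar>cos (2 * pi * (real p / 4 - t))\<bar> \<le> 2 * pi * \<bar>t\<bar>"
proof -
  obtain i where i: "p = 2 * i + 1" using assms oddE by blast
  have e: "2 * pi * (real p / 4 - t) = real i * pi + (pi / 2 - 2 * pi * t)"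
    unfolding i by (simp add: field_simps)
  have "\<bar>cos (2 * pi * (real p / 4 - t))\<bar> = \<bar>cos (real i * pi) * cos (pi / 2 - 2 * pi * t)\<bar>"
    unfolding e cos_add by simp
  also have "\<dots> \<le> 1 * \<bar>sin (2 * pi * t)\<bar>"
    unfolding abs_mult by (intro mult_mono) (auto simp: cos_diff)
  also have "\<dots> \<le> \<bar>2 * pi * t\<bar>" using abs_sin_x_le_abs_x by simp
  finally show ?thesis by (simp add: abs_mult)
qed

context skew_system
begin

text \<open>Half the modulus over \<open>x1\<close>, so that fibres near \<open>x1\<close> still
  have parameters of modulus at least \<open>\<beta>\<close>; \<open>10 / \<beta>\<close> is then
  the radius beyond which \<open>far_quad\<close> applies.\<close>

definition \<beta> :: real where "\<beta> = cmod (param \<alpha> x1) / 2"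

lemma \<beta>: "\<beta> > 0" "\<beta> \<le> 1/2" "\<beta> \<le> cmod \<alpha> / 2" "10 / \<beta> \<ge> 20"
proof -
  have "param \<alpha> x1 \<noteq> 0" using repel0 by auto
  then show b: "\<beta> > 0" by (simp add: \<beta>_def)
  show b2: "\<beta> \<le> 1/2" using norm_param_less_1[of x1] by (simp add: \<beta>_def)
  show "\<beta> \<le> cmod \<alpha> / 2" using norm_param_le[of \<alpha> x1] by (simp add: \<beta>_def)
  show "10 / \<beta> \<ge> 20" using b b2 by (simp add: field_simps)
qed

end

text \<open>The hypothesis on the parameters holds for orbits that stay close to \<open>1/4\<close> or \<open>3/4\<close>, where
  the fibre map is the identity.\<close>

lemma orb_near_identity:
  assumes L: "L \<ge> 1000" and \<rho>: "\<rho> \<ge> 20"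
    and par: "\<And>j. j < k \<Longrightarrow> cmod (param \<alpha> (real L ^ j * v)) \<le> 2 / \<rho> / real L ^ (k - j)"
    and z: "cmod z \<le> 2 * \<rho>" and j: "j \<le> k"
  shows "cmod (orb \<alpha> L j v z - z) \<le> 60 * \<rho> / real L ^ (Suc k - j)"
  using j
proof (induction j)
  case 0
  then show ?case using \<rho> by simp
next
  case (Suc j)
  let ?w = "orb \<alpha> L j v z" and ?b = "param \<alpha> (real L ^ j * v)"
  let ?P = "real L ^ (k - j)"
  have e: "Suc k - j = Suc (k - j)" "Suc k - Suc j = k - j" using Suc.prems by auto
  have P: "?P \<ge> 1000"
  proof -
    have "real L ^ 1 \<le> ?P" using L Suc.prems by (intro power_increasing) auto
    then have "real L \<le> ?P" by simp
    moreover have "1000 \<le> real L" using L by simp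
    ultimately show ?thesis by (rule order_trans[rotated])
  qed
  have IH: "cmod (?w - z) \<le> 60 * \<rho> / (real L * ?P)" using Suc by (simp add: e)
  also have "\<dots> \<le> 60 * \<rho> / (1000 * ?P)"
    using L P \<rho> by (intro divide_left_mono mult_right_mono) auto
  finally have IH2: "cmod (?w - z) \<le> 6/100 * \<rho> / ?P" by simp
  also have "\<dots> \<le> 6/100 * \<rho> / 1" using P \<rho> L by (intro divide_left_mono) auto
  finally have "cmod ?w \<le> 3 * \<rho>" using z \<rho> norm_triangle_ineq[of "?w - z" z] by simp
  moreover from this have "cmod (1 - ?w) \<le> 4 * \<rho>" using norm_triangle_ineq4[of 1 ?w] \<rho> by simp
  moreover have "cmod ?b \<le> 2 / \<rho> / ?P" using par Suc.prems by simp
  ultimately have "cmod (?b * ?w * (1 - ?w)) \<le> (2 / \<rho> / ?P) * (3 * \<rho>) * (4 * \<rho>)"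
    unfolding norm_mult using \<rho> by (intro mult_mono mult_nonneg_nonneg) auto
  also have "\<dots> = 24 * \<rho> / ?P" using \<rho> by simp
  finally have 1: "cmod (?b * ?w * (1 - ?w)) \<le> 24 * \<rho> / ?P" .
  have "cmod (orb \<alpha> L (Suc j) v z - z) \<le> cmod (?w - z) + cmod (?b * ?w * (1 - ?w))"
    using norm_triangle_ineq[of "?w - z" "?b * ?w * (1 - ?w)"] by (simp add: quad_def algebra_simps)
  also have "\<dots> \<le> 6/100 * \<rho> / ?P + 24 * \<rho> / ?P" using IH2 1 by (rule add_mono)
  also have "\<dots> = (6/100 * \<rho> + 24 * \<rho>) / ?P" by (simp add: add_divide_distrib)
  \<comment> \<open>The earlier error carries an additional factor 1/L <= 1/1000, so the current
    step dominates.\<close>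
  also have "\<dots> \<le> 60 * \<rho> / ?P" using \<rho> P by (intro divide_right_mono) auto
  finally show ?case by (simp add: e)
qed

text \<open>The bound on 7 / L limits the drift of the parameter along cylinders at
  \<open>x1\<close>; the radius in \<open>esc\<close> is the one beyond which orbits over these
  cylinders grow.\<close>

locale skew_large = skew_system +
  fixes L :: nat
  assumes L: "L \<ge> 1000" "odd L" "7 / real L \<le> \<beta>"
    and fix0: "real L * x0 - x0 \<in> \<int>" and fix1: "real L * x1 - x1 \<in> \<int>"
    and esc: "escapes (10 / \<beta>) L"
begin

lemma L2: "L \<ge> 2"
  using L by simp

lemma param_near_x1:
  assumes "x \<in> cyl L n x1" "k < n"
  shows "\<beta> \<le> cmod (param \<alpha> (real L ^ k * x))"
proof -
  have "real L ^ k * \<bar>x1 - x\<bar> \<le> 1 / real L ^ (n - k)"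
    using cyl_dist_le[of x L n x1 k] assms L by simp
  also have "\<dots> \<le> 1 / real L ^ 1" using assms L by (intro divide_left_mono power_increasing) auto
  finally have d: "\<bar>real L ^ k * x - real L ^ k * x1\<bar> \<le> 1 / real L"
    by (simp add: abs_mult abs_minus_commute flip: right_diff_distrib)
  have "cmod (param \<alpha> (real L ^ k * x) - param \<alpha> x1) = cmod (param \<alpha> (real L ^ k * x) - param \<alpha> (real L ^ k * x1))"
    using param_cong[OF fixed_power[OF fix1, of k]] by simp
  also have "\<dots> \<le> cmod \<alpha> * (7 * \<bar>real L ^ k * x - real L ^ k * x1\<bar>)" by (rule norm_param_diff_le)
  also have "\<dots> \<le> 1 * (7 * (1 / real L))" using d a by (intro mult_mono) auto
  also have "\<dots> \<le> \<beta>" using L by simp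
  finally have "cmod (param \<alpha> x1) - cmod (param \<alpha> (real L ^ k * x)) \<le> \<beta>"
    using norm_triangle_ineq2[of "param \<alpha> x1" "param \<alpha> (real L ^ k * x)"] by (simp add: norm_minus_commute)
  then show ?thesis by (simp add: \<beta>_def)
qed

text \<open>The radius \<open>\<rho>\<close> of the annulus that \<open>D\<close> produces cannot be
  prescribed, so the last parameter is adapted to it: |b| = 1 / \<open>\<rho>\<close> puts the zero
  1 + 1/b into the annulus. In between, the base point spends k steps near odd quarters, where the
  maps are almost the identity. A long delay k means that the base point enters close to 1/4, so the
  annulus, found exactly over 1/4, is still covered.\<close>

lemma far_hits_0:
  assumes \<epsilon>: "\<epsilon> > 0" and D: "open D" "z0 \<in> D" and far: "cmod z0 > 10 / \<beta>"
  obtains x z n where "\<bar>x - x1\<bar> < \<epsilon>" "z \<in> D" "orb \<alpha> L n x z = 0"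
proof -
  have "open (D \<inter> - cball 0 (10 / \<beta>))" "z0 \<in> D \<inter> - cball 0 (10 / \<beta>)" using D far by auto
  then obtain s where s: "s > 0" "ball z0 s \<subseteq> D \<inter> - cball 0 (10 / \<beta>)"
    unfolding open_contains_ball by blast
  have sf: "10 / \<beta> \<le> cmod z" if "z \<in> ball z0 s" for z using s(2) that by fastforce
  obtain n0 where n0: "60 * cmod z0 / s < (3/2) ^ n0" using real_arch_pow[of "3/2"] by auto
  obtain n where n: "n \<ge> n0" "\<And>y. y \<in> cyl L n x1 \<Longrightarrow> \<bar>y - x1\<bar> < \<epsilon>"
    using small_cyl[OF \<epsilon>, of L n0 x1] L by auto
  have "60 * cmod z0 / s \<le> (3/2) ^ n"
    using n0 n(1) power_increasing[of n0 n "3/2::real"] by linarith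
  then have n60: "60 * cmod z0 \<le> s * (3/2) ^ n" using s by (simp add: field_simps)
  define X where "X = (\<lambda>t. (of_int \<lfloor>real L ^ n * x1\<rfloor> + t) / real L ^ n)"
  have X: "X t \<in> cyl L n x1" "real L ^ n * X t - t \<in> \<int>" if "0 \<le> t" "t < 1" for t
    unfolding X_def using cyl_target[of L t n x1] that L by auto
  obtain \<rho> where \<rho>: "2 ^ n * (10 / \<beta>) \<le> \<rho>"
      "{w. \<rho> / 2 \<le> cmod w \<and> cmod w \<le> 2 * \<rho>} \<subseteq> orb \<alpha> L n (X (1/4)) ` ball z0 s"
    using orb_image_annulus[OF \<beta>(1) less_imp_le[OF a(2)] param_near_x1[OF X(1)] sf s(1) n60, of "1/4"]
    by auto
  have \<rho>20: "\<rho> \<ge> 10 / \<beta>"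
  proof -
    have "1 * (10 / \<beta>) \<le> 2 ^ n * (10 / \<beta>)" using \<beta> by (intro mult_right_mono) auto
    then show ?thesis using \<rho>(1) by linarith
  qed
  have "compact {w. \<rho> / 2 \<le> cmod w \<and> cmod w \<le> 2 * \<rho>}"
  proof -
    have "{w. \<rho> / 2 \<le> cmod w \<and> cmod w \<le> 2 * \<rho>} = cball 0 (2 * \<rho>) - ball 0 (\<rho> / 2)" by auto
    then show ?thesis by (simp add: compact_diff)
  qed
  from compact_subset_orb_image[OF open_ball this \<rho>(2)]
  have ev: "\<forall>\<^sub>F y in nhds (X (1/4)). {w. \<rho> / 2 \<le> cmod w \<and> cmod w \<le> 2 * \<rho>} \<subseteq> orb \<alpha> L n y ` ball z0 s" .
  \<comment> \<open>The value of the cosine that gives |b| = 1 / \<open>\<rho>\<close>.\<close>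
  define c where "c = 1 / (cmod \<alpha> * \<rho>)"
  have \<rho>pos: "\<rho> \<ge> 20" using \<rho>20 \<beta> by linarith
  have c: "c > 0" "c \<le> 1/20"
  proof -
    show "c > 0" using a \<rho>pos by (simp add: c_def)
    have "20 \<le> cmod \<alpha> * (10 / \<beta>)" using \<beta> by (simp add: field_simps)
    also have "\<dots> \<le> cmod \<alpha> * \<rho>" using \<rho>20 by (intro mult_left_mono) auto
    finally show "c \<le> 1/20" using a \<rho>pos by (simp add: c_def field_simps)
  qed
  obtain \<phi> where \<phi>: "0 \<le> \<phi>" "\<phi> \<le> 1/2" "sin \<phi> = c"
  proof -
    have "sin 0 \<le> c" "c \<le> sin (1/2)" using c half_le_sin[of "1/2"] by auto
    then have "\<exists>x\<ge>0. x \<le> 1/2 \<and> sin x = c" by (intro IVT') (auto intro!: continuous_intros)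
    then show ?thesis using that by blast
  qed
  have \<phi>c: "\<phi> \<le> 2 * c" using half_le_sin[OF \<phi>(1,2)] \<phi>(3) by simp
  \<comment> \<open>After k steps the deviation from an odd quarter has grown to
    \<open>\<phi> / (2 * pi)\<close>; at 1/4 minus this deviation the cosine is sin
    \<open>\<phi>\<close> = c.\<close>
  define t where "t = (\<lambda>k::nat. 1/4 - \<phi> / (2 * pi) / real L ^ k)"
  have tb: "0 \<le> t k" "t k < 1" for k
  proof -
    have "0 \<le> \<phi> / (2 * pi) / real L ^ k" using \<phi> by simp
    moreover have "\<phi> / (2 * pi) / real L ^ k \<le> (1/2) / (2 * 3) / 1"
      using \<phi> L pi_approx by (intro frac_le) auto
    ultimately show "0 \<le> t k" "t k < 1" by (auto simp: t_def)
  qed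
  have "(\<lambda>k. X (t k)) \<longlonglongrightarrow> X (1/4 - 0)"
    unfolding X_def t_def
  proof (intro tendsto_intros)
    have "(\<lambda>k. \<phi> / (2 * pi) * (1 / real L) ^ k) \<longlonglongrightarrow> \<phi> / (2 * pi) * 0"
      using L by (intro tendsto_mult tendsto_const LIMSEQ_power_zero) auto
    then show "(\<lambda>k. \<phi> / (2 * pi) / real L ^ k) \<longlonglongrightarrow> 0" by (simp add: power_divide)
  qed (use L in auto)
  then have "\<forall>\<^sub>F k in sequentially. {w. \<rho> / 2 \<le> cmod w \<and> cmod w \<le> 2 * \<rho>} \<subseteq> orb \<alpha> L n (X (t k)) ` ball z0 s"
    using eventually_compose_filterlim[OF ev] by simp
  then obtain k0 where k0: "\<And>k. k \<ge> k0 \<Longrightarrow> {w. \<rho> / 2 \<le> cmod w \<and> cmod w \<le> 2 * \<rho>} \<subseteq> orb \<alpha> L n (X (t k)) ` ball z0 s"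
    unfolding eventually_sequentially by blast
  \<comment> \<open>Even, so that L^k is 1 mod 4 and the base point ends near 1/4 and not near
    3/4.\<close>
  define k where "k = 2 * k0"
  define v where "v = t k"
  define b where "b = \<alpha> * of_real c"
  have v: "real L ^ j * v = real (L ^ j) / 4 - \<phi> / (2 * pi) / real L ^ (k - j)" if "j \<le> k" for j
  proof -
    have "real L ^ k = real L ^ (k - j) * real L ^ j" using that by (simp flip: power_add)
    then show ?thesis using L by (simp add: v_def t_def right_diff_distrib)
  qed
  have par: "cmod (param \<alpha> (real L ^ j * v)) \<le> 2 / \<rho> / real L ^ (k - j)" if "j < k" for j
  proof -
    have "\<bar>cos (2 * pi * (real L ^ j * v))\<bar> \<le> 2 * pi * \<bar>\<phi> / (2 * pi) / real L ^ (k - j)\<bar>"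
      using v[of j] abs_cos_odd_quarter[of "L ^ j" "\<phi> / (2 * pi) / real L ^ (k - j)"] L(2) that by simp
    also have "\<dots> = \<phi> / real L ^ (k - j)" using \<phi> by (simp add: abs_divide abs_mult)
    also have "\<dots> \<le> 2 * c / real L ^ (k - j)" using \<phi>c by (intro divide_right_mono) auto
    finally have "cmod \<alpha> * \<bar>cos (2 * pi * (real L ^ j * v))\<bar> \<le> cmod \<alpha> * (2 * c / real L ^ (k - j))"
      by (intro mult_left_mono) auto
    also have "\<dots> = 2 / \<rho> / real L ^ (k - j)" using a by (simp add: c_def)
    finally show ?thesis by (simp add: param_def norm_mult)
  qed
  have park: "param \<alpha> (real L ^ k * v) = b"
  proof -
    obtain j where "L = 2 * j + 1" using L(2) oddE by blast
    then have "L ^ 2 = 4 * (j * j + j) + 1" by (simp add: power2_eq_square algebra_simps)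
    then have "L ^ 2 mod 4 = 1" by simp
    then have "L ^ k mod 4 = 1" using power_mod[of "L ^ 2" 4 k0] by (simp add: k_def power_mult)
    then obtain i where "L ^ k = 4 * i + 1" by (metis mult_div_mod_eq)
    then have "real (L ^ k) = 4 * real i + 1" by simp
    then have "real (L ^ k) / 4 - 1/4 = real i" by linarith
    then have "real (L ^ k) / 4 - 1/4 \<in> \<int>" by (simp only: Ints_of_nat)
    then have "real L ^ k * v - (1/4 - \<phi> / (2 * pi)) \<in> \<int>" using v[of k] by simp
    from param_cong[OF this] have "param \<alpha> (real L ^ k * v) = \<alpha> * of_real (cos (2 * pi * (1/4 - \<phi> / (2 * pi))))"
      by (simp add: param_def)
    also have "2 * pi * (1/4 - \<phi> / (2 * pi)) = pi / 2 - \<phi>" by (simp add: field_simps)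
    finally show ?thesis using \<phi>(3) by (simp add: cos_diff b_def)
  qed
  have b: "b \<noteq> 0" "cmod (1 / b) = \<rho>" using a c \<rho>pos by (auto simp: b_def c_def norm_mult norm_divide)
  define y where "y = 1 + 1 / b"
  have y: "\<rho> - 1 \<le> cmod y" "cmod y \<le> \<rho> + 1"
    using norm_triangle_ineq[of 1 "1 / b"] norm_triangle_ineq2[of "1 / b" "- 1"] b
    by (auto simp: y_def norm_minus_commute add.commute)
  have close: "cmod (orb \<alpha> L k v w - w) \<le> \<rho> / 16" if "cmod w \<le> 2 * \<rho>" for w
  proof -
    have "cmod (orb \<alpha> L k v w - w) \<le> 60 * \<rho> / real L ^ (Suc k - k)"
      using orb_near_identity[OF L(1) \<rho>pos par that order_refl] by simp
    also have "\<dots> \<le> 60 * \<rho> / 960" using L \<rho>pos by (intro divide_left_mono) auto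
    finally show ?thesis by simp
  qed
  \<comment> \<open>The k almost trivial steps move points by at most \<open>\<rho> / 16\<close>, so
    their composition still attains y close to y.\<close>
  have "\<exists>w\<in>ball y (\<rho> / 4). orb \<alpha> L k v w - y = 0"
  proof (rule holomorphic_contract_to_zero[of y "\<rho> / 4" "\<lambda>w. orb \<alpha> L k v w - y"])
    show "continuous_on (cball y (\<rho> / 4)) (\<lambda>w. orb \<alpha> L k v w - y)" by (intro continuous_intros)
    show "(\<lambda>w. orb \<alpha> L k v w - y) holomorphic_on ball y (\<rho> / 4)"
      by (intro holomorphic_intros holomorphic_on_orb)
    show "cmod (orb \<alpha> L k v y - y) < cmod (orb \<alpha> L k v w - y)" if w: "cmod (y - w) = \<rho> / 4" for w
    proof -
      have "cmod w \<le> 2 * \<rho>" using norm_triangle_ineq4[of y "y - w"] w y \<rho>pos by simp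
      then have "cmod (orb \<alpha> L k v w - w) \<le> \<rho> / 16" by (rule close)
      moreover have "cmod (w - y) \<le> cmod (orb \<alpha> L k v w - w) + cmod (orb \<alpha> L k v w - y)"
        using norm_triangle_ineq4[of "orb \<alpha> L k v w - y" "orb \<alpha> L k v w - w"] by (simp add: add.commute)
      moreover have "cmod (orb \<alpha> L k v y - y) \<le> \<rho> / 16" using y \<rho>pos by (intro close) auto
      ultimately show ?thesis using w \<rho>pos by (simp add: norm_minus_commute)
    qed
  qed (use \<rho>pos in auto)
  then obtain w where w: "cmod (y - w) < \<rho> / 4" "orb \<alpha> L k v w = y" by (auto simp: dist_norm)
  have "\<rho> / 2 \<le> cmod w \<and> cmod w \<le> 2 * \<rho>"
    using norm_triangle_ineq4[of y "y - w"] norm_triangle_ineq2[of y "y - w"] w y \<rho>pos by simp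
  then have "w \<in> orb \<alpha> L n (X v) ` ball z0 s" using k0[of k] by (auto simp: k_def v_def)
  then obtain z where z: "z \<in> ball z0 s" "orb \<alpha> L n (X v) z = w" by auto
  have "orb \<alpha> L (n + Suc k) (X v) z = orb \<alpha> L (Suc k) v w"
    using orb_add_cong[OF X(2)[OF tb[of k]], of \<alpha> "Suc k" z] z(2) by (simp add: v_def)
  also have "\<dots> = quad b y" using w(2) park by simp
  also have "\<dots> = 0" using b by (simp add: quad_factor y_def field_simps)
  finally show ?thesis
    using that[of "X v" z "n + Suc k"] n(2)[OF X(1)[OF tb[of k]]] z(1) s(2) by (auto simp: v_def)
qed

text \<open>Among the outcomes of \<open>escapes\<close>, an orbit through 1 is turned into one
  through 0 over the fibre \<open>x0\<close>: there 1 repels, and by reflection small discs at 1 are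
  spread over 0.\<close>

lemma hits_0_near_x1:
  assumes \<epsilon>: "\<epsilon> > 0" and D: "open D" "D \<noteq> {}"
  obtains x z n where "\<bar>x - x1\<bar> < \<epsilon>" "z \<in> D" "orb \<alpha> L n x z = 0"
proof -
  obtain x z n where x: "\<bar>x - x1\<bar> < \<epsilon>" "z \<in> D" and
     c: "orb \<alpha> L n x z = 0 \<or> orb \<alpha> L n x z = 1 \<or>
      real L ^ n * x - x1 \<in> \<int> \<and> 10 / \<beta> < cmod (orb \<alpha> L n x z)"
    using esc \<epsilon> D unfolding escapes_def by blast
  define e where "e = \<epsilon> - \<bar>x - x1\<bar>"
  have e: "e > 0" using x by (simp add: e_def)
  have Lp: "L > 0" using L by simp
  from c consider "orb \<alpha> L n x z = 0" | "orb \<alpha> L n x z = 1" |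
    "real L ^ n * x - x1 \<in> \<int>" "10 / \<beta> < cmod (orb \<alpha> L n x z)" by blast
  then show ?thesis
  proof cases
    case 1
    with that x show ?thesis by blast
  next
    case 2
    obtain \<delta> \<rho> where \<delta>: "\<delta> > 0" "\<rho> > 0" "\<And>v w. \<bar>v - real L ^ n * x\<bar> < \<delta> \<Longrightarrow> dist w (orb \<alpha> L n x z) < \<rho> \<Longrightarrow>
        \<exists>x' z'. \<bar>x' - x\<bar> < e \<and> z' \<in> D \<and> real L ^ n * x' - v \<in> \<int> \<and> orb \<alpha> L n x' z' = w"
      using orb_box_image[OF Lp D(1) x(2) e diff_self_Ints] by blast
    \<comment> \<open>As 1 is fixed in all fibres, the base point can travel on to \<open>x0\<close>
      while the value stays 1.\<close>
    obtain v N where v: "\<bar>v - real L ^ n * x\<bar> < \<delta>" "real L ^ N * v - x0 \<in> \<int>"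
      using dense_preimages[OF L2 x0 \<delta>(1)] by blast
    obtain x' z' where x': "\<bar>x' - x\<bar> < e" "z' \<in> D" "real L ^ n * x' - v \<in> \<int>" "orb \<alpha> L n x' z' = 1"
      using \<delta>(3)[OF v(1), of 1] \<delta>(2) 2 by auto
    have fibre: "real L ^ (n + N) * x' - x0 \<in> \<int>" using Ints_add_trans[OF x'(3) v(2)] .
    have one: "orb \<alpha> L (n + N) x' z' = 1" using x'(4) by (simp add: orb_add)
    have "open (orb \<alpha> L (n + N) x' ` D)" "1 \<in> orb \<alpha> L (n + N) x' ` D"
      using open_orb_image[OF D(1)] one x'(2) by (auto intro: rev_image_eqI)
    then obtain \<rho>' where \<rho>': "\<rho>' > 0" "ball 1 \<rho>' \<subseteq> orb \<alpha> L (n + N) x' ` D"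
      using open_contains_ball by blast
    obtain m u where u: "cmod u < \<rho>'" "(quad (- param \<alpha> x0) ^^ m) u = 1"
      using quad_iterates_cover[of "- param \<alpha> x0" \<rho>' 1] norm_param_less_1 repel1 \<rho>'(1) by auto
    have refl: "(quad b ^^ m) (1 - u) = 1 - (quad (- b) ^^ m) u" for b m
      by (induction m) (simp_all add: quad_reflect)
    have "1 - u \<in> ball 1 \<rho>'" using u by (simp add: dist_norm)
    with \<rho>'(2) obtain z'' where z'': "z'' \<in> D" "orb \<alpha> L (n + N) x' z'' = 1 - u" by fastforce
    have "orb \<alpha> L ((n + N) + m) x' z'' = 0"
      using orb_add[of \<alpha> L "n + N" m x' z''] orb_fixed[OF fix0 fibre] z''(2) refl u(2) by simp
    moreover have "\<bar>x' - x1\<bar> < \<epsilon>" using x'(1) by (simp add: e_def)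
    ultimately show ?thesis using that z''(1) by blast
  next
    case 3
    obtain \<delta> \<rho> where \<delta>: "\<delta> > 0" "\<rho> > 0" "\<And>v w. \<bar>v - x1\<bar> < \<delta> \<Longrightarrow> dist w (orb \<alpha> L n x z) < \<rho> \<Longrightarrow>
        \<exists>x' z'. \<bar>x' - x\<bar> < e \<and> z' \<in> D \<and> real L ^ n * x' - v \<in> \<int> \<and> orb \<alpha> L n x' z' = w"
      using orb_box_image[OF Lp D(1) x(2) e 3(1)] by blast
    obtain v w m where v: "\<bar>v - x1\<bar> < \<delta>" "w \<in> ball (orb \<alpha> L n x z) \<rho>" "orb \<alpha> L m v w = 0"
      using far_hits_0[OF \<delta>(1) open_ball _ 3(2)] \<delta>(2) by (metis centre_in_ball)
    obtain x' z' where x': "\<bar>x' - x\<bar> < e" "z' \<in> D" "real L ^ n * x' - v \<in> \<int>" "orb \<alpha> L n x' z' = w"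
      using \<delta>(3)[OF v(1), of w] v(2) by (auto simp: dist_commute)
    have "orb \<alpha> L (n + m) x' z' = 0" using orb_add_cong[OF x'(3)] x'(4) v(3) by simp
    moreover have "\<bar>x' - x1\<bar> < \<epsilon>" using x'(1) by (simp add: e_def)
    ultimately show ?thesis using that x'(2) by blast
  qed
qed

text \<open>Three perturbations of total size below \<open>\<epsilon>\<close>: onto the fibre
  \<open>x1\<close>, where the previous lemma applies, then to the hit, and finally, 0 being fixed
  in all fibres, to a base point that later lands on \<open>x1\<close>.\<close>

lemma hits_0:
  assumes \<epsilon>: "\<epsilon> > 0" and D: "open D" "D \<noteq> {}"
  obtains x z n where "\<bar>x - c\<bar> < \<epsilon>" "z \<in> D" "real L ^ n * x - x1 \<in> \<int>" "orb \<alpha> L n x z = 0"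
proof -
  have Lp: "L > 0" using L by simp
  obtain x n where x: "\<bar>x - c\<bar> < \<epsilon>/2" "real L ^ n * x - x1 \<in> \<int>"
    using dense_preimages[OF L2 x1, of "\<epsilon>/2" c] \<epsilon> by auto
  obtain z where z: "z \<in> D" using D by blast
  have e4: "\<epsilon>/4 > 0" using \<epsilon> by simp
  obtain \<delta> \<rho> where \<delta>: "\<delta> > 0" "\<rho> > 0" "\<And>v w. \<bar>v - x1\<bar> < \<delta> \<Longrightarrow> dist w (orb \<alpha> L n x z) < \<rho> \<Longrightarrow>
      \<exists>x' z'. \<bar>x' - x\<bar> < \<epsilon>/4 \<and> z' \<in> D \<and> real L ^ n * x' - v \<in> \<int> \<and> orb \<alpha> L n x' z' = w"
    using orb_box_image[OF Lp D(1) z e4 x(2)] by blast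
  obtain v w m where v: "\<bar>v - x1\<bar> < \<delta>" "w \<in> ball (orb \<alpha> L n x z) \<rho>" "orb \<alpha> L m v w = 0"
    using hits_0_near_x1[OF \<delta>(1), of "ball (orb \<alpha> L n x z) \<rho>"] \<delta>(2) by (metis centre_in_ball empty_iff open_ball)
  obtain x' z' where x': "\<bar>x' - x\<bar> < \<epsilon>/4" "z' \<in> D" "real L ^ n * x' - v \<in> \<int>" "orb \<alpha> L n x' z' = w"
    using \<delta>(3)[OF v(1), of w] v(2) by (auto simp: dist_commute)
  have 0: "orb \<alpha> L (n + m) x' z' = 0" using orb_add_cong[OF x'(3)] x'(4) v(3) by simp
  obtain \<delta>' \<rho>' where \<delta>': "\<delta>' > 0" "\<rho>' > 0" "\<And>v w. \<bar>v - real L ^ (n + m) * x'\<bar> < \<delta>' \<Longrightarrow> dist w (orb \<alpha> L (n + m) x' z') < \<rho>' \<Longrightarrow>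
      \<exists>y z''. \<bar>y - x'\<bar> < \<epsilon>/4 \<and> z'' \<in> D \<and> real L ^ (n + m) * y - v \<in> \<int> \<and> orb \<alpha> L (n + m) y z'' = w"
    using orb_box_image[OF Lp D(1) x'(2) e4 diff_self_Ints] by blast
  obtain u N where u: "\<bar>u - real L ^ (n + m) * x'\<bar> < \<delta>'" "real L ^ N * u - x1 \<in> \<int>"
    using dense_preimages[OF L2 x1 \<delta>'(1)] by blast
  obtain y z'' where y: "\<bar>y - x'\<bar> < \<epsilon>/4" "z'' \<in> D" "real L ^ (n + m) * y - u \<in> \<int>" "orb \<alpha> L (n + m) y z'' = 0"
    using \<delta>'(3)[OF u(1), of 0] \<delta>'(2) 0 by auto
  have "real L ^ ((n + m) + N) * y - x1 \<in> \<int>" using Ints_add_trans[OF y(3) u(2)] .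
  moreover have "orb \<alpha> L ((n + m) + N) y z'' = 0" using y(4) by (simp add: orb_add[of \<alpha> L "n + m" N])
  moreover have "\<bar>y - c\<bar> < \<epsilon>" using x(1) x'(1) y(1) by linarith
  ultimately show ?thesis using that y(2) by blast
qed

text \<open>With 0 in the open image over \<open>x1\<close>, iterating the repelling map there
  covers any ball; stability of compact images extends this to nearby fibres.\<close>

lemma covers:
  assumes \<epsilon>: "\<epsilon> > 0" and D: "open D" "D \<noteq> {}"
  shows "\<exists>N. \<exists>\<delta>>0. \<forall>v w. \<bar>v - x1\<bar> < \<delta> \<longrightarrow> cmod w \<le> R \<longrightarrow>
    (\<exists>x z. \<bar>x - c\<bar> < \<epsilon> \<and> z \<in> D \<and> real L ^ N * x - v \<in> \<int> \<and> orb \<alpha> L N x z = w)"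
proof -
  obtain x z n where x: "\<bar>x - c\<bar> < \<epsilon>" "z \<in> D" "real L ^ n * x - x1 \<in> \<int>" "orb \<alpha> L n x z = 0"
    using hits_0[OF assms] .
  have "open (orb \<alpha> L n x ` D)" "0 \<in> orb \<alpha> L n x ` D"
    using open_orb_image[OF D(1)] x by (auto intro: rev_image_eqI)
  then obtain \<rho> where \<rho>: "\<rho> > 0" "ball 0 \<rho> \<subseteq> orb \<alpha> L n x ` D"
    using open_contains_ball by blast
  obtain p where "cball 0 R \<subseteq> (quad (param \<alpha> x1) ^^ p) ` ball 0 \<rho>"
    using quad_iterates_cover_compact[OF norm_param_less_1 repel0 \<rho>(1) compact_cball] by blast
  also have "\<dots> \<subseteq> (quad (param \<alpha> x1) ^^ p) ` (orb \<alpha> L n x ` D)" using \<rho>(2) by (rule image_mono)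
  also have "\<dots> = orb \<alpha> L (n + p) x ` D"
    using orb_fixed[OF fix1 x(3)] by (auto simp: orb_add image_image)
  finally have "\<forall>\<^sub>F y in nhds x. cball 0 R \<subseteq> orb \<alpha> L (n + p) y ` D"
    by (rule compact_subset_orb_image[OF D(1) compact_cball])
  then obtain d where d: "d > 0" "\<And>y. \<bar>y - x\<bar> < d \<Longrightarrow> cball 0 R \<subseteq> orb \<alpha> L (n + p) y ` D"
    unfolding eventually_nhds_metric dist_real_def by blast
  define e where "e = min d (\<epsilon> - \<bar>x - c\<bar>)"
  have e: "e > 0" using d x by (simp add: e_def)
  have Lp: "real L ^ (n + p) > 0" using L by simp
  show ?thesis
  proof (rule exI[of _ "n + p"], rule exI[of _ "e * real L ^ (n + p)"], intro conjI allI impI)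
    show "e * real L ^ (n + p) > 0" using e Lp by simp
    fix v w assume v: "\<bar>v - x1\<bar> < e * real L ^ (n + p)" and w: "cmod w \<le> R"
    define y where "y = x + (v - x1) / real L ^ (n + p)"
    have "\<bar>y - x\<bar> = \<bar>v - x1\<bar> / real L ^ (n + p)" by (simp add: y_def)
    then have y: "\<bar>y - x\<bar> < e" using v Lp by (simp add: pos_divide_less_eq)
    have "w \<in> cball 0 R" using w by simp
    with d(2)[of y] y obtain z' where "z' \<in> D" "orb \<alpha> L (n + p) y z' = w" by (fastforce simp: e_def)
    moreover have "real L ^ (n + p) * y - v \<in> \<int>"
    proof -
      have "real L ^ (n + p) * x - x1 \<in> \<int>" using Ints_add_trans[OF x(3) fixed_power[OF fix1]] .
      moreover have "real L ^ (n + p) * y - v = real L ^ (n + p) * x - x1" using Lp by (simp add: y_def field_simps)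
      ultimately show ?thesis by simp
    qed
    moreover have "\<bar>y - c\<bar> < \<epsilon>" using y unfolding e_def by linarith
    ultimately show "\<exists>x z. \<bar>x - c\<bar> < \<epsilon> \<and> z \<in> D \<and> real L ^ (n + p) * x - v \<in> \<int> \<and> orb \<alpha> L (n + p) x z = w"
      by blast
  qed
qed

text \<open>The time in \<open>covers\<close> is fixed; the surplus n - N is spent afterwards in a
  cylinder at \<open>x1\<close> that ends over the target. There points beyond radius
  \<open>10 / \<beta>\<close> only move outwards, so a preimage of w stays in the ball of radius R
  whatever the surplus.\<close>

lemma mixes:
  assumes \<epsilon>: "\<epsilon> > 0" and D: "open D" "D \<noteq> {}"
  shows "\<exists>N0. \<forall>n\<ge>N0. \<exists>x z. \<bar>x - c\<bar> < \<epsilon> \<and> z \<in> D \<and> real L ^ n * x - v \<in> \<int> \<and> orb \<alpha> L n x z = w"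
proof -
  define R where "R = max (10 / \<beta>) (cmod w)"
  obtain N \<delta> where N: "\<delta> > 0" "\<And>v w. \<bar>v - x1\<bar> < \<delta> \<Longrightarrow> cmod w \<le> R \<Longrightarrow>
      \<exists>x z. \<bar>x - c\<bar> < \<epsilon> \<and> z \<in> D \<and> real L ^ N * x - v \<in> \<int> \<and> orb \<alpha> L N x z = w"
    using covers[OF assms, of R c] by blast
  obtain q where q: "\<And>y. y \<in> cyl L q x1 \<Longrightarrow> \<bar>y - x1\<bar> < \<delta>"
    using small_cyl[OF N(1), of L 0 x1] L by auto
  show ?thesis
  proof (rule exI[of _ "N + q"], intro allI impI)
    fix n assume "n \<ge> N + q"
    then have k: "n = N + (n - N)" "n - N \<ge> q" by auto
    define k where "k = n - N"
    note k = k[folded k_def]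
    obtain y where y: "y \<in> cyl L k x1" "real L ^ k * y - frac v \<in> \<int>"
    proof -
      have "L > 0" using L by simp
      from that cyl_target[OF this frac_ge_0 frac_lt_1] show ?thesis by blast
    qed
    have "frac v - v \<in> \<int>" by (simp add: frac_def)
    from Ints_add[OF y(2) this] have yv: "real L ^ k * y - v \<in> \<int>" by simp
    obtain w' where w': "orb \<alpha> L k y w' = w" using orb_surj by blast
    have "cmod w' \<le> R"
    proof (rule ccontr)
      assume "\<not> cmod w' \<le> R"
      then have gt: "cmod w' > R" by simp
      have "2 ^ k * cmod w' \<le> cmod (orb \<alpha> L k y w')"
        using gt a by (intro orb_far[OF \<beta>(1)] param_near_x1[OF y(1)]) (auto simp: R_def)
      moreover have "1 * cmod w' \<le> 2 ^ k * cmod w'" by (intro mult_right_mono) auto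
      ultimately show False using w' gt by (simp add: R_def)
    qed
    moreover have "\<bar>y - x1\<bar> < \<delta>" using q cyl_mono[OF y(1) k(2)] L by simp
    ultimately obtain x z where xz: "\<bar>x - c\<bar> < \<epsilon>" "z \<in> D" "real L ^ N * x - y \<in> \<int>" "orb \<alpha> L N x z = w'"
      using N(2) by blast
    have "orb \<alpha> L n x z = w" unfolding k(1) using orb_add_cong[OF xz(3)] xz(4) w' by simp
    moreover have "real L ^ n * x - v \<in> \<int>" unfolding k(1) using Ints_add_trans[OF xz(3) yv] .
    ultimately show "\<exists>x z. \<bar>x - c\<bar> < \<epsilon> \<and> z \<in> D \<and> real L ^ n * x - v \<in> \<int> \<and> orb \<alpha> L n x z = w"
      using xz by blast
  qed
qed

end

section \<open>Lebesgue measure and multiplication by a natural number\<close>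

lemma periodic_nat:
  fixes H :: "real \<Rightarrow> 'a"
  assumes "\<And>x. H (x + 1) = H x"
  shows "H (x + real n) = H x"
proof (induction n)
  case (Suc n)
  have "H (x + real (Suc n)) = H ((x + real n) + 1)" by (simp add: algebra_simps)
  then show ?case using Suc assms by simp
qed simp

definition unit_cell :: "nat \<Rightarrow> nat \<Rightarrow> real set" where
  "unit_cell L j = {real j / real L..<(real j + 1) / real L}"

lemma unit_cell_measurable [measurable]: "unit_cell L j \<in> sets borel"
  by (simp add: unit_cell_def)

lemma sum_indicator_unit_cell:
  assumes "L > 0"
  shows "(\<Sum>j<L. indicator (unit_cell L j) x) = (indicator {0..<1} x :: ennreal)"
proof (cases "x \<in> {0..<1}")
  case True
  define i where "i = nat \<lfloor>real L * x\<rfloor>"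
  have i: "real i \<le> real L * x" "real L * x < real i + 1"
    using True assms by (auto simp: i_def)
  have iL: "i < L"
  proof -
    have "real L * x < real L * 1" using True assms by (intro mult_strict_left_mono) auto
    then have "real i < real L" using i(1) by linarith
    then show ?thesis by simp
  qed
  have eq: "x \<in> unit_cell L j \<longleftrightarrow> j = i" for j
  proof -
    have "x \<in> unit_cell L j \<longleftrightarrow> real j \<le> real L * x \<and> real L * x < real j + 1"
      using assms by (auto simp: unit_cell_def field_simps)
    also have "\<dots> \<longleftrightarrow> j = i"
    proof
      assume j: "real j \<le> real L * x \<and> real L * x < real j + 1"
      have "real j < real i + 1" "real i < real j + 1" using i j by linarith+
      then show "j = i" by linarith
    qed (use i in auto)
    finally show ?thesis .
  qed
  have "(\<Sum>j<L. indicator (unit_cell L j) x) = (\<Sum>j<L. if j = i then 1 else (0 :: ennreal))"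
    by (intro sum.cong) (auto simp: eq)
  then show ?thesis using iL True by simp
next
  case False
  have "x \<notin> unit_cell L j" if "j < L" for j
  proof
    assume "x \<in> unit_cell L j"
    then have "0 \<le> x" "x < (real j + 1) / real L"
      using order_trans[of 0 "real j / real L" x] by (auto simp: unit_cell_def)
    moreover have "(real j + 1) / real L \<le> 1" using that by simp
    ultimately show False using False by auto
  qed
  then show ?thesis using False by simp
qed

lemma nn_integral_unit_cell:
  fixes H :: "real \<Rightarrow> ennreal"
  assumes L: "L > 0" and [measurable]: "H \<in> borel_measurable borel" and per: "\<And>x. H (x + 1) = H x"
  shows "(\<integral>\<^sup>+x. H (real L * x) * indicator (unit_cell L j) x \<partial>lborel) =
    ennreal (1 / real L) * (\<integral>\<^sup>+x. H x * indicator {0..<1} x \<partial>lborel)"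
proof -
  have "(\<integral>\<^sup>+x. H (real L * x) * indicator (unit_cell L j) x \<partial>lborel) =
    ennreal \<bar>1 / real L\<bar> * (\<integral>\<^sup>+x. H (real L * (real j / real L + 1 / real L * x)) *
      indicator (unit_cell L j) (real j / real L + 1 / real L * x) \<partial>lborel)"
    using L by (intro nn_integral_real_affine) auto
  also have "(\<lambda>x. H (real L * (real j / real L + 1 / real L * x)) *
      indicator (unit_cell L j) (real j / real L + 1 / real L * x)) = (\<lambda>x. H x * indicator {0..<1} x)"
  proof
    fix x
    have "real L * (real j / real L + 1 / real L * x) = x + real j" using L by (simp add: field_simps)
    moreover have "real j / real L + 1 / real L * x \<in> unit_cell L j \<longleftrightarrow> x \<in> {0..<1}"
      using L by (auto simp: unit_cell_def field_simps)
    ultimately show "H (real L * (real j / real L + 1 / real L * x)) *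
      indicator (unit_cell L j) (real j / real L + 1 / real L * x) = H x * indicator {0..<1} x"
      using periodic_nat[of H x j] per by (simp add: indicator_def)
  qed
  finally show ?thesis by simp
qed

text \<open>The first factor is an upper Riemann sum of \<open>g\<close>; it bounds the transfer operator with weight \<open>g\<close>.\<close>

lemma nn_integral_transfer:
  fixes g H :: "real \<Rightarrow> ennreal"
  assumes L: "L > 0" and [measurable]: "H \<in> borel_measurable borel"
    and per: "\<And>x. H (x + 1) = H x" and c: "\<And>j x. j < L \<Longrightarrow> x \<in> unit_cell L j \<Longrightarrow> g x \<le> c j"
  shows "(\<integral>\<^sup>+x. g x * H (real L * x) * indicator {0..<1} x \<partial>lborel) \<le>
    (\<Sum>j<L. c j) * ennreal (1 / real L) * (\<integral>\<^sup>+x. H x * indicator {0..<1} x \<partial>lborel)"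
proof -
  have "(\<integral>\<^sup>+x. g x * H (real L * x) * indicator {0..<1} x \<partial>lborel) =
    (\<integral>\<^sup>+x. (\<Sum>j<L. g x * H (real L * x) * indicator (unit_cell L j) x) \<partial>lborel)"
    by (simp add: sum_indicator_unit_cell[OF L] flip: sum_distrib_left)
  also have "\<dots> \<le> (\<integral>\<^sup>+x. (\<Sum>j<L. c j * (H (real L * x) * indicator (unit_cell L j) x)) \<partial>lborel)"
  proof (intro nn_integral_mono sum_mono)
    fix x j assume "j \<in> {..<L}"
    then show "g x * H (real L * x) * indicator (unit_cell L j) x \<le> c j * (H (real L * x) * indicator (unit_cell L j) x)"
      using c[of j x] by (auto simp: indicator_def intro: mult_right_mono)
  qed
  also have "\<dots> = (\<Sum>j<L. c j * (\<integral>\<^sup>+x. H (real L * x) * indicator (unit_cell L j) x \<partial>lborel))"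
    by (subst nn_integral_sum) (auto simp: nn_integral_cmult)
  also have "\<dots> = (\<Sum>j<L. c j) * ennreal (1 / real L) * (\<integral>\<^sup>+x. H x * indicator {0..<1} x \<partial>lborel)"
    by (simp add: nn_integral_unit_cell[where H = H, OF L _ per] sum_distrib_right mult.assoc)
  finally show ?thesis .
qed

text \<open>Multiplication by \<open>L\<close> mod 1 preserves Lebesgue measure; this is
  \<open>nn_integral_transfer\<close> with weight 1. A subset of the circle is represented by a
  periodic set.\<close>

lemma emeasure_preimage_le:
  fixes A :: "real set"
  assumes L: "L > 0" and A: "A \<in> sets borel" and per: "\<And>x. x + 1 \<in> A \<longleftrightarrow> x \<in> A"
  shows "emeasure lborel {x \<in> {0..<1}. real L * x \<in> A} \<le> emeasure lborel (A \<inter> {0..<1})"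
proof -
  have [measurable]: "A \<in> sets borel" by (rule A)
  have "emeasure lborel {x \<in> {0..<1}. real L * x \<in> A} =
     (\<integral>\<^sup>+x. indicator {x \<in> {0..<1}. real L * x \<in> A} x \<partial>lborel)"
    by (subst nn_integral_indicator) auto
  also have "\<dots> = (\<integral>\<^sup>+x. 1 * indicator A (real L * x) * indicator {0..<1} x \<partial>lborel)"
    by (intro nn_integral_cong) (auto simp: indicator_def)
  also have "\<dots> \<le> (\<Sum>j<L. 1) * ennreal (1 / real L) * (\<integral>\<^sup>+x. indicator A x * indicator {0..<1} x \<partial>lborel)"
    using per by (intro nn_integral_transfer L) (auto simp: indicator_def)
  also have "(\<Sum>j<L. 1) * ennreal (1 / real L) = 1"
    using L by (simp add: ennreal_of_nat_eq_real_of_nat flip: ennreal_mult)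
  also have "(\<integral>\<^sup>+x. indicator A x * indicator {0..<1} x \<partial>lborel) = emeasure lborel (A \<inter> {0..<1})"
  proof -
    have "(\<integral>\<^sup>+x. indicator A x * indicator {0..<1} x \<partial>lborel) = (\<integral>\<^sup>+x. indicator (A \<inter> {0..<1}) x \<partial>lborel)"
      by (intro nn_integral_cong) (auto simp: indicator_def)
    then show ?thesis by simp
  qed
  finally show ?thesis by simp
qed

text \<open>Peeling off the first factor leaves the shorter product at L x. Thus
  \<open>\<theta>\<close> serves as the mean of g, and the factors behave as if independent.\<close>

lemma nn_integral_product_le:
  fixes g :: "real \<Rightarrow> ennreal"
  assumes L: "L > 0" and [measurable]: "g \<in> borel_measurable borel"
    and per: "\<And>x. g (x + 1) = g x" and c: "\<And>j x. j < L \<Longrightarrow> x \<in> unit_cell L j \<Longrightarrow> g x \<le> c j"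
    and \<theta>: "(\<Sum>j<L. c j) * ennreal (1 / real L) \<le> \<theta>"
  shows "(\<integral>\<^sup>+x. (\<Prod>k<n. g (real L ^ k * x)) * indicator {0..<1} x \<partial>lborel) \<le> \<theta> ^ n"
proof (induction n)
  case (Suc n)
  let ?H = "\<lambda>x. \<Prod>k<n. g (real L ^ k * x)"
  have H: "?H (x + 1) = ?H x" for x
  proof (intro prod.cong refl)
    fix k
    have "real L ^ k * (x + 1) = real L ^ k * x + real (L ^ k)" by (simp add: algebra_simps)
    then show "g (real L ^ k * (x + 1)) = g (real L ^ k * x)"
      using periodic_nat[of g "real L ^ k * x" "L ^ k"] per by simp
  qed
  have "(\<Prod>k<Suc n. g (real L ^ k * x)) = g x * ?H (real L * x)" for x
    by (subst prod.lessThan_Suc_shift) (simp add: mult_ac)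
  then have "(\<integral>\<^sup>+x. (\<Prod>k<Suc n. g (real L ^ k * x)) * indicator {0..<1} x \<partial>lborel) =
      (\<integral>\<^sup>+x. g x * ?H (real L * x) * indicator {0..<1} x \<partial>lborel)" by simp
  also have "\<dots> \<le> (\<Sum>j<L. c j) * ennreal (1 / real L) * (\<integral>\<^sup>+x. ?H x * indicator {0..<1} x \<partial>lborel)"
    by (rule nn_integral_transfer[where H = ?H, OF L _ H c]) auto
  also have "\<dots> \<le> \<theta> * \<theta> ^ n" using Suc \<theta> by (intro mult_mono) auto
  finally show ?case by simp
qed simp

section \<open>Almost every orbit of the expanding map visits every interval infinitely often\<close>

text \<open>For a power \<open>M\<close> of \<open>L\<close> a cell of length 1/M fits into [c, d].
  Base-M digits are independent, so avoiding this cell under all powers of M has probability 0;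
  preimages under powers of \<open>L\<close> handle visits after time N.\<close>

lemma AE_visits_interval:
  assumes L: "L \<ge> 2" and c: "0 \<le> c" "c < d" "d \<le> 1"
  shows "AE x in lborel. x \<in> {0..<1} \<longrightarrow> (\<forall>N. \<exists>n\<ge>N. frac (real L ^ n * x) \<in> {c..d})"
proof -
  \<comment> \<open>Two cell lengths are less than d - c, so the first cell that starts at or after
    c ends before d.\<close>
  obtain m where m: "2 / (d - c) < real L ^ m" using real_arch_pow[of "real L"] L by auto
  define M where "M = L ^ m"
  have M: "2 / (d - c) < real M" "M > 0" using m L by (auto simp: M_def)
  then have M2: "2 < (d - c) * real M" using c by (simp add: field_simps)
  define i where "i = nat \<lceil>c * real M\<rceil>"
  have i: "c * real M \<le> real i" "real i < c * real M + 1"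
  proof -
    have "0 \<le> c * real M" using c by simp
    then show "c * real M \<le> real i" "real i < c * real M + 1" unfolding i_def by linarith+
  qed
  have id: "real i + 1 \<le> d * real M" using i M2 by (simp add: algebra_simps)
  have iM: "i < M"
  proof -
    have "d * real M \<le> 1 * real M" using c by (intro mult_right_mono) auto
    then show ?thesis using id by simp
  qed
  have sub: "x \<in> {c..d}" if "x \<in> unit_cell M i" for x
  proof -
    have "c \<le> real i / real M" "(real i + 1) / real M \<le> d" using i id M by (auto simp: field_simps)
    then show ?thesis using that by (auto simp: unit_cell_def)
  qed
  define B where "B = {x. frac x \<notin> unit_cell M i}"
  have [measurable]: "B \<in> sets borel" unfolding B_def frac_def by measurable
  define \<theta> where "\<theta> = 1 - 1 / real M"
  have \<theta>: "0 \<le> \<theta>" "\<theta> < 1" using M by (auto simp: \<theta>_def)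
  define C where "C = (\<Inter>k. {x. real M ^ k * x \<in> B})"
  have [measurable]: "C \<in> sets borel"
    unfolding C_def by (intro sets.countable_INT) auto
  have perB: "x + real k \<in> B \<longleftrightarrow> x \<in> B" for x k by (simp add: B_def frac_def)
  have perC: "x + 1 \<in> C \<longleftrightarrow> x \<in> C" for x
  proof -
    have "real M ^ k * (x + 1) \<in> B \<longleftrightarrow> real M ^ k * x \<in> B" for k
      using perB[of "real M ^ k * x" "M ^ k"] by (simp add: algebra_simps)
    then show ?thesis by (simp add: C_def)
  qed
  have "emeasure lborel (C \<inter> {0..<1}) \<le> ennreal \<theta> ^ n" for n
  proof -
    have "emeasure lborel (C \<inter> {0..<1}) = (\<integral>\<^sup>+x. indicator (C \<inter> {0..<1}) x \<partial>lborel)" by simp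
    also have "\<dots> \<le> (\<integral>\<^sup>+x. (\<Prod>k<n. indicator B (real M ^ k * x)) * indicator {0..<1} x \<partial>lborel)"
      by (intro nn_integral_mono) (auto simp: indicator_def C_def)
    also have "\<dots> \<le> ennreal \<theta> ^ n"
    proof (rule nn_integral_product_le[where c = "\<lambda>j. if j = i then 0 else 1"])
      show "indicator B x \<le> (if j = i then 0 else 1 :: ennreal)" if "j < M" "x \<in> unit_cell M j" for j x
      proof (cases "j = i")
        case True
        have "x \<in> {0..<1}"
        proof -
          have "x \<ge> 0" using that(2) order_trans[of 0 "real j / real M" x] by (auto simp: unit_cell_def)
          moreover have "(real j + 1) / real M \<le> 1" using that(1) by simp
          ultimately show ?thesis using that(2) by (auto simp: unit_cell_def)
        qed
        then have "frac x = x" by (simp add: frac_eq)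
        then have "x \<notin> B" using that True by (simp add: B_def)
        then show ?thesis by simp
      qed (simp add: indicator_def)
      have "(\<Sum>j<M. if j = i then 0 else 1 :: ennreal) = (\<Sum>j\<in>{..<M} - {i}. 1)"
        by (rule sum.mono_neutral_cong_right) auto
      also have "\<dots> = ennreal (real (M - 1))"
        using iM by (simp add: ennreal_of_nat_eq_real_of_nat)
      finally show "(\<Sum>j<M. if j = i then 0 else 1 :: ennreal) * ennreal (1 / real M) \<le> ennreal \<theta>"
        using M by (simp add: \<theta>_def of_nat_diff field_simps flip: ennreal_mult)
      show "indicator B (x + 1) = (indicator B x :: ennreal)" for x
        using perB[of x 1] by (simp add: indicator_def)
    qed (use M in auto)
    finally show ?thesis .
  qed
  then have "emeasure lborel (C \<inter> {0..<1}) \<le> ennreal (\<theta> ^ n)" for n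
    using \<theta> by (simp add: ennreal_power)
  moreover have "(\<lambda>n. ennreal (\<theta> ^ n)) \<longlonglongrightarrow> ennreal 0"
    using \<theta> by (intro tendsto_ennrealI LIMSEQ_power_zero) auto
  ultimately have C0: "emeasure lborel (C \<inter> {0..<1}) = 0"
    using LIMSEQ_le_const[of "\<lambda>n. ennreal (\<theta> ^ n)" 0 "emeasure lborel (C \<inter> {0..<1})"] by auto
  have null: "{x \<in> {0..<1}. real L ^ N * x \<in> C} \<in> null_sets lborel" for N
  proof -
    have "emeasure lborel {x \<in> {0..<1}. real (L ^ N) * x \<in> C} \<le> 0"
      using emeasure_preimage_le[of "L ^ N" C] perC L C0 by simp
    then show ?thesis by (intro null_setsI) auto
  qed
  have "AE x in lborel. \<forall>N. x \<notin> {x \<in> {0..<1}. real L ^ N * x \<in> C}"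
    by (subst AE_all_countable) (intro allI AE_not_in null)
  then show ?thesis
  proof eventually_elim
    case (elim x)
    show ?case
    proof (intro impI allI)
      fix N assume "x \<in> {0..<1}"
      with elim have "real L ^ N * x \<notin> C" by simp
      then obtain k where "real M ^ k * (real L ^ N * x) \<notin> B" by (auto simp: C_def)
      then have "frac (real L ^ (m * k + N) * x) \<in> unit_cell M i"
        by (simp add: B_def M_def power_add power_mult mult.assoc)
      with sub show "\<exists>n\<ge>N. frac (real L ^ n * x) \<in> {c..d}"
        by (intro exI[of _ "m * k + N"]) auto
    qed
  qed
qed

section \<open>The basin of infinity\<close>

text \<open>The zeros are 1/4 and 3/4, and near each of them |cos| grows at least with slope 2; two
  intervals of length s remain.\<close>

lemma small_cos_measure:
  assumes s: "0 < s" "s \<le> 1/4"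
  shows "emeasure lborel ({x. \<bar>cos (2 * pi * x)\<bar> < s} \<inter> {0..<1}) \<le> ennreal (2 * s)"
proof -
  have key: "\<bar>y\<bar> < s / 2" if y: "\<bar>y\<bar> \<le> 1/4" "\<bar>sin (2 * pi * y)\<bar> < s" for y :: real
  proof -
    define u where "u = 2 * pi * \<bar>y\<bar>"
    have u: "0 \<le> u" "u \<le> pi / 2" using y by (auto simp: u_def field_simps)
    have su: "sin u < s"
      using y(2) by (cases "y \<ge> 0") (auto simp: u_def abs_less_iff)
    have "u \<le> 1/2"
    proof (rule ccontr)
      assume "\<not> u \<le> 1/2"
      then have "sin (1/2) \<le> sin u" using u by (intro sin_monotone_2pi_le) auto
      moreover have "1/4 \<le> sin (1/2 :: real)" using half_le_sin[of "1/2"] by simp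
      ultimately show False using su s by simp
    qed
    then have "u < 2 * s" using half_le_sin[of u] u su by simp
    then have "pi * \<bar>y\<bar> < s" by (simp add: u_def)
    moreover have "2 * \<bar>y\<bar> \<le> pi * \<bar>y\<bar>" using pi_ge_two by (intro mult_right_mono) auto
    ultimately show ?thesis by simp
  qed
  have "{x. \<bar>cos (2 * pi * x)\<bar> < s} \<inter> {0..<1} \<subseteq> {1/4 - s/2..1/4 + s/2} \<union> {3/4 - s/2..3/4 + s/2}"
  proof
    fix x assume x: "x \<in> {x. \<bar>cos (2 * pi * x)\<bar> < s} \<inter> {0..<1}"
    then have x01: "0 \<le> x" "x < 1" by auto
    show "x \<in> {1/4 - s/2..1/4 + s/2} \<union> {3/4 - s/2..3/4 + s/2}"
    proof (cases "x \<le> 1/2")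
      case True
      have "sin (2 * pi * (x - 1/4)) = - cos (2 * pi * x)"
      proof -
        have "2 * pi * (x - 1/4) = 2 * pi * x - pi / 2" by (simp add: field_simps)
        then show ?thesis by (simp add: sin_diff)
      qed
      moreover have "\<bar>x - 1/4\<bar> \<le> 1/4" using x01 True by linarith
      ultimately have "\<bar>x - 1/4\<bar> < s / 2" using x by (intro key) auto
      then have "1/4 - s/2 \<le> x" "x \<le> 1/4 + s/2" by linarith+
      then show ?thesis by auto
    next
      case False
      have "sin (2 * pi * (x - 3/4)) = cos (2 * pi * x)"
      proof -
        have "2 * pi * (x - 3/4) = (2 * pi * x - pi / 2) - pi" by (simp add: field_simps)
        then show ?thesis by (simp only: sin_diff[of _ pi]) (simp add: sin_diff)
      qed
      moreover have "\<bar>x - 3/4\<bar> \<le> 1/4" using x01 False by linarith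
      ultimately have "\<bar>x - 3/4\<bar> < s / 2" using x by (intro key) auto
      then have "3/4 - s/2 \<le> x" "x \<le> 3/4 + s/2" by linarith+
      then show ?thesis by auto
    qed
  qed
  then have "emeasure lborel ({x. \<bar>cos (2 * pi * x)\<bar> < s} \<inter> {0..<1}) \<le>
      emeasure lborel ({1/4 - s/2..1/4 + s/2} \<union> {3/4 - s/2..3/4 + s/2})"
    by (intro emeasure_mono) auto
  also have "\<dots> \<le> emeasure lborel {1/4 - s/2..1/4 + s/2} + emeasure lborel {3/4 - s/2..3/4 + s/2}"
    by (intro emeasure_subadditive) auto
  also have "\<dots> = ennreal (2 * s)" using s by (simp flip: ennreal_plus)
  finally show ?thesis .
qed

text \<open>Small parameters weaken the attraction of infinity, but the fibres with |cos| < s / 2^k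
  at some time k have total measure at most 4s. Elsewhere growth by 4 in each step outruns the
  halving of the lower bound, so the estimate sustains itself.\<close>

lemma basin_infinity_large:
  assumes L: "L > 0" and a: "\<alpha> \<noteq> 0" "cmod \<alpha> \<le> 1" and \<delta>: "\<delta> > 0"
  obtains G R where "G \<in> sets borel" "emeasure lborel ({0..<1} - G) \<le> ennreal \<delta>"
    "\<And>x z. x \<in> G \<Longrightarrow> R \<le> cmod z \<Longrightarrow> filterlim (\<lambda>n. orb \<alpha> L n x z) at_infinity sequentially"
proof -
  define s where "s = min (1/4) (\<delta> / 4)"
  have s: "0 < s" "s \<le> 1/4" "4 * s \<le> \<delta>" using \<delta> by (auto simp: s_def)
  define G where "G = {x. \<forall>k. s / 2 ^ k \<le> \<bar>cos (2 * pi * (real L ^ k * x))\<bar>}"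
  have G_sets: "G \<in> sets borel" unfolding G_def by measurable
  let ?A = "\<lambda>k::nat. {x. \<bar>cos (2 * pi * x)\<bar> < s / 2 ^ k}"
  have m: "emeasure lborel {x \<in> {0..<1}. real L ^ k * x \<in> ?A k} \<le> ennreal (2 * s * (1/2) ^ k)" for k
  proof -
    have per: "\<bar>cos (2 * pi * (x + 1))\<bar> = \<bar>cos (2 * pi * x)\<bar>" for x
      using cos_2pi_cong[of "x + 1" x] by simp
    have "emeasure lborel {x \<in> {0..<1}. real (L ^ k) * x \<in> ?A k} \<le> emeasure lborel (?A k \<inter> {0..<1})"
      by (rule emeasure_preimage_le) (use L per in auto)
    also have "\<dots> \<le> ennreal (2 * (s / 2 ^ k))"
    proof (rule small_cos_measure)
      have "s / 2 ^ k \<le> s / 1" using s by (intro divide_left_mono) auto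
      then show "s / 2 ^ k \<le> 1/4" using s by linarith
    qed (use s in auto)
    finally show ?thesis by (simp add: power_divide)
  qed
  have "{0..<1} - G = (\<Union>k. {x \<in> {0..<1}. real L ^ k * x \<in> ?A k})" unfolding G_def by (auto simp: not_le) (meson not_le)
  then have "emeasure lborel ({0..<1} - G) \<le> (\<Sum>k. emeasure lborel {x \<in> {0..<1}. real L ^ k * x \<in> ?A k})"
    by (simp only:) (intro emeasure_subadditive_countably, auto)
  also have "\<dots> \<le> (\<Sum>k. ennreal (2 * s * (1/2) ^ k))"
    using m by (intro suminf_le) auto
  also have "\<dots> = ennreal (\<Sum>k. 2 * s * (1/2) ^ k)"
    using s by (intro suminf_ennreal2 summable_mult summable_geometric) auto
  also have "(\<Sum>k. 2 * s * (1/2) ^ k) = 4 * s"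
    using s by (subst suminf_mult) (auto simp: suminf_geometric)
  also have "ennreal (4 * s) \<le> ennreal \<delta>" using s by (intro ennreal_leI)
  finally have meas: "emeasure lborel ({0..<1} - G) \<le> ennreal \<delta>" .
  \<comment> \<open>The 6 is the growth rate 4 plus the bound 2 for |1 + b|.\<close>
  define R where "R = 6 / (cmod \<alpha> * s)"
  have R: "R > 0" using a s by (simp add: R_def)
  have "filterlim (\<lambda>n. orb \<alpha> L n x z) at_infinity sequentially" if x: "x \<in> G" and z: "R \<le> cmod z" for x z
  proof -
    have grow: "R * 4 ^ n \<le> cmod (orb \<alpha> L n x z)" for n
    proof (induction n)
      case (Suc n)
      let ?b = "param \<alpha> (real L ^ n * x)" and ?w = "orb \<alpha> L n x z"
      have "s / 2 ^ n \<le> \<bar>cos (2 * pi * (real L ^ n * x))\<bar>" using x by (simp add: G_def)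
      from mult_left_mono[OF this, of "cmod \<alpha>"]
      have "cmod \<alpha> * (s / 2 ^ n) \<le> cmod ?b" by (simp add: param_def norm_mult)
      then have "(cmod \<alpha> * (s / 2 ^ n)) * (R * 4 ^ n) \<le> cmod (?b * ?w)"
        unfolding norm_mult using Suc a s R by (intro mult_mono) auto
      moreover have "(cmod \<alpha> * (s / 2 ^ n)) * (R * 4 ^ n) = 6 * 2 ^ n"
      proof -
        have "(4::real) ^ n = 2 ^ n * 2 ^ n" by (simp flip: power_mult_distrib)
        then show ?thesis using a s by (simp add: R_def)
      qed
      moreover have "(1::real) \<le> 2 ^ n" by simp
      ultimately have "6 \<le> cmod (?b * ?w)" by linarith
      moreover have "cmod (1 + ?b) \<le> 2"
        using norm_triangle_ineq[of 1 ?b] norm_param_le[of \<alpha> "real L ^ n * x"] a by simp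
      ultimately have "4 \<le> cmod (1 + ?b - ?b * ?w)"
        using norm_triangle_ineq2[of "?b * ?w" "1 + ?b"] by (simp add: norm_minus_commute)
      then have "4 * cmod ?w \<le> cmod (1 + ?b - ?b * ?w) * cmod ?w" by (intro mult_right_mono) auto
      then have "4 * cmod ?w \<le> cmod (orb \<alpha> L (Suc n) x z)"
        by (simp add: quad_factor norm_mult mult.commute)
      then show ?case using Suc by simp
    qed (use z in simp)
    have "filterlim (\<lambda>n. R * real n) at_top sequentially"
      by (rule filterlim_tendsto_pos_mult_at_top[OF tendsto_const R filterlim_real_sequentially])
    then have "filterlim (\<lambda>n. cmod (orb \<alpha> L n x z)) at_top sequentially"
    proof (rule filterlim_at_top_mono, intro always_eventually allI)
      fix n
      have "real n \<le> 2 ^ n" using of_nat_less_two_power[of n, where 'a = real] by simp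
      also have "\<dots> \<le> 4 ^ n" by (intro power_mono) auto
      finally have "R * real n \<le> R * 4 ^ n" using R by simp
      then show "R * real n \<le> cmod (orb \<alpha> L n x z)" using grow[of n] by linarith
    qed
    then show ?thesis by (rule filterlim_norm_at_top_imp_at_infinity)
  qed
  with that G_sets meas show ?thesis by blast
qed

section \<open>The basin of a fixed point with negative Lyapunov exponent\<close>

abbreviation unit_measure :: "real measure" where
  "unit_measure \<equiv> restrict_space lborel {0..<1}"

lemma finite_unit_measure: "finite_measure unit_measure"
  by (rule finite_measureI) (simp add: emeasure_restrict_space)

lemma measure_unit_measure: "measure unit_measure (space unit_measure) = 1"
  by (simp add: measure_def emeasure_restrict_space)

lemma exp_le_quadratic:
  fixes y :: real
  assumes "\<bar>y\<bar> \<le> 1"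
  shows "exp y \<le> 1 + y + y\<^sup>2"
proof (cases "y \<ge> 0")
  case True
  then show ?thesis using exp_bound[of y] assms by simp
next
  case False
  define w where "w = - y"
  have w: "0 < w" using False by (simp add: w_def)
  have "exp (- w) \<le> 1 / (1 + w)"
    using exp_ge_add_one_self[of w] w by (simp add: exp_minus field_simps)
  also have "\<dots> \<le> 1 - w + w\<^sup>2"
  proof -
    have "(1 + w) * (1 - w + w\<^sup>2) = 1 + w ^ 3" by (simp add: algebra_simps power2_eq_square power3_eq_cube)
    moreover have "0 \<le> w ^ 3" using w by simp
    ultimately have "1 \<le> (1 + w) * (1 - w + w\<^sup>2)" by linarith
    then show ?thesis using w by (simp add: divide_le_eq mult.commute)
  qed
  finally show ?thesis by (simp add: w_def)
qed

text \<open>As a function of t the mean of exp (t f) has at t = 0 the value 1 and the derivative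
  \<open>integral\<^sup>L unit_measure f\<close>, which is negative.\<close>

lemma exp_moment_less_1:
  fixes f :: "real \<Rightarrow> real"
  assumes f: "f \<in> borel_measurable borel" "\<And>x. \<bar>f x\<bar> \<le> M" and neg: "integral\<^sup>L unit_measure f < 0"
  obtains t where "0 < t" "integral\<^sup>L unit_measure (\<lambda>x. exp (t * f x)) < 1"
proof -
  interpret finite_measure unit_measure by (rule finite_unit_measure)
  have [measurable]: "f \<in> borel_measurable unit_measure"
    using f(1) by (simp add: measurable_restrict_space1)
  have int: "integrable unit_measure f"
    using f(2) by (intro integrable_const_bound[of _ M]) auto
  define B where "B = \<bar>M\<bar> + 1"
  have B: "B > 0" "\<bar>f x\<bar> \<le> B" for x using f(2)[of x] by (auto simp: B_def)
  define I where "I = integral\<^sup>L unit_measure f"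
  \<comment> \<open>1 / B keeps t f in the range of \<open>exp_le_quadratic\<close>; the second
    bound lets the quadratic term cost at most half of the linear gain.\<close>
  define t where "t = min (1 / B) (- I / (2 * B\<^sup>2))"
  have t: "t > 0" "t \<le> 1 / B" "t \<le> - I / (2 * B\<^sup>2)" using B(1) neg by (auto simp: t_def I_def divide_neg_pos)
  have tf: "\<bar>t * f x\<bar> \<le> 1" for x
  proof -
    have "\<bar>t * f x\<bar> \<le> 1 / B * B" unfolding abs_mult using t B by (intro mult_mono) auto
    then show ?thesis using B by simp
  qed
  have pw: "exp (t * f x) \<le> 1 + t * f x + t\<^sup>2 * B\<^sup>2" for x
  proof -
    have "(f x)\<^sup>2 \<le> B\<^sup>2" using B(2)[of x] B(1) by (metis abs_le_square_iff abs_of_pos)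
    then have "t\<^sup>2 * (f x)\<^sup>2 \<le> t\<^sup>2 * B\<^sup>2" by (intro mult_left_mono) auto
    then show ?thesis using exp_le_quadratic[OF tf[of x]] by (simp add: power_mult_distrib)
  qed
  have "integral\<^sup>L unit_measure (\<lambda>x. exp (t * f x)) \<le> integral\<^sup>L unit_measure (\<lambda>x. (1 + t\<^sup>2 * B\<^sup>2) + t * f x)"
  proof (rule integral_mono)
    show "integrable unit_measure (\<lambda>x. exp (t * f x))"
      using tf by (intro integrable_const_bound[of _ "exp 1"]) (auto simp: abs_le_iff)
    show "integrable unit_measure (\<lambda>x. (1 + t\<^sup>2 * B\<^sup>2) + t * f x)" using int by auto
  qed (use pw in \<open>auto simp: algebra_simps\<close>)
  also have "\<dots> = 1 + t\<^sup>2 * B\<^sup>2 + t * I"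
    using int measure_unit_measure by (simp add: I_def)
  also have "\<dots> < 1"
  proof -
    have "t * B\<^sup>2 \<le> - I / 2" using t(3) B by (simp add: field_simps)
    then have "t * (t * B\<^sup>2 + I) < 0" using t(1) neg by (intro mult_pos_neg) (auto simp: I_def)
    then show ?thesis by (simp add: power2_eq_square algebra_simps)
  qed
  finally show ?thesis using that t(1) by blast
qed

text \<open>By uniform continuity the value at the left endpoint plus \<open>\<epsilon>\<close>
  bounds g on a cell and exceeds it by at most 2 \<open>\<epsilon>\<close>, which is the gap between
  the integral and \<open>\<theta>\<close>.\<close>

lemma upper_riemann_sum:
  fixes g :: "real \<Rightarrow> real"
  assumes g: "continuous_on UNIV g" "\<And>x. g x \<ge> 0" and int: "integral\<^sup>L unit_measure g < \<theta>"
  shows "\<forall>\<^sub>F L in sequentially. \<exists>c. (\<forall>j<L. \<forall>x\<in>unit_cell L j. g x \<le> c j) \<and> (\<forall>j. 0 \<le> c j) \<and>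
    (\<Sum>j<L. ennreal (c j)) * ennreal (1 / real L) \<le> ennreal \<theta>"
proof -
  interpret finite_measure unit_measure by (rule finite_unit_measure)
  have gm: "g \<in> borel_measurable borel" using g(1) by (rule borel_measurable_continuous_onI)
  have [measurable]: "g \<in> borel_measurable unit_measure" "g \<in> borel_measurable borel"
    using gm by (auto simp: measurable_restrict_space1)
  define \<epsilon> where "\<epsilon> = (\<theta> - integral\<^sup>L unit_measure g) / 2"
  have e: "\<epsilon> > 0" using int by (simp add: \<epsilon>_def)
  have "uniformly_continuous_on {0..1} g"
    by (intro compact_uniformly_continuous continuous_on_subset[OF g(1)]) auto
  from this[unfolded uniformly_continuous_on_def, rule_format, OF e] obtain d where d: "d > 0" "\<And>x y. x \<in> {0..1} \<Longrightarrow> y \<in> {0..1} \<Longrightarrow> dist y x < d \<Longrightarrow> dist (g y) (g x) < \<epsilon>"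
    by auto
  obtain B where B: "\<And>x. x \<in> {0..1} \<Longrightarrow> g x \<le> B"
  proof -
    have "compact (g ` {0..1})"
      by (intro compact_continuous_image continuous_on_subset[OF g(1)]) auto
    then have "bdd_above (g ` {0..1})" by (simp add: bounded_imp_bdd_above compact_imp_bounded)
    then obtain B where "\<forall>y\<in>g ` {0..1}. y \<le> B" unfolding bdd_above_def by blast
    then show ?thesis by (intro that[of B]) blast
  qed
  have intg: "integrable unit_measure g"
  proof (rule integrable_const_bound[of _ B])
    show "AE x in unit_measure. norm (g x) \<le> B"
      using B g(2) by (intro AE_I2) (auto simp: space_restrict_space)
  qed auto
  have "\<forall>\<^sub>F L in sequentially. real L > 1 / d"
    using filterlim_real_sequentially by (simp add: filterlim_at_top_dense)
  then have "\<forall>\<^sub>F L in sequentially. real L > 1 / d \<and> L > 0"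
    using eventually_gt_at_top[of 0] by eventually_elim auto
  then show ?thesis
  proof eventually_elim
    case (elim L)
    then have Ld: "1 / real L < d" "L > 0" using d by (auto simp: field_simps)
    define c where "c = (\<lambda>j::nat. g (real j / real L) + \<epsilon>)"
    have cell: "g x \<le> c j" "c j \<le> g x + 2 * \<epsilon>" if "j < L" "x \<in> unit_cell L j" for j x
    proof -
      have x: "real j / real L \<le> x" "x < real j / real L + 1 / real L"
        using that by (auto simp: unit_cell_def add_divide_distrib)
      have "real j / real L + 1 / real L \<le> 1" using that(1) Ld by (simp add: field_simps)
      moreover have j0: "0 \<le> real j / real L" by simp
      ultimately have x1: "0 \<le> x" "x \<le> 1" using x by linarith+
      have "dist x (real j / real L) < d" using x Ld by (auto simp: dist_real_def)
      then have "dist (g x) (g (real j / real L)) < \<epsilon>"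
      proof (rule d(2)[rotated 2])
        show "real j / real L \<in> {0..1}" "x \<in> {0..1}"
          unfolding atLeastAtMost_iff using x x1 j0 by linarith+
      qed
      then show "g x \<le> c j" "c j \<le> g x + 2 * \<epsilon>" by (auto simp: c_def dist_real_def)
    qed
    have c0: "0 \<le> c j" for j using g(2)[of "real j / real L"] e by (simp add: c_def)
    have "(\<Sum>j<L. ennreal (c j)) * ennreal (1 / real L) = (\<Sum>j<L. \<integral>\<^sup>+x. ennreal (c j) * indicator (unit_cell L j) x \<partial>lborel)"
    proof -
      have "emeasure lborel (unit_cell L j) = ennreal (1 / real L)" for j
        using Ld by (simp add: unit_cell_def divide_right_mono add_divide_distrib)
      then show ?thesis by (simp add: sum_distrib_right nn_integral_cmult_indicator)
    qed
    also have "\<dots> \<le> (\<Sum>j<L. \<integral>\<^sup>+x. ennreal (g x + 2 * \<epsilon>) * indicator (unit_cell L j) x \<partial>lborel)"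
    proof (intro sum_mono nn_integral_mono)
      fix j x assume "j \<in> {..<L}"
      then show "ennreal (c j) * indicator (unit_cell L j) x \<le> ennreal (g x + 2 * \<epsilon>) * indicator (unit_cell L j) x"
        using cell(2)[of j x] by (auto simp: indicator_def intro: ennreal_leI)
    qed
    also have "\<dots> = (\<integral>\<^sup>+x. (\<Sum>j<L. ennreal (g x + 2 * \<epsilon>) * indicator (unit_cell L j) x) \<partial>lborel)"
      by (subst nn_integral_sum) auto
    also have "\<dots> = (\<integral>\<^sup>+x. ennreal (g x + 2 * \<epsilon>) * indicator {0..<1} x \<partial>lborel)"
      by (simp add: sum_indicator_unit_cell[OF Ld(2)] flip: sum_distrib_left)
    also have "\<dots> = (\<integral>\<^sup>+x. ennreal (g x + 2 * \<epsilon>) \<partial>unit_measure)"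
      by (subst nn_integral_restrict_space) auto
    also have "\<dots> = ennreal (integral\<^sup>L unit_measure (\<lambda>x. g x + 2 * \<epsilon>))"
      using g(2) e intg by (intro nn_integral_eq_integral) (auto simp: add_nonneg_nonneg)
    also have "integral\<^sup>L unit_measure (\<lambda>x. g x + 2 * \<epsilon>) = \<theta>"
      using intg measure_unit_measure by (simp add: \<epsilon>_def diff_divide_distrib)
    finally show ?case using cell(1) c0 by (intro exI[of _ c]) auto
  qed
qed

text \<open>Comparison with the linear cocycle \<open>A\<close>: each nonlinear step costs at most a
  further factor exp (|w| / e), where e bounds |1 + b| from below. The total correction is the
  exponential of the summed orbit; if it was at most 2 at all earlier times, the geometric bound on
  \<open>A\<close> keeps the sum below e ln 2, which closes the induction.\<close>

lemma orb_near_0: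
  assumes a: "cmod \<alpha> < 1" and A: "A = (\<lambda>n. \<Prod>k<n. cmod (1 + param \<alpha> (real L ^ k * x)))"
    and bound: "\<And>n. A n \<le> K * p ^ n" and p: "0 < p" "p < 1" and K: "K > 0"
    and z: "cmod z \<le> (1 - cmod \<alpha>) * ln 2 * (1 - p) / (2 * K)"
  shows "(\<lambda>n. orb \<alpha> L n x z) \<longlonglongrightarrow> 0"
proof -
  define e where "e = 1 - cmod \<alpha>"
  have e: "e > 0" using a by (simp add: e_def)
  let ?w = "\<lambda>n. orb \<alpha> L n x z"
  have A0: "A n \<ge> 0" for n by (simp add: A prod_nonneg)
  have growth: "cmod (?w n) \<le> cmod z * A n * exp ((\<Sum>k<n. cmod (?w k)) / e)" for n
  proof (induction n)
    case (Suc n)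
    let ?b = "param \<alpha> (real L ^ n * x)"
    have b: "cmod ?b \<le> cmod \<alpha>" by (rule norm_param_le)
    have be: "e \<le> cmod (1 + ?b)" using norm_triangle_ineq2[of 1 "- ?b"] b by (simp add: e_def)
    have "cmod (1 + ?b - ?b * ?w n) \<le> cmod (1 + ?b) + cmod ?b * cmod (?w n)"
      using norm_triangle_ineq4[of "1 + ?b" "?b * ?w n"] by (simp add: norm_mult)
    also have "cmod ?b * cmod (?w n) \<le> 1 * cmod (?w n)" using b a by (intro mult_right_mono) auto
    also have "1 * cmod (?w n) \<le> cmod (1 + ?b) * (cmod (?w n) / e)"
      using mult_right_mono[OF be, of "cmod (?w n) / e"] e by simp
    finally have "cmod (1 + ?b - ?b * ?w n) \<le> cmod (1 + ?b) * (1 + cmod (?w n) / e)"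
      by (simp add: algebra_simps)
    also have "\<dots> \<le> cmod (1 + ?b) * exp (cmod (?w n) / e)"
      by (intro mult_left_mono) (auto simp: exp_ge_add_one_self)
    finally have "cmod (?w (Suc n)) \<le> cmod (?w n) * (cmod (1 + ?b) * exp (cmod (?w n) / e))"
      by (simp add: quad_factor norm_mult mult_left_mono)
    also have "\<dots> \<le> (cmod z * A n * exp ((\<Sum>k<n. cmod (?w k)) / e)) * (cmod (1 + ?b) * exp (cmod (?w n) / e))"
      using Suc by (intro mult_right_mono) auto
    also have "\<dots> = cmod z * A (Suc n) * exp ((\<Sum>k<Suc n. cmod (?w k)) / e)"
      by (simp add: A add_divide_distrib exp_add mult_ac)
    finally show ?case .
  qed (simp add: A)
  have geo: "(\<Sum>k<n. p ^ k) \<le> 1 / (1 - p)" for n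
  proof -
    have "(\<Sum>k<n. p ^ k) = (1 - p ^ n) / (1 - p)" using p by (simp add: sum_gp_strict)
    also have "\<dots> \<le> 1 / (1 - p)" using p by (intro divide_right_mono) auto
    finally show ?thesis .
  qed
  have main: "cmod (?w n) \<le> 2 * cmod z * A n" for n
  proof (induction n rule: less_induct)
    case (less n)
    have "(\<Sum>k<n. cmod (?w k)) \<le> (\<Sum>k<n. 2 * cmod z * (K * p ^ k))"
    proof (rule sum_mono)
      fix k assume "k \<in> {..<n}"
      then have "cmod (?w k) \<le> 2 * cmod z * A k" using less by simp
      also have "\<dots> \<le> 2 * cmod z * (K * p ^ k)" using bound by (intro mult_left_mono) auto
      finally show "cmod (?w k) \<le> 2 * cmod z * (K * p ^ k)" .
    qed
    also have "\<dots> = 2 * cmod z * K * (\<Sum>k<n. p ^ k)" by (simp add: sum_distrib_left mult.assoc)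
    also have "\<dots> \<le> 2 * cmod z * K * (1 / (1 - p))" using geo K by (intro mult_left_mono) auto
    also have "\<dots> \<le> e * ln 2" using z K p by (simp add: e_def field_simps)
    finally have "(\<Sum>k<n. cmod (?w k)) / e \<le> ln 2" using e by (simp add: field_simps)
    then have "exp ((\<Sum>k<n. cmod (?w k)) / e) \<le> 2" by (metis exp_le_cancel_iff exp_ln zero_less_numeral)
    then have "cmod z * A n * exp ((\<Sum>k<n. cmod (?w k)) / e) \<le> cmod z * A n * 2"
      using A0 by (intro mult_left_mono) auto
    then show ?case using growth[of n] by simp
  qed
  have "cmod (?w n) \<le> 2 * cmod z * K * p ^ n" for n
  proof -
    have "2 * cmod z * A n \<le> 2 * cmod z * (K * p ^ n)" using bound by (intro mult_left_mono) auto
    then show ?thesis using main[of n] by (simp add: mult.assoc)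
  qed
  moreover have "(\<lambda>n. 2 * cmod z * K * p ^ n) \<longlonglongrightarrow> 0"
    using p by (intro tendsto_mult_right_zero LIMSEQ_power_zero) auto
  ultimately show ?thesis by (rule Lim_null_comparison[OF always_eventually[OF allI]])
qed

text \<open>Markov's inequality at level q^n, with q the square root of the moment rate, leaves
  exceptional sets of measure at most q^n, and their tails are small. Taking the power 1/t gives
  decay of the product of multipliers itself; \<open>K\<close> absorbs the first N steps, where each
  factor is only known to be at most 2.\<close>

lemma basin_0_large_of_moments:
  assumes a: "cmod \<alpha> < 1" and t: "t > 0" and \<theta>: "\<theta> < 1"
    and mom: "\<And>n. (\<integral>\<^sup>+x. (\<Prod>k<n. ennreal (cmod (1 + param \<alpha> (real L ^ k * x)) powr t)) * indicator {0..<1} x \<partial>lborel) \<le> ennreal \<theta> ^ n"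
    and \<delta>: "\<delta> > 0"
  obtains G \<rho> where "G \<in> sets borel" "emeasure lborel ({0..<1} - G) \<le> ennreal \<delta>" "\<rho> > 0"
    "\<And>x z. x \<in> G \<Longrightarrow> cmod z \<le> \<rho> \<Longrightarrow> (\<lambda>n. orb \<alpha> L n x z) \<longlonglongrightarrow> 0"
proof -
  \<comment> \<open>The maximum makes the rate positive, as the divisions by powers of q
    require.\<close>
  define \<theta>' where "\<theta>' = max \<theta> (1/2)"
  have \<theta>': "0 < \<theta>'" "\<theta>' < 1" "\<theta> \<le> \<theta>'" using \<theta> by (auto simp: \<theta>'_def)
  define q where "q = sqrt \<theta>'"
  have q: "0 < q" "q < 1" "q * q = \<theta>'" using \<theta>' by (auto simp: q_def)
  define P where "P = (\<lambda>n x. \<Prod>k<n. cmod (1 + param \<alpha> (real L ^ k * x)) powr t)"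
  have P0: "P n x \<ge> 0" for n x by (simp add: P_def prod_nonneg)
  have [measurable]: "P n \<in> borel_measurable borel" for n
    unfolding P_def param_def by measurable
  have mQ: "emeasure lborel {x \<in> {0..<1}. q ^ n \<le> P n x} \<le> ennreal (q ^ n)" for n
  proof -
    have "emeasure lborel {x \<in> {0..<1}. q ^ n \<le> P n x} \<le>
        emeasure lborel {x \<in> {0..<1}. 1 \<le> ennreal (1 / q ^ n) * ennreal (P n x)}"
    proof (intro emeasure_mono subsetI)
      fix x assume x: "x \<in> {x \<in> {0..<1}. q ^ n \<le> P n x}"
      have "1 \<le> 1 / q ^ n * P n x" using x q by (simp add: field_simps)
      then have "ennreal 1 \<le> ennreal (1 / q ^ n * P n x)" by (rule ennreal_leI)
      moreover have "ennreal (1 / q ^ n * P n x) = ennreal (1 / q ^ n) * ennreal (P n x)"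
        using q P0 by (intro ennreal_mult) auto
      ultimately have "1 \<le> ennreal (1 / q ^ n) * ennreal (P n x)" by (simp only: ennreal_1)
      then show "x \<in> {x \<in> {0..<1}. 1 \<le> ennreal (1 / q ^ n) * ennreal (P n x)}"
        using x by blast
    qed auto
    also have "\<dots> \<le> ennreal (1 / q ^ n) * (\<integral>\<^sup>+x. ennreal (P n x) * indicator {0..<1} x \<partial>lborel)"
      by (intro nn_integral_Markov_inequality) auto
    also have "(\<integral>\<^sup>+x. ennreal (P n x) * indicator {0..<1} x \<partial>lborel) \<le> ennreal \<theta> ^ n"
      using mom[of n] by (simp add: P_def prod_ennreal)
    also have "ennreal \<theta> ^ n \<le> ennreal \<theta>' ^ n" using \<theta>' by (intro power_mono ennreal_leI) auto
    also have "ennreal (1 / q ^ n) * ennreal \<theta>' ^ n = ennreal (q ^ n)"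
    proof -
      have "1 / q ^ n * \<theta>' ^ n = q ^ n" using q by (simp add: power_mult_distrib flip: q(3))
      then show ?thesis using q \<theta>' by (simp add: ennreal_power flip: ennreal_mult)
    qed
    finally show ?thesis by (simp add: mult_left_mono)
  qed
  obtain N where N: "q ^ N < \<delta> * (1 - q)" using real_arch_pow_inv[of "\<delta> * (1 - q)" q] \<delta> q by auto
  define G where "G = {x. \<forall>n\<ge>N. P n x < q ^ n}"
  have G: "G \<in> sets borel" unfolding G_def by measurable
  have "{0..<1} - G = (\<Union>n. {x \<in> {0..<1}. q ^ (n + N) \<le> P (n + N) x})"
  proof -
    have "x \<notin> G \<longleftrightarrow> (\<exists>n. q ^ (n + N) \<le> P (n + N) x)" for x
    proof
      assume "x \<notin> G"
      then obtain m where m: "m \<ge> N" "\<not> P m x < q ^ m" unfolding G_def by blast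
      then have "q ^ (m - N + N) \<le> P (m - N + N) x" by simp
      then show "\<exists>n. q ^ (n + N) \<le> P (n + N) x" by blast
    next
      assume "\<exists>n. q ^ (n + N) \<le> P (n + N) x"
      then obtain n where "\<not> P (n + N) x < q ^ (n + N)" by (auto simp: not_less)
      then show "x \<notin> G" unfolding G_def using le_add2[of N n] by blast
    qed
    then show ?thesis by auto
  qed
  then have "emeasure lborel ({0..<1} - G) \<le> (\<Sum>n. emeasure lborel {x \<in> {0..<1}. q ^ (n + N) \<le> P (n + N) x})"
    by (simp only:) (intro emeasure_subadditive_countably, auto)
  also have "\<dots> \<le> (\<Sum>n. ennreal (q ^ (n + N)))" using mQ by (intro suminf_le) auto
  also have "\<dots> = ennreal (\<Sum>n. q ^ (n + N))"
    using q by (intro suminf_ennreal2) (auto simp: power_add intro!: summable_mult2 summable_geometric)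
  also have "(\<Sum>n. q ^ (n + N)) = q ^ N / (1 - q)"
    using q by (simp add: power_add suminf_mult2[symmetric] summable_geometric suminf_geometric)
  also have "ennreal (q ^ N / (1 - q)) \<le> ennreal \<delta>" using N q by (intro ennreal_leI) (simp add: field_simps)
  finally have meas: "emeasure lborel ({0..<1} - G) \<le> ennreal \<delta>" .
  define p where "p = q powr (1 / t)"
  have p: "0 < p" "p < 1" using q t powr_less_mono2[of "1 / t" q 1] by (auto simp: p_def)
  define K where "K = (2 / p) ^ N"
  have K: "K > 0" using p by (simp add: K_def)
  have basin: "(\<lambda>n. orb \<alpha> L n x z) \<longlonglongrightarrow> 0"
    if x: "x \<in> G" and z: "cmod z \<le> (1 - cmod \<alpha>) * ln 2 * (1 - p) / (2 * K)" for x z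
  proof -
    define A where "A = (\<lambda>n. \<Prod>k<n. cmod (1 + param \<alpha> (real L ^ k * x)))"
    have A0: "A n \<ge> 0" for n by (simp add: A_def prod_nonneg)
    have "A n \<le> K * p ^ n" for n
    proof (cases "n \<ge> N")
      case True
      have "A n powr t = P n x" unfolding A_def P_def by (rule prod_powr_distrib)
      also have "\<dots> < q ^ n" using x True by (simp add: G_def)
      also have "q ^ n = (p ^ n) powr t"
        using q t p by (simp add: p_def powr_powr powr_power flip: powr_realpow)
      finally have "A n < p ^ n" using p t A0 by (metis linorder_not_less powr_mono2 less_imp_le zero_le_power)
      moreover have "1 * p ^ n \<le> K * p ^ n"
        using p by (intro mult_right_mono) (auto simp: K_def one_le_power)
      ultimately show ?thesis by simp
    next
      case False
      have "A n \<le> 2 ^ n"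
      proof -
        have "A n \<le> (\<Prod>k<n. 2)"
          unfolding A_def
        proof (intro prod_mono conjI)
          fix k show "cmod (1 + param \<alpha> (real L ^ k * x)) \<le> 2"
            using norm_triangle_ineq[of 1 "param \<alpha> (real L ^ k * x)"] norm_param_le[of \<alpha> "real L ^ k * x"] a by simp
        qed auto
        then show ?thesis by simp
      qed
      also have "2 ^ n = (2 / p) ^ n * p ^ n" using p by (simp add: power_divide)
      also have "\<dots> \<le> K * p ^ n"
        unfolding K_def using p False by (intro mult_right_mono power_increasing) auto
      finally show ?thesis .
    qed
    from orb_near_0[OF a A_def this p K z] show ?thesis .
  qed
  have "(1 - cmod \<alpha>) * ln 2 * (1 - p) / (2 * K) > 0" using a p K by simp
  with that G meas basin show ?thesis by blast
qed

text \<open>A negative exponent gives a fractional moment below 1, and for large \<open>L\<close> so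
  is its upper Riemann sum. The threshold for \<open>L\<close> is found before
  \<open>\<delta>\<close>, so one \<open>L\<close> serves every \<open>\<delta>\<close>.\<close>

lemma basin_0_large:
  assumes a: "cmod \<alpha> < 1"
    and neg: "integral\<^sup>L unit_measure (\<lambda>x. ln (cmod (1 + param \<alpha> x))) < 0"
  shows "\<forall>\<^sub>F L in sequentially. \<forall>\<delta>>0. \<exists>G\<in>sets borel. \<exists>\<rho>>0. emeasure lborel ({0..<1} - G) \<le> ennreal \<delta> \<and>
    (\<forall>x\<in>G. \<forall>z. cmod z \<le> \<rho> \<longrightarrow> (\<lambda>n. orb \<alpha> L n x z) \<longlonglongrightarrow> 0)"
proof -
  have b: "1 - cmod \<alpha> \<le> cmod (1 + param \<alpha> x)" "cmod (1 + param \<alpha> x) \<le> 2" for x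
    using norm_triangle_ineq2[of 1 "- param \<alpha> x"] norm_triangle_ineq[of 1 "param \<alpha> x"] norm_param_le[of \<alpha> x] a by auto
  have pos: "cmod (1 + param \<alpha> x) > 0" for x using b(1)[of x] a by linarith
  have cont: "continuous_on UNIV (\<lambda>x. ln (cmod (1 + param \<alpha> x)))"
    unfolding param_def by (intro continuous_intros) (use pos in \<open>auto simp: param_def\<close>)
  have bd: "\<bar>ln (cmod (1 + param \<alpha> x))\<bar> \<le> \<bar>ln (1 - cmod \<alpha>)\<bar> + \<bar>ln 2\<bar>" for x
  proof -
    have "ln (1 - cmod \<alpha>) \<le> ln (cmod (1 + param \<alpha> x))" "ln (cmod (1 + param \<alpha> x)) \<le> ln 2"
      using b[of x] pos[of x] a by auto
    then show ?thesis by linarith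
  qed
  obtain t where t: "t > 0" "integral\<^sup>L unit_measure (\<lambda>x. exp (t * ln (cmod (1 + param \<alpha> x)))) < 1"
    using exp_moment_less_1[OF borel_measurable_continuous_onI[OF cont] bd neg] .
  define g where "g = (\<lambda>x. cmod (1 + param \<alpha> x) powr t)"
  have g_exp: "g x = exp (t * ln (cmod (1 + param \<alpha> x)))" for x
    using pos[of x] by (simp add: g_def powr_def)
  then have g_fun: "g = (\<lambda>x. exp (t * ln (cmod (1 + param \<alpha> x))))" by auto
  have gc: "continuous_on UNIV g" unfolding g_fun by (intro continuous_intros cont)
  define \<theta> where "\<theta> = (integral\<^sup>L unit_measure g + 1) / 2"
  have \<theta>: "\<theta> < 1" "integral\<^sup>L unit_measure g < \<theta>" using t(2) by (auto simp: \<theta>_def g_fun)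
  have "\<forall>\<^sub>F L in sequentially. \<exists>c. (\<forall>j<L. \<forall>x\<in>unit_cell L j. g x \<le> c j) \<and> (\<forall>j. 0 \<le> c j) \<and>
    (\<Sum>j<L. ennreal (c j)) * ennreal (1 / real L) \<le> ennreal \<theta>"
    using \<theta>(2) by (intro upper_riemann_sum gc) (auto simp: g_def)
  moreover have "\<forall>\<^sub>F L in sequentially. L > 0" by (rule eventually_gt_at_top)
  ultimately show ?thesis
  proof eventually_elim
    case (elim L)
    then obtain c where c: "\<And>j x. j < L \<Longrightarrow> x \<in> unit_cell L j \<Longrightarrow> g x \<le> c j"
        "(\<Sum>j<L. ennreal (c j)) * ennreal (1 / real L) \<le> ennreal \<theta>" by blast
    have gm: "(\<lambda>x. ennreal (g x)) \<in> borel_measurable borel"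
      using borel_measurable_continuous_onI[OF gc] by measurable
    have gper: "ennreal (g (x + 1)) = ennreal (g x)" for x
      using param_cong[of "x + 1" x \<alpha>] by (simp add: g_def)
    have mom: "(\<integral>\<^sup>+x. (\<Prod>k<n. ennreal (g (real L ^ k * x))) * indicator {0..<1} x \<partial>lborel) \<le> ennreal \<theta> ^ n" for n
      by (rule nn_integral_product_le[where g = "\<lambda>x. ennreal (g x)" and c = "\<lambda>j. ennreal (c j)", OF elim(2) gm gper _ c(2)])
        (use c(1) in \<open>auto intro: ennreal_leI\<close>)
    show ?case
    proof (intro allI impI)
      fix \<delta> :: real assume "\<delta> > 0"
      from basin_0_large_of_moments[OF a t(1) \<theta>(1) mom[unfolded g_def] this]
      show "\<exists>G\<in>sets borel. \<exists>\<rho>>0. emeasure lborel ({0..<1} - G) \<le> ennreal \<delta> \<and>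
        (\<forall>x\<in>G. \<forall>z. cmod z \<le> \<rho> \<longrightarrow> (\<lambda>n. orb \<alpha> L n x z) \<longlonglongrightarrow> 0)" by metis
    qed
  qed
qed

section \<open>Topology of the circle and of the sphere\<close>

lemma to_circle_eq_iff: "to_circle x = to_circle y \<longleftrightarrow> x - y \<in> \<int>"
  by (rule circle.abs_eq_iff)

lemma to_circle_cases:
  obtains x where "0 \<le> x" "x < 1" "u = to_circle x"
proof -
  have "u = to_circle (rep_circle u)" by (metis Quotient_abs_rep Quotient_circle)
  also have "\<dots> = to_circle (frac (rep_circle u))"
    by (simp add: to_circle_eq_iff frac_def)
  finally show ?thesis using that frac_ge_0 frac_lt_1 by blast
qed

lemma continuous_on_to_circle [continuous_intros]: "continuous_on A to_circle"
  by (rule continuous_on_subset[of UNIV]) (auto simp: continuous_on_open_vimage open_circle_def)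

lemma open_to_circle_image:
  assumes "open V"
  shows "open (to_circle ` V)"
proof -
  have "to_circle -` (to_circle ` V) = (\<Union>k\<in>\<int>. (+) k ` V)"
  proof (intro set_eqI iffI)
    fix x assume "x \<in> to_circle -` (to_circle ` V)"
    then obtain y where y: "y \<in> V" "x - y \<in> \<int>" by (auto simp: to_circle_eq_iff)
    then show "x \<in> (\<Union>k\<in>\<int>. (+) k ` V)" by (intro UN_I[of "x - y"]) (auto intro!: image_eqI[of _ _ y])
  next
    fix x assume "x \<in> (\<Union>k\<in>\<int>. (+) k ` V)"
    then obtain k y where "k \<in> \<int>" "y \<in> V" "x = k + y" by auto
    then show "x \<in> to_circle -` (to_circle ` V)" by (auto simp: to_circle_eq_iff intro!: image_eqI[of _ _ y])
  qed
  then show ?thesis unfolding open_circle_def using assms by (auto intro: open_translation)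
qed

lemma continuous_on_Fin [continuous_intros]: "continuous_on A Fin"
  by (rule continuous_on_subset[of UNIV]) (auto simp: continuous_on_open_vimage open_riemann_sphere_def)

lemma Fin_vimage_image [simp]: "Fin -` (Fin ` V) = V"
  by auto

lemma open_Fin_image: "open V \<Longrightarrow> open (Fin ` V)"
  unfolding open_riemann_sphere_def by auto

lemma open_Fin_image_far: "open (insert Infty (Fin ` (- cball 0 r)))"
proof -
  have "Fin -` insert Infty (Fin ` (- cball 0 r)) = - cball 0 r" by auto
  then show ?thesis unfolding open_riemann_sphere_def by (simp add: open_Compl)
qed

lemma open_Infty_far:
  assumes "open S" "Infty \<in> S"
  obtains n :: nat where "insert Infty (Fin ` (- cball 0 (real n))) \<subseteq> S"
proof -
  have "bounded (- (Fin -` S))" using assms compact_imp_bounded unfolding open_riemann_sphere_def by blast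
  then obtain r where r: "\<And>z. z \<in> - (Fin -` S) \<Longrightarrow> cmod z \<le> r" by (auto simp: bounded_iff)
  obtain n :: nat where "r \<le> real n" using real_arch_simple by blast
  then have "z \<in> Fin -` S" if "z \<in> - cball 0 (real n)" for z
    using r[of z] that by (cases "z \<in> Fin -` S") auto
  with that assms(2) show ?thesis by blast
qed

text \<open>Second countability of both factors makes the product sigma-algebra of
  \<open>std_volume\<close> the Borel one (\<open>borel_prod\<close>).\<close>

instance circle :: second_countable_topology
proof
  obtain B :: "real set set" where B: "countable B" "topological_basis B"
    using ex_countable_basis by blast
  have "topological_basis ((`) to_circle ` B)"
  proof (rule topological_basisI)
    show "open S" if "S \<in> (`) to_circle ` B" for S
      using that B(2) topological_basis_open open_to_circle_image by blast
    fix S :: "circle set" and u assume S: "open S" "u \<in> S"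
    obtain x where x: "u = to_circle x" by (rule to_circle_cases)
    obtain V where "V \<in> B" "x \<in> V" "V \<subseteq> to_circle -` S"
      using topological_basisE[OF B(2), of "to_circle -` S" x] S x unfolding open_circle_def by auto
    then show "\<exists>B'\<in>(`) to_circle ` B. u \<in> B' \<and> B' \<subseteq> S" using x by blast
  qed
  then show "\<exists>B::circle set set. countable B \<and> open = generate_topology B"
    using B(1) by (intro exI[of _ "(`) to_circle ` B"]) (auto intro: topological_basis_imp_subbasis)
qed

instance riemann_sphere :: second_countable_topology
proof
  obtain B :: "complex set set" where B: "countable B" "topological_basis B"
    using ex_countable_basis by blast
  let ?B = "(`) Fin ` B \<union> range (\<lambda>n::nat. insert Infty (Fin ` (- cball 0 (real n))))"
  have "topological_basis ?B"
  proof (rule topological_basisI)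
    show "open S" if "S \<in> ?B" for S
      using that B(2) topological_basis_open open_Fin_image open_Fin_image_far by blast
    fix S :: "riemann_sphere set" and p assume S: "open S" "p \<in> S"
    show "\<exists>B'\<in>?B. p \<in> B' \<and> B' \<subseteq> S"
    proof (cases p)
      case (Fin z)
      obtain V where "V \<in> B" "z \<in> V" "V \<subseteq> Fin -` S"
        using topological_basisE[OF B(2), of "Fin -` S" z] S Fin unfolding open_riemann_sphere_def by auto
      then show ?thesis using Fin by blast
    next
      case Infty
      then have inf: "Infty \<in> S" using S by simp
      obtain n :: nat where "insert Infty (Fin ` (- cball 0 (real n))) \<subseteq> S"
        by (rule open_Infty_far[OF S(1) inf])
      then show ?thesis unfolding Infty
        by (intro bexI[of _ "insert Infty (Fin ` (- cball 0 (real n)))"]) auto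
    qed
  qed
  then show "\<exists>B::riemann_sphere set set. countable B \<and> open = generate_topology B"
    using B(1) by (intro exI[of _ ?B]) (auto intro: topological_basis_imp_subbasis)
qed

instance riemann_sphere :: t2_space
proof
  have far: "\<exists>U V. open U \<and> open V \<and> Fin z \<in> U \<and> Infty \<in> V \<and> U \<inter> V = {}" for z
    by (intro exI[of _ "Fin ` ball 0 (cmod z + 1)"] exI[of _ "insert Infty (Fin ` (- cball 0 (cmod z + 1)))"])
      (auto intro: open_Fin_image open_Fin_image_far)
  fix p q :: riemann_sphere assume ne: "p \<noteq> q"
  show "\<exists>U V. open U \<and> open V \<and> p \<in> U \<and> q \<in> V \<and> U \<inter> V = {}"
  proof (cases p)
    case p: (Fin z)
    show ?thesis
    proof (cases q)
      case q: (Fin w)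
      then have "z \<noteq> w" using ne p by simp
      then obtain U V where "open U" "open V" "z \<in> U" "w \<in> V" "U \<inter> V = {}"
        by (metis separation_t2)
      then show ?thesis unfolding p q
        by (intro exI[of _ "Fin ` U"] exI[of _ "Fin ` V"]) (auto intro: open_Fin_image)
    next
      case Infty
      then show ?thesis using far[of z] p by simp
    qed
  next
    case p: Infty
    with ne obtain w where q: "q = Fin w" by (cases q) auto
    obtain U V where "open U" "open V" "Fin w \<in> U" "Infty \<in> V" "U \<inter> V = {}"
      using far[of w] by blast
    then show ?thesis unfolding p q by (intro exI[of _ V] exI[of _ U]) auto
  qed
qed

lemma compact_circle: "compact (UNIV :: circle set)"
proof -
  have "(UNIV :: circle set) = to_circle ` {0..1}"
  proof (intro set_eqI iffI)
    fix u obtain x where "0 \<le> x" "x < 1" "u = to_circle x" by (rule to_circle_cases)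
    then show "u \<in> to_circle ` {0..1}" by auto
  qed simp
  then show ?thesis by (metis compact_Icc compact_continuous_image continuous_on_to_circle)
qed

lemma compact_riemann_sphere: "compact (UNIV :: riemann_sphere set)"
  unfolding compact_eq_Heine_Borel
proof (intro allI impI, elim conjE)
  fix C :: "riemann_sphere set set" assume C: "\<forall>c\<in>C. open c" "UNIV \<subseteq> \<Union>C"
  then obtain U where U: "U \<in> C" "Infty \<in> U" by blast
  have "compact (Fin ` (- (Fin -` U)))"
    using C U unfolding open_riemann_sphere_def
    by (intro compact_continuous_image continuous_on_Fin) auto
  then obtain D where D: "D \<subseteq> C" "finite D" "Fin ` (- (Fin -` U)) \<subseteq> \<Union>D"
  proof (rule compactE[of _ C])
    show "Fin ` (- (Fin -` U)) \<subseteq> \<Union>C" using C(2) by (rule subset_trans[OF subset_UNIV])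
  qed (use C(1) in auto)
  have "UNIV \<subseteq> \<Union>(insert U D)"
  proof
    fix p :: riemann_sphere
    show "p \<in> \<Union>(insert U D)"
      using U(2) D(3) by (cases p) auto
  qed
  with U D show "\<exists>D\<subseteq>C. finite D \<and> UNIV \<subseteq> \<Union>D" by (intro exI[of _ "insert U D"]) auto
qed

lemma open_prod_obtain:
  assumes "open U" "(u, p) \<in> U"
  obtains A S where "open A" "open S" "u \<in> A" "p \<in> S" "A \<times> S \<subseteq> U"
proof -
  obtain A S where "open A" "open S" "(u, p) \<in> A \<times> S" "A \<times> S \<subseteq> U"
    by (rule open_prod_elim[OF assms])
  with that show ?thesis by simp
qed

text \<open>An open set around infinity contains finite points since the plane is not
  compact.\<close>

lemma open_box:
  fixes U :: "(circle \<times> riemann_sphere) set"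
  assumes "open U" "U \<noteq> {}"
  shows "\<exists>c \<epsilon> D. \<epsilon> > 0 \<and> 0 < c - \<epsilon> \<and> c + \<epsilon> < 1 \<and> open D \<and> D \<noteq> {} \<and>
    (\<forall>x z. \<bar>x - c\<bar> < \<epsilon> \<longrightarrow> z \<in> D \<longrightarrow> (to_circle x, Fin z) \<in> U)"
proof -
  obtain u p where up: "(u, p) \<in> U" using assms by auto
  obtain A S where AS: "open A" "open S" "u \<in> A" "p \<in> S" "A \<times> S \<subseteq> U"
    by (rule open_prod_obtain[OF assms(1) up])
  obtain x where x: "0 \<le> x" "x < 1" "u = to_circle x" by (rule to_circle_cases)
  have "open (to_circle -` A)" "x \<in> to_circle -` A" using AS x by (auto simp: open_circle_def)
  then obtain e where e: "e > 0" "ball x e \<subseteq> to_circle -` A" using open_contains_ball by blast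
  define \<epsilon> where "\<epsilon> = min (e / 4) ((1 - x) / 4)"
  have \<epsilon>: "\<epsilon> > 0" "\<epsilon> \<le> e / 4" "\<epsilon> \<le> (1 - x) / 4" using e x by (auto simp: \<epsilon>_def min_def)
  have D: "open (Fin -` S)" using AS by (simp add: open_riemann_sphere_def)
  have "Fin -` S \<noteq> {}"
  proof (cases p)
    case (Fin z)
    then show ?thesis using AS by auto
  next
    case Infty
    then have "compact (- (Fin -` S))" using AS by (simp add: open_riemann_sphere_def)
    then show ?thesis using not_compact_UNIV[where 'a = complex] by auto
  qed
  show ?thesis
  \<comment> \<open>The centre is shifted by 2 \<open>\<epsilon>\<close>, so that the interval lies
    inside (0, 1) even for x = 0.\<close>
  proof (rule exI[of _ "x + 2 * \<epsilon>"], rule exI[of _ \<epsilon>], rule exI[of _ "Fin -` S"], intro conjI allI impI)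
    fix y z assume "\<bar>y - (x + 2 * \<epsilon>)\<bar> < \<epsilon>" "z \<in> Fin -` S"
    moreover from this have "\<bar>x - y\<bar> < e" using \<epsilon> by linarith
    then have "y \<in> ball x e" by (simp add: dist_real_def)
    ultimately show "(to_circle y, Fin z) \<in> U" using AS e(2) by auto
  qed (use \<epsilon> x D \<open>Fin -` S \<noteq> {}\<close> in \<open>auto simp: field_simps\<close>)
qed

section \<open>The skew product on lifts\<close>

lemma circle_expand_funpow: "(circle_expand L ^^ n) (to_circle x) = to_circle (real L ^ n * x)"
  by (induction n) (simp_all add: circle_expand.abs_eq mult.assoc)

lemma fibre_poly_to_circle: "fibre_poly \<alpha> (to_circle x) z = quad (param \<alpha> x) z"
  by (simp add: fibre_poly_def quad_def param_def cos_2pi.abs_eq)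

lemma fibre_iterate_Fin: "fibre_iterate \<alpha> L n (to_circle x) (Fin z) = Fin (orb \<alpha> L n x z)"
  by (induction n) (simp_all add: circle_expand_funpow fibre_poly_to_circle)

lemma fibre_iterate_Infty: "fibre_iterate \<alpha> L n u Infty = Infty"
  by (induction n) simp_all

lemma circle_expand_fixed_iff: "circle_expand L (to_circle x) = to_circle x \<longleftrightarrow> real L * x - x \<in> \<int>"
  by (simp add: circle_expand.abs_eq to_circle_eq_iff)

lemma stable_set_Fin:
  assumes "(\<lambda>n. orb \<alpha> L n x z) \<longlonglongrightarrow> w"
  shows "(to_circle x, Fin z) \<in> stable_set \<alpha> L (Fin w)"
proof -
  have "isCont Fin w" using continuous_on_Fin[of UNIV] by (simp add: continuous_on_eq_continuous_at)
  from isCont_tendsto_compose[OF this assms] show ?thesis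
    by (simp add: stable_set_def fibre_iterate_Fin)
qed

lemma stable_set_Infty:
  assumes "filterlim (\<lambda>n. orb \<alpha> L n x z) at_infinity sequentially"
  shows "(to_circle x, Fin z) \<in> stable_set \<alpha> L Infty"
proof -
  have "(\<lambda>n. Fin (orb \<alpha> L n x z)) \<longlonglongrightarrow> Infty"
  proof (rule topological_tendstoI)
    fix S assume "open S" "Infty \<in> S"
    then obtain m :: nat where m: "insert Infty (Fin ` (- cball 0 (real m))) \<subseteq> S" by (rule open_Infty_far)
    have "\<forall>\<^sub>F n in sequentially. real m + 1 \<le> cmod (orb \<alpha> L n x z)"
      using assms filterlim_at_infinity[of 0 "\<lambda>n. orb \<alpha> L n x z" sequentially]
      by (auto simp: )
    then show "\<forall>\<^sub>F n in sequentially. Fin (orb \<alpha> L n x z) \<in> S"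
      by eventually_elim (use m in auto)
  qed
  then show ?thesis by (simp add: stable_set_def fibre_iterate_Fin)
qed

section \<open>Measurability and positivity\<close>

lemma sets_std_volume [measurable_cong]: "sets std_volume = sets borel"
proof -
  have "sets std_volume = sets (borel \<Otimes>\<^sub>M borel)"
    unfolding std_volume_def by (rule sets_pair_measure_cong) (simp_all add: circle_lebesgue_def spherical_area_def)
  moreover have "(borel \<Otimes>\<^sub>M borel) = (borel :: (circle \<times> riemann_sphere) measure)" by (rule borel_prod)
  ultimately show ?thesis by (simp only:)
qed

text \<open>For nonzero \<open>\<alpha>\<close> the skew product is discontinuous at infinity over
  1/4 and 3/4. Iterates are therefore treated on the finite part, where they are continuous, and on
  the line at infinity separately.\<close>

lemma open_fibre_iterate_Fin:
  assumes "open V"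
  shows "open {(u, p). \<exists>z. p = Fin z \<and> fibre_iterate \<alpha> L n u (Fin z) \<in> V}"
proof (rule topological_space_class.openI)
  fix q assume "q \<in> {(u, p). \<exists>z. p = Fin z \<and> fibre_iterate \<alpha> L n u (Fin z) \<in> V}"
  then obtain u z where q: "q = (u, Fin z)" "fibre_iterate \<alpha> L n u (Fin z) \<in> V" by auto
  obtain x where x: "u = to_circle x" by (rule to_circle_cases)
  have "open (Fin -` V)" using assms by (simp add: open_riemann_sphere_def)
  then have "open ((\<lambda>p. orb \<alpha> L n (fst p) (snd p)) -` (Fin -` V))"
    by (rule open_vimage) (intro continuous_intros)
  moreover have "(x, z) \<in> (\<lambda>p. orb \<alpha> L n (fst p) (snd p)) -` (Fin -` V)"
    using q x by (simp add: fibre_iterate_Fin)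
  ultimately obtain A B where AB: "open A" "open B" "x \<in> A" "z \<in> B"
      "A \<times> B \<subseteq> (\<lambda>p. orb \<alpha> L n (fst p) (snd p)) -` (Fin -` V)"
    by (rule open_prod_obtain)
  have "to_circle ` A \<times> Fin ` B \<subseteq> {(u, p). \<exists>z. p = Fin z \<and> fibre_iterate \<alpha> L n u (Fin z) \<in> V}"
    using AB(5) by (auto simp: fibre_iterate_Fin)
  moreover have "open (to_circle ` A \<times> Fin ` B)"
    using AB by (intro open_Times open_to_circle_image open_Fin_image)
  moreover have "q \<in> to_circle ` A \<times> Fin ` B" using AB q x by auto
  ultimately show "\<exists>T. open T \<and> q \<in> T \<and> T \<subseteq> {(u, p). \<exists>z. p = Fin z \<and> fibre_iterate \<alpha> L n u (Fin z) \<in> V}"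
    by blast
qed

lemma fibre_iterate_measurable:
  assumes "open V"
  shows "{(u, p). fibre_iterate \<alpha> L n u p \<in> V} \<in> sets borel"
proof -
  have "{(u, p). fibre_iterate \<alpha> L n u p \<in> V} = {(u, p). \<exists>z. p = Fin z \<and> fibre_iterate \<alpha> L n u (Fin z) \<in> V} \<union>
     (if Infty \<in> V then UNIV \<times> {Infty} else {})" (is "?l = ?r")
  proof (rule set_eqI)
    fix q :: "circle \<times> riemann_sphere"
    obtain u p where q: "q = (u, p)" by (cases q)
    show "q \<in> ?l \<longleftrightarrow> q \<in> ?r" unfolding q
      by (cases p) (auto simp: fibre_iterate_Infty)
  qed
  moreover have "closed (UNIV \<times> {Infty} :: (circle \<times> riemann_sphere) set)"
    by (intro closed_Times) auto
  ultimately show ?thesis using open_fibre_iterate_Fin[OF assms] by auto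
qed

lemma stable_set_measurable: "stable_set \<alpha> L p \<in> sets borel"
proof -
  obtain A :: "nat \<Rightarrow> riemann_sphere set" where A: "\<And>i. open (A i)" "\<And>i. p \<in> A i"
      "\<And>S. open S \<Longrightarrow> p \<in> S \<Longrightarrow> eventually (\<lambda>i. A i \<subseteq> S) sequentially"
    using countable_basis_at_decseq[of p] by blast
  have "stable_set \<alpha> L p = (\<Inter>i. \<Union>N. \<Inter>n\<in>{N..}. {(u, q). fibre_iterate \<alpha> L n u q \<in> A i})"
  proof (intro set_eqI iffI)
    fix x assume x: "x \<in> stable_set \<alpha> L p"
    obtain u q where uq: "x = (u, q)" by (cases x)
    have ev: "\<forall>\<^sub>F n in sequentially. fibre_iterate \<alpha> L n u q \<in> A i" for i
      using x A(1,2) unfolding stable_set_def uq by (auto intro: topological_tendstoD)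
    show "x \<in> (\<Inter>i. \<Union>N. \<Inter>n\<in>{N..}. {(u, q). fibre_iterate \<alpha> L n u q \<in> A i})"
    proof (rule INT_I)
      fix i
      show "x \<in> (\<Union>N. \<Inter>n\<in>{N..}. {(u, q). fibre_iterate \<alpha> L n u q \<in> A i})"
        using ev[of i] unfolding uq eventually_sequentially by auto
    qed
  next
    fix x assume x: "x \<in> (\<Inter>i. \<Union>N. \<Inter>n\<in>{N..}. {(u, q). fibre_iterate \<alpha> L n u q \<in> A i})"
    obtain u q where uq: "x = (u, q)" by (cases x)
    have "(\<lambda>n. fibre_iterate \<alpha> L n u q) \<longlonglongrightarrow> p"
    proof (rule topological_tendstoI)
      fix S assume "open S" "p \<in> S"
      then obtain i where i: "A i \<subseteq> S" using A(3) by (metis eventually_sequentially order_refl)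
      from x have "x \<in> (\<Union>N. \<Inter>n\<in>{N..}. {(u, q). fibre_iterate \<alpha> L n u q \<in> A i})" by blast
      then have "\<exists>N. \<forall>n\<ge>N. fibre_iterate \<alpha> L n u q \<in> A i" unfolding uq by auto
      then show "\<forall>\<^sub>F n in sequentially. fibre_iterate \<alpha> L n u q \<in> S"
        using i unfolding eventually_sequentially by blast
    qed
    then show "x \<in> stable_set \<alpha> L p" by (simp add: stable_set_def uq)
  qed
  moreover have "(\<Inter>i. \<Union>N. \<Inter>n\<in>{N..}. {(u, q). fibre_iterate \<alpha> L n u q \<in> A i}) \<in> sets borel"
    by (intro sets.countable_INT sets.countable_UN sets.countable_INT') (auto intro!: fibre_iterate_measurable A)
  ultimately show ?thesis by simp
qed

lemma to_circle_measurable [measurable]: "to_circle \<in> borel_measurable borel"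
  by (intro borel_measurable_continuous_onI continuous_on_to_circle)

lemma Fin_measurable [measurable]: "Fin \<in> borel_measurable borel"
  by (intro borel_measurable_continuous_onI continuous_on_Fin)

lemma AE_circle_lebesgue:
  assumes "{u. P u} \<in> sets borel"
  shows "(AE u in circle_lebesgue. P u) \<longleftrightarrow> (AE x in lborel. x \<in> {0..<1} \<longrightarrow> P (to_circle x))"
proof -
  have "to_circle \<in> measurable unit_measure borel" by (intro measurable_restrict_space1) simp
  then have "(AE u in circle_lebesgue. P u) \<longleftrightarrow> (AE x in unit_measure. P (to_circle x))"
    unfolding circle_lebesgue_def using assms by (intro AE_distr_iff) auto
  also have "\<dots> \<longleftrightarrow> (AE x in lborel. x \<in> {0..<1} \<longrightarrow> P (to_circle x))"
    by (rule AE_restrict_space_iff) simp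
  finally show ?thesis .
qed

lemma emeasure_spherical_area:
  assumes "S \<in> sets borel"
  shows "emeasure spherical_area S = (\<integral>\<^sup>+z. ennreal (4 / (1 + (cmod z)\<^sup>2)\<^sup>2) * indicator (Fin -` S) z \<partial>lborel)"
proof -
  have "Fin -` S \<in> sets borel" using measurable_sets[OF Fin_measurable assms] by simp
  then show ?thesis
    unfolding spherical_area_def using assms
    by (subst emeasure_distr) (auto simp: emeasure_density)
qed

lemma spherical_area_sigma_finite: "sigma_finite_measure spherical_area"
proof
  let ?A = "\<lambda>n::nat. insert Infty (Fin ` cball 0 (real n))"
  have "closed (?A n)" for n
  proof -
    have e: "- ?A n = Fin ` (- cball 0 (real n))"
    proof (rule set_eqI)
      fix p show "p \<in> - ?A n \<longleftrightarrow> p \<in> Fin ` (- cball 0 (real n))" by (cases p) auto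
    qed
    show ?thesis unfolding closed_def e by (intro open_Fin_image open_Compl closed_cball)
  qed
  then have m: "?A n \<in> sets borel" for n by simp
  have "emeasure spherical_area (?A n) \<noteq> \<infinity>" for n
  proof -
    have "emeasure spherical_area (?A n) \<le> (\<integral>\<^sup>+z. 4 * indicator (cball (0::complex) (real n)) z \<partial>lborel)"
      unfolding emeasure_spherical_area[OF m]
    proof (rule nn_integral_mono)
      fix z :: complex
      have "1 \<le> (1 + (cmod z)\<^sup>2)\<^sup>2" by (intro one_le_power) simp
      then have "4 / (1 + (cmod z)\<^sup>2)\<^sup>2 \<le> 4 / 1" by (intro frac_le) auto
      then have "ennreal (4 / (1 + (cmod z)\<^sup>2)\<^sup>2) \<le> ennreal 4" by (intro ennreal_leI) simp
      then show "ennreal (4 / (1 + (cmod z)\<^sup>2)\<^sup>2) * indicator (Fin -` ?A n) z \<le> 4 * indicator (cball 0 (real n)) z"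
        by (auto simp: indicator_def)
    qed
    also have "\<dots> = 4 * emeasure lborel (cball (0::complex) (real n))" by (subst nn_integral_cmult_indicator) auto
    also have "\<dots> < \<infinity>"
      using emeasure_lborel_cball_finite[of "0::complex" "real n"] by (simp add: ennreal_mult_less_top)
    finally show ?thesis by simp
  qed
  moreover have "(\<Union>n. ?A n) = UNIV"
  proof (intro set_eqI iffI)
    fix p show "p \<in> (\<Union>n. ?A n)"
    proof (cases p)
      case (Fin z)
      obtain n :: nat where "cmod z \<le> real n" using real_arch_simple by blast
      then have "p \<in> ?A n" using Fin by auto
      then show ?thesis by blast
    qed auto
  qed simp
  ultimately show "\<exists>A. countable A \<and> A \<subseteq> sets spherical_area \<and> \<Union>A = space spherical_area \<and> (\<forall>a\<in>A. emeasure spherical_area a \<noteq> \<infinity>)"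
    using m by (intro exI[of _ "range ?A"]) (auto simp: spherical_area_def)
qed

lemma emeasure_spherical_area_pos:
  assumes "S \<in> sets borel" "open V" "V \<noteq> {}" "Fin ` V \<subseteq> S"
  shows "emeasure spherical_area S > 0"
proof (rule ccontr)
  assume "\<not> ?thesis"
  then have "(\<integral>\<^sup>+z. ennreal (4 / (1 + (cmod z)\<^sup>2)\<^sup>2) * indicator (Fin -` S) z \<partial>lborel) = 0"
    by (simp add: emeasure_spherical_area[OF assms(1)])
  moreover have "Fin -` S \<in> sets borel" using measurable_sets[OF Fin_measurable assms(1)] by simp
  ultimately have "AE z in lborel. ennreal (4 / (1 + (cmod z)\<^sup>2)\<^sup>2) * indicator (Fin -` S) z = 0"
    by (subst (asm) nn_integral_0_iff_AE) auto
  then have "AE z in lborel. z \<notin> V"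
  proof eventually_elim
    case (elim z)
    have "0 < 4 / (1 + (cmod z)\<^sup>2)\<^sup>2"
      by (intro divide_pos_pos zero_less_power add_pos_nonneg) auto
    then show ?case using elim assms(4) by (auto simp: indicator_def split: if_splits)
  qed
  then have "V \<in> null_sets lborel" using assms(2) by (subst (asm) AE_iff_null_sets[symmetric]) auto
  then have "V \<in> null_sets lebesgue" by (rule null_sets_completionI)
  then have "negligible V" by (simp add: negligible_iff_null_sets)
  then show False using open_not_negligible[OF assms(2,3)] by simp
qed

text \<open>By Fubini; measurability of \<open>A\<close> matters, since \<open>emeasure\<close> is 0 on non-measurable sets.\<close>

lemma std_volume_pos:
  assumes A: "A \<in> sets borel" and X: "X \<subseteq> {0..<1}" "X \<in> sets borel" "emeasure lborel X > 0"
    and sec: "\<And>x. x \<in> X \<Longrightarrow> \<exists>V. open V \<and> V \<noteq> {} \<and> (\<forall>z\<in>V. (to_circle x, Fin z) \<in> A)"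
  shows "emeasure std_volume A > 0"
proof (rule ccontr)
  assume "\<not> ?thesis"
  then have 0: "emeasure std_volume A = 0" by simp
  interpret S: sigma_finite_measure spherical_area by (rule spherical_area_sigma_finite)
  have Am: "A \<in> sets (circle_lebesgue \<Otimes>\<^sub>M spherical_area)"
    using A sets_std_volume unfolding std_volume_def by simp
  have sp: "sets spherical_area = sets borel" by (simp add: spherical_area_def)
  have secm: "Pair u -` A \<in> sets borel" for u using sets_Pair1[OF Am] sp by simp
  have "(\<integral>\<^sup>+u. emeasure spherical_area (Pair u -` A) \<partial>circle_lebesgue) = 0"
    using S.emeasure_pair_measure_alt[OF Am] 0 by (simp add: std_volume_def)
  moreover have mm: "(\<lambda>u. emeasure spherical_area (Pair u -` A)) \<in> borel_measurable circle_lebesgue"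
    by (rule S.measurable_emeasure_Pair[OF Am])
  ultimately have "AE u in circle_lebesgue. emeasure spherical_area (Pair u -` A) = 0"
    by (subst (asm) nn_integral_0_iff_AE) auto
  moreover have "{u. emeasure spherical_area (Pair u -` A) = 0} \<in> sets borel"
  proof -
    have "(\<lambda>u. emeasure spherical_area (Pair u -` A)) \<in> borel_measurable borel"
      using mm by (simp add: circle_lebesgue_def)
    then show ?thesis by measurable
  qed
  ultimately have "AE x in lborel. x \<in> {0..<1} \<longrightarrow> emeasure spherical_area (Pair (to_circle x) -` A) = 0"
    by (simp add: AE_circle_lebesgue)
  then have "AE x in lborel. x \<notin> X"
  proof eventually_elim
    case (elim x)
    show ?case
    proof
      assume x: "x \<in> X"
      then obtain V where V: "open V" "V \<noteq> {}" "\<forall>z\<in>V. (to_circle x, Fin z) \<in> A" using sec by blast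
      have "emeasure spherical_area (Pair (to_circle x) -` A) > 0"
        using V by (intro emeasure_spherical_area_pos[OF secm V(1,2)]) auto
      with elim x X(1) show False by auto
    qed
  qed
  then have "X \<in> null_sets lborel" using X(2) by (subst (asm) AE_iff_null_sets[symmetric]) auto
  with X(3) show False by auto
qed

section \<open>Omega limits in the compact product\<close>

text \<open>The closed tails of the orbit together with \<open>C\<close> have the finite
  intersection property in a compact space.\<close>

lemma omega_limit_meets_closed:
  fixes F :: "circle \<times> riemann_sphere \<Rightarrow> circle \<times> riemann_sphere"
  assumes C: "closed C" and io: "\<And>N. \<exists>n\<ge>N. (F ^^ n) x \<in> C"
  shows "omega_limit F x \<inter> C \<noteq> {}"
proof -
  have cpt: "compact (UNIV :: (circle \<times> riemann_sphere) set)"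
    using compact_Times[OF compact_circle compact_riemann_sphere] by simp
  let ?T = "\<lambda>n. closure {(F ^^ k) x | k. k \<ge> n}"
  have "UNIV \<inter> \<Inter>(insert C (range ?T)) \<noteq> {}"
  proof (rule compact_imp_fip[OF cpt])
    show "closed T" if "T \<in> insert C (range ?T)" for T using that C by auto
    fix \<F> assume \<F>: "finite \<F>" "\<F> \<subseteq> insert C (range ?T)"
    then obtain I where I: "finite I" "\<F> - {C} = ?T ` I"
      using finite_subset_image[of "\<F> - {C}" ?T UNIV] by auto
    define m where "m = Max (insert 0 I)"
    obtain n where n: "n \<ge> m" "(F ^^ n) x \<in> C" using io by blast
    have "(F ^^ n) x \<in> ?T i" if "i \<in> I" for i
    proof -
      have "i \<le> m" using I(1) that by (simp add: m_def)
      then show ?thesis using n(1) by (intro subsetD[OF closure_subset]) auto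
    qed
    then have "(F ^^ n) x \<in> T" if "T \<in> \<F>" for T
      using n(2) I(2) that by (cases "T = C") blast+
    then show "UNIV \<inter> \<Inter>\<F> \<noteq> {}" by auto
  qed
  then show ?thesis unfolding omega_limit_def by auto
qed

text \<open>If the fibre orbit left a neighbourhood of p infinitely often, compactness would give a
  limit point outside it. Conversely, limit points of a convergent fibre orbit have fibre coordinate
  p, the sphere being Hausdorff.\<close>

lemma attraction_basin_eq:
  "attraction_basin (skew_product \<alpha> L) (UNIV \<times> {p}) = stable_set \<alpha> L p"
proof (intro set_eqI iffI)
  fix x assume x: "x \<in> stable_set \<alpha> L p"
  obtain u q where uq: "x = (u, q)" by (cases x)
  have lim: "(\<lambda>n. fibre_iterate \<alpha> L n u q) \<longlonglongrightarrow> p" using x by (simp add: stable_set_def uq)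
  have "w = p" if vw: "(v, w) \<in> omega_limit (skew_product \<alpha> L) x" for v w
  proof (rule ccontr)
    assume "w \<noteq> p"
    then obtain A B where AB: "open A" "open B" "w \<in> A" "p \<in> B" "A \<inter> B = {}"
      by (metis separation_t2)
    obtain N where N: "\<And>n. n \<ge> N \<Longrightarrow> fibre_iterate \<alpha> L n u q \<in> B"
      using topological_tendstoD[OF lim AB(2,4)] by (auto simp: eventually_sequentially)
    have "(v, w) \<in> closure {(skew_product \<alpha> L ^^ k) x | k. k \<ge> N}"
      using vw by (auto simp: omega_limit_def)
    moreover have "open (UNIV \<times> A)" "(v, w) \<in> UNIV \<times> A" using AB by (auto intro: open_Times)
    ultimately have "(UNIV \<times> A) \<inter> {(skew_product \<alpha> L ^^ k) x | k. k \<ge> N} \<noteq> {}"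
      using open_Int_closure_eq_empty[of "UNIV \<times> A"] by blast
    then show False using N AB(5) by (auto simp: uq skew_product_funpow)
  qed
  then show "x \<in> attraction_basin (skew_product \<alpha> L) (UNIV \<times> {p})"
    by (auto simp: attraction_basin_def)
next
  fix x assume x: "x \<in> attraction_basin (skew_product \<alpha> L) (UNIV \<times> {p})"
  obtain u q where uq: "x = (u, q)" by (cases x)
  have "(\<lambda>n. fibre_iterate \<alpha> L n u q) \<longlonglongrightarrow> p"
  proof (rule topological_tendstoI, rule ccontr)
    fix S assume S: "open S" "p \<in> S" and "\<not> (\<forall>\<^sub>F n in sequentially. fibre_iterate \<alpha> L n u q \<in> S)"
    then have io: "\<exists>n\<ge>N. (skew_product \<alpha> L ^^ n) x \<in> UNIV \<times> (- S)" for N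
      by (auto simp: eventually_sequentially uq skew_product_funpow)
    have "closed (UNIV \<times> (- S) :: (circle \<times> riemann_sphere) set)"
      using S by (intro closed_Times) auto
    from omega_limit_meets_closed[OF this io] x S show False by (auto simp: attraction_basin_def)
  qed
  then show "x \<in> stable_set \<alpha> L p" by (simp add: stable_set_def uq)
qed

section \<open>Recurrence to arcs and minimality of the attractors\<close>

lemma closed_to_circle_image:
  assumes "0 \<le> c" "c \<le> d" "d < c + 1"
  shows "closed (to_circle ` {c..d})"
proof -
  have "- (to_circle ` {c..d}) = to_circle ` {d<..<c+1}"
  proof (intro set_eqI iffI)
    fix u assume u: "u \<in> - (to_circle ` {c..d})"
    obtain y where y: "0 \<le> y" "y < 1" "u = to_circle y" by (rule to_circle_cases)
    define x where "x = c + frac (y - c)"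
    have "u = to_circle x" unfolding y(3) to_circle_eq_iff x_def frac_def by simp
    moreover have "c \<le> x" "x < c + 1" unfolding x_def using frac_ge_0 frac_lt_1 by auto
    ultimately show "u \<in> to_circle ` {d<..<c+1}" using u by force
  next
    fix u assume "u \<in> to_circle ` {d<..<c+1}"
    then obtain x where x: "d < x" "x < c + 1" "u = to_circle x" by auto
    have False if "y \<in> {c..d}" "u = to_circle y" for y
    proof -
      have "to_circle x = to_circle y" using x(3) that(2) by simp
      then have "x - y \<in> \<int>" by (simp only: to_circle_eq_iff)
      then obtain k where "x - y = of_int k" by (rule Ints_cases)
      moreover have "0 < x - y" "x - y < 1" using x that by auto
      ultimately show False by auto
    qed
    then show "u \<in> - (to_circle ` {c..d})" by blast
  qed
  then show ?thesis unfolding closed_def by (simp add: open_to_circle_image)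
qed

lemma AE_visits_arc:
  assumes L: "L \<ge> 2" and c: "0 \<le> c" "c < d" "d < 1"
  shows "AE q in std_volume. \<forall>N. \<exists>n\<ge>N. (circle_expand L ^^ n) (fst q) \<in> to_circle ` {c..d}"
proof -
  have K: "to_circle ` {c..d} \<in> sets borel" using closed_to_circle_image[of c d] c by simp
  have [measurable]: "(\<lambda>u. (circle_expand L ^^ n) u) \<in> borel_measurable borel" for n
  proof (rule borel_measurable_continuous_onI)
    have "open ((circle_expand L ^^ n) -` S)" if "open S" for S
    proof -
      have "to_circle -` ((circle_expand L ^^ n) -` S) = (\<lambda>x. real L ^ n * x) -` (to_circle -` S)"
        by (auto simp: circle_expand_funpow)
      moreover have "open ((\<lambda>x. real L ^ n * x) -` (to_circle -` S))"
        using that by (intro open_vimage continuous_intros) (simp add: open_circle_def)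
      ultimately show ?thesis by (simp add: open_circle_def)
    qed
    then show "continuous_on UNIV (circle_expand L ^^ n)" by (simp add: continuous_on_open_vimage)
  qed
  let ?P = "\<lambda>u. \<forall>N. \<exists>n\<in>{N..}. (circle_expand L ^^ n) u \<in> to_circle ` {c..d}"
  have Pm: "{u. ?P u} \<in> sets borel"
  proof -
    have "{u. ?P u} = (\<Inter>N. \<Union>n\<in>{N..}. (circle_expand L ^^ n) -` (to_circle ` {c..d}))" by auto
    moreover have "(circle_expand L ^^ n) -` (to_circle ` {c..d}) \<in> sets borel" for n
      using measurable_sets[OF _ K, of "circle_expand L ^^ n" borel] by simp
    ultimately show ?thesis by (auto intro!: sets.countable_INT sets.countable_UN')
  qed
  have "AE u in circle_lebesgue. ?P u"
    unfolding AE_circle_lebesgue[OF Pm]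
  proof -
    have "AE x in lborel. x \<in> {0..<1} \<longrightarrow> (\<forall>N. \<exists>n\<ge>N. frac (real L ^ n * x) \<in> {c..d})"
      using AE_visits_interval[OF L c(1,2)] c by simp
    then show "AE x in lborel. x \<in> {0..<1} \<longrightarrow> ?P (to_circle x)"
    proof eventually_elim
      case (elim x)
      have "to_circle (real L ^ n * x) \<in> to_circle ` {c..d}" if "frac (real L ^ n * x) \<in> {c..d}" for n
      proof -
        have "to_circle (real L ^ n * x) = to_circle (frac (real L ^ n * x))"
          by (simp add: to_circle_eq_iff frac_def)
        then show ?thesis using that by blast
      qed
      note arc = this
      show ?case
      proof (intro impI allI)
        fix N assume "x \<in> {0..<1}"
        with elim obtain n where "n \<ge> N" "frac (real L ^ n * x) \<in> {c..d}" by blast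
        then show "\<exists>n\<in>{N..}. (circle_expand L ^^ n) (to_circle x) \<in> to_circle ` {c..d}"
          using arc[of n] unfolding circle_expand_funpow by (intro bexI[of _ n]) auto
      qed
    qed
  qed
  moreover have "{u. \<not> ?P u} \<in> sets borel"
  proof -
    have "{u. \<not> ?P u} = - {u. ?P u}" by blast
    then show ?thesis using borel_comp[OF Pm] by (simp only:)
  qed
  moreover have "space circle_lebesgue = UNIV" "sets circle_lebesgue = sets borel"
    by (simp_all add: circle_lebesgue_def)
  ultimately have null: "{u. \<not> ?P u} \<in> null_sets circle_lebesgue"
    using AE_iff_null[of circle_lebesgue ?P] by simp
  interpret S: sigma_finite_measure spherical_area by (rule spherical_area_sigma_finite)
  have "{u. \<not> ?P u} \<times> UNIV \<in> null_sets std_volume"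
  proof (rule null_setsI)
    have s: "UNIV \<in> sets spherical_area" by (simp add: spherical_area_def)
    show "emeasure std_volume ({u. \<not> ?P u} \<times> UNIV) = 0"
      unfolding std_volume_def using null s by (subst S.emeasure_pair_measure_Times) auto
    show "{u. \<not> ?P u} \<times> UNIV \<in> sets std_volume"
      unfolding std_volume_def using null s by (intro pair_measureI) auto
  qed
  then have "AE q in std_volume. q \<notin> {u. \<not> ?P u} \<times> UNIV" by (rule AE_not_in)
  then show ?thesis
  proof eventually_elim
    case (elim q)
    then have "?P (fst q)" by (cases q) auto
    then show ?case by (simp add: Bex_def)
  qed
qed

text \<open>A smaller closed set misses a box around some (u, p). Almost every orbit visits a closed
  arc in the base of this box infinitely often, so its omega limit has a point over the arc; if the
  omega limit lay in the smaller set, that point would be in the box.\<close>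

lemma metric_attractorI:
  assumes L: "L \<ge> 2" and pos: "emeasure std_volume (stable_set \<alpha> L p) > 0"
  shows "metric_attractor std_volume (skew_product \<alpha> L) (UNIV \<times> {p})"
  unfolding metric_attractor_def attraction_basin_eq
proof (intro conjI notI)
  show "closed (UNIV \<times> {p} :: (circle \<times> riemann_sphere) set)" by (intro closed_Times) auto
  show "0 < emeasure std_volume (stable_set \<alpha> L p)" by (rule pos)
  assume "\<exists>A'. closed A' \<and> A' \<subset> UNIV \<times> {p} \<and>
    (AE x in std_volume. (x \<in> attraction_basin (skew_product \<alpha> L) A') = (x \<in> stable_set \<alpha> L p))"
  then obtain A where A: "closed A" "A \<subset> UNIV \<times> {p}"
      "AE x in std_volume. (x \<in> attraction_basin (skew_product \<alpha> L) A) = (x \<in> stable_set \<alpha> L p)" by blast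
  then obtain u where u: "(u, p) \<notin> A" by auto
  have "open (- A)" "(u, p) \<in> - A" using A(1) u by auto
  then obtain U V where UV: "open U" "open V" "u \<in> U" "p \<in> V" "U \<times> V \<subseteq> - A"
    by (rule open_prod_obtain)
  obtain x where x: "0 \<le> x" "x < 1" "u = to_circle x" by (rule to_circle_cases)
  have "open (to_circle -` U)" "x \<in> to_circle -` U" using UV x by (auto simp: open_circle_def)
  then obtain e where e: "e > 0" "ball x e \<subseteq> to_circle -` U" using open_contains_ball by blast
  define d where "d = x + min (e / 2) ((1 - x) / 2)"
  have d: "x < d" "d < 1" "d < x + e" using e x by (auto simp: d_def min_def field_simps)
  have KU: "to_circle ` {x..d} \<subseteq> U"
  proof -
    have "{x..d} \<subseteq> ball x e" using d by (auto simp: dist_real_def)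
    then show ?thesis using e(2) by blast
  qed
  have "AE q in std_volume. q \<notin> stable_set \<alpha> L p"
    using A(3) AE_visits_arc[OF L x(1) d(1,2)]
  proof eventually_elim
    case (elim q)
    show ?case
    proof
      assume q: "q \<in> stable_set \<alpha> L p"
      obtain v w where vw: "q = (v, w)" by (cases q)
      have sub: "omega_limit (skew_product \<alpha> L) q \<subseteq> A" using elim(1) q by (simp add: attraction_basin_def)
      have "closed (to_circle ` {x..d} \<times> (UNIV :: riemann_sphere set))"
        using closed_to_circle_image[of x d] x d by (intro closed_Times) auto
      moreover have "\<exists>n\<ge>N. (skew_product \<alpha> L ^^ n) q \<in> to_circle ` {x..d} \<times> UNIV" for N
        using elim(2) by (auto simp: vw skew_product_funpow)
      ultimately obtain y where y: "y \<in> omega_limit (skew_product \<alpha> L) q" "y \<in> to_circle ` {x..d} \<times> UNIV"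
        using omega_limit_meets_closed by blast
      then have "y \<in> A" using sub by blast
      moreover from this have "snd y = p" using A(2) by auto
      then have "y \<in> U \<times> V" using y(2) KU UV(4) by (cases y) auto
      ultimately show False using UV(5) by blast
    qed
  qed
  then have "stable_set \<alpha> L p \<in> null_sets std_volume"
    using stable_set_measurable[of \<alpha> L p] sets_std_volume by (subst (asm) AE_iff_null_sets[symmetric]) auto
  with pos show False by auto
qed

section \<open>The basins have positive volume in every open set\<close>

lemma to_circle_frac: "to_circle (frac t) = to_circle t"
  by (simp add: to_circle_eq_iff frac_def)

lemma stable_set_of_image:
  assumes "(to_circle (real L ^ n * x), Fin (orb \<alpha> L n x z)) \<in> stable_set \<alpha> L p"
  shows "(to_circle x, Fin z) \<in> stable_set \<alpha> L p"
proof -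
  have "(\<lambda>m. Fin (orb \<alpha> L (m + n) x z)) \<longlonglongrightarrow> p"
    using assms by (simp add: stable_set_def fibre_iterate_Fin add.commute[of _ n] orb_add)
  then have "(\<lambda>m. Fin (orb \<alpha> L m x z)) \<longlonglongrightarrow> p" by (rule LIMSEQ_offset)
  then show ?thesis by (simp add: stable_set_def fibre_iterate_Fin)
qed

text \<open>The value reached by one orbit at time n is also reached from \<open>D\<close> over
  every nearby y. For most y the fibre at time n is good: multiplication by L^n preserves measure,
  so the bad y have measure at most d, while the interval has length 2d.\<close>

lemma stable_set_pos_of_hit:
  assumes L: "L > 0" and box: "0 < c - \<epsilon>" "c + \<epsilon> < 1" and D: "open D"
    and U: "open U" "\<And>x z. \<bar>x - c\<bar> < \<epsilon> \<Longrightarrow> z \<in> D \<Longrightarrow> (to_circle x, Fin z) \<in> U"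
    and hit: "\<bar>x - c\<bar> < \<epsilon>" "z0 \<in> D"
    and good: "\<And>\<delta>. \<delta> > 0 \<Longrightarrow> \<exists>G\<in>sets borel. \<exists>\<rho>>0. emeasure lborel ({0..<1} - G) \<le> ennreal \<delta> \<and>
      (\<forall>y\<in>G. \<forall>v. dist v (orb \<alpha> L n x z0) \<le> \<rho> \<longrightarrow> (to_circle y, Fin v) \<in> stable_set \<alpha> L p)"
  shows "emeasure std_volume (U \<inter> stable_set \<alpha> L p) > 0"
proof -
  let ?w = "orb \<alpha> L n x z0"
  have "{?w} \<subseteq> orb \<alpha> L n x ` D" using hit(2) by blast
  then have "\<forall>\<^sub>F y in nhds x. {?w} \<subseteq> orb \<alpha> L n y ` D"
    by (intro compact_subset_orb_image D) auto
  then obtain d0 where d0: "d0 > 0" "\<And>y. \<bar>y - x\<bar> < d0 \<Longrightarrow> ?w \<in> orb \<alpha> L n y ` D"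
    unfolding eventually_nhds_metric dist_real_def by auto
  define d where "d = min d0 (\<epsilon> - \<bar>x - c\<bar>)"
  have d: "d > 0" "d \<le> d0" "d \<le> \<epsilon> - \<bar>x - c\<bar>" using d0 hit by (auto simp: d_def)
  obtain G \<rho> where G: "G \<in> sets borel" "\<rho> > 0" "emeasure lborel ({0..<1} - G) \<le> ennreal d"
      "\<And>y v. y \<in> G \<Longrightarrow> dist v ?w \<le> \<rho> \<Longrightarrow> (to_circle y, Fin v) \<in> stable_set \<alpha> L p"
    using good[OF d(1)] by blast
  have near: "\<bar>y - c\<bar> < \<epsilon>" "0 < y" "y < 1" if "\<bar>y - x\<bar> < d" for y
    using that d(3) box by linarith+
  have [measurable]: "G \<in> sets borel" by (rule G(1))
  define A where "A = {y. frac y \<notin> G}"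
  have [measurable]: "frac \<in> borel_measurable (borel :: real measure)"
    unfolding frac_def by measurable
  have A[measurable]: "A \<in> sets borel" unfolding A_def by measurable
  define X where "X = {y. \<bar>y - x\<bar> < d \<and> frac (real L ^ n * y) \<in> G}"
  have X[measurable]: "X \<in> sets borel" unfolding X_def by measurable
  have "emeasure lborel {y \<in> {0..<1}. real (L ^ n) * y \<in> A} \<le> emeasure lborel (A \<inter> {0..<1})"
    using L by (intro emeasure_preimage_le A) (auto simp: A_def frac_def)
  also have "A \<inter> {0..<1} = {0..<1} - G" by (auto simp: A_def frac_eq[THEN iffD2])
  finally have Am: "emeasure lborel {y \<in> {0..<1}. real L ^ n * y \<in> A} \<le> ennreal d"
    using G(3) by simp
  have Xpos: "emeasure lborel X > 0"
  proof (rule ccontr)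
    assume "\<not> ?thesis"
    then have X0: "emeasure lborel X = 0" by simp
    have "{x - d<..<x + d} \<subseteq> X \<union> {y \<in> {0..<1}. real L ^ n * y \<in> A}"
    proof
      fix y assume "y \<in> {x - d<..<x + d}"
      then have y: "\<bar>y - x\<bar> < d" by auto
      with near[OF y] show "y \<in> X \<union> {y \<in> {0..<1}. real L ^ n * y \<in> A}"
        by (auto simp: X_def A_def)
    qed
    then have "emeasure lborel {x - d<..<x + d} \<le> emeasure lborel (X \<union> {y \<in> {0..<1}. real L ^ n * y \<in> A})"
      by (intro emeasure_mono) auto
    also have "\<dots> \<le> emeasure lborel X + emeasure lborel {y \<in> {0..<1}. real L ^ n * y \<in> A}"
      by (intro emeasure_subadditive) auto
    also have "\<dots> \<le> ennreal d" using X0 Am by simp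
    finally have "ennreal (2 * d) \<le> ennreal d" using d(1) by simp
    then show False using d(1) by (simp add: ennreal_le_iff)
  qed
  show ?thesis
  proof (rule std_volume_pos[OF _ _ X Xpos])
    show "U \<inter> stable_set \<alpha> L p \<in> sets borel" using U(1) stable_set_measurable by auto
    show "X \<subseteq> {0..<1}" using near by (auto simp: X_def less_imp_le)
    fix y assume y: "y \<in> X"
    then have yd: "\<bar>y - x\<bar> < d" "frac (real L ^ n * y) \<in> G" by (auto simp: X_def)
    let ?V = "D \<inter> orb \<alpha> L n y -` ball ?w \<rho>"
    have "open (orb \<alpha> L n y -` ball ?w \<rho>)"
      by (intro open_vimage open_ball) (intro continuous_intros)
    then have "open ?V" using D by (intro open_Int)
    moreover have "?V \<noteq> {}"
    proof -
      obtain z where "z \<in> D" "orb \<alpha> L n y z = ?w" using d0(2)[of y] yd d by force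
      then show ?thesis using G(2) by auto
    qed
    moreover have "(to_circle y, Fin z) \<in> U \<inter> stable_set \<alpha> L p" if z: "z \<in> ?V" for z
    proof
      show "(to_circle y, Fin z) \<in> U" using U(2) near[OF yd(1)] z by auto
      have "(to_circle (frac (real L ^ n * y)), Fin (orb \<alpha> L n y z)) \<in> stable_set \<alpha> L p"
        using z by (intro G(4)[OF yd(2)]) (auto simp: dist_commute)
      then show "(to_circle y, Fin z) \<in> stable_set \<alpha> L p"
        unfolding to_circle_frac by (rule stable_set_of_image)
    qed
    ultimately show "\<exists>V. open V \<and> V \<noteq> {} \<and> (\<forall>z\<in>V. (to_circle y, Fin z) \<in> U \<inter> stable_set \<alpha> L p)"
      by blast
  qed
qed

text \<open>For odd \<open>L\<close> translation by 1/2 commutes with \<open>E\<close> and changes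
  the sign of every parameter; combined with the reflection z -> 1 - z it is a symmetry exchanging 0
  and 1.\<close>

lemma orb_half_shift:
  assumes "odd L"
  shows "orb \<alpha> L n (x + 1/2) z = 1 - orb \<alpha> L n x (1 - z)"
proof -
  have "param \<alpha> (real L ^ k * (x + 1/2)) = param (- \<alpha>) (real L ^ k * x)" for k
  proof -
    obtain i where "L ^ k = 2 * i + 1" using assms oddE[of "L ^ k"] by auto
    then have "real L ^ k = 2 * real i + 1" by (metis of_nat_1 of_nat_add of_nat_mult of_nat_numeral of_nat_power)
    then have "real L ^ k * (x + 1/2) - (real L ^ k * x + 1/2) = real i" by (simp add: algebra_simps)
    then have "real L ^ k * (x + 1/2) - (real L ^ k * x + 1/2) \<in> \<int>" by (metis Ints_of_nat)
    from param_cong[OF this] have "param \<alpha> (real L ^ k * (x + 1/2)) = param \<alpha> (real L ^ k * x + 1/2)" .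
    also have "cos (2 * pi * (real L ^ k * x + 1/2)) = - cos (2 * pi * (real L ^ k * x))"
    proof -
      have "2 * pi * (real L ^ k * x + 1/2) = 2 * pi * (real L ^ k * x) + pi" by (simp add: algebra_simps)
      then show ?thesis by (simp only: cos_periodic_pi)
    qed
    then have "param \<alpha> (real L ^ k * x + 1/2) = param (- \<alpha>) (real L ^ k * x)" by (simp add: param_def)
    finally show ?thesis .
  qed
  then have "orb \<alpha> L n (x + 1/2) z = orb (- \<alpha>) L n x z" by (induction n) simp_all
  then show ?thesis by (simp add: orb_reflect)
qed

lemma basin_1_large:
  assumes odd: "odd L" and good: "\<And>\<delta>. \<delta> > 0 \<Longrightarrow> \<exists>G\<in>sets borel. \<exists>\<rho>>0. emeasure lborel ({0..<1} - G) \<le> ennreal \<delta> \<and>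
      (\<forall>x\<in>G. \<forall>z. cmod z \<le> \<rho> \<longrightarrow> (\<lambda>n. orb \<alpha> L n x z) \<longlonglongrightarrow> 0)" and \<delta>: "\<delta> > 0"
  shows "\<exists>G\<in>sets borel. \<exists>\<rho>>0. emeasure lborel ({0..<1} - G) \<le> ennreal \<delta> \<and>
      (\<forall>x\<in>G. \<forall>z. dist z 1 \<le> \<rho> \<longrightarrow> (\<lambda>n. orb \<alpha> L n x z) \<longlonglongrightarrow> 1)"
proof -
  \<comment> \<open>Half of \<open>\<delta>\<close> for each of the two pieces into which
    translation mod 1 cuts the bad set.\<close>
  obtain G \<rho> where G: "G \<in> sets borel" "\<rho> > 0" "emeasure lborel ({0..<1} - G) \<le> ennreal (\<delta> / 2)"
      "\<And>x z. x \<in> G \<Longrightarrow> cmod z \<le> \<rho> \<Longrightarrow> (\<lambda>n. orb \<alpha> L n x z) \<longlonglongrightarrow> 0"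
    using good[of "\<delta> / 2"] \<delta> by auto
  have [measurable]: "G \<in> sets borel" by (rule G(1))
  have [measurable]: "frac \<in> borel_measurable (borel :: real measure)"
    unfolding frac_def by measurable
  define G' where "G' = {x. frac (x + 1/2) \<in> G}"
  have G'[measurable]: "G' \<in> sets borel" unfolding G'_def by measurable
  let ?C = "{0..<1} - G"
  have trans: "emeasure lborel ((+) a -` ?C) = emeasure lborel ?C" for a :: real
  proof -
    have "emeasure lborel ?C = emeasure (distr lborel borel ((+) a)) ?C" by (simp add: lborel_distr_plus)
    also have "\<dots> = emeasure lborel ((+) a -` ?C)" by (subst emeasure_distr) auto
    finally show ?thesis by simp
  qed
  have m: "(+) a -` ?C \<in> sets borel" for a :: real
    using measurable_sets[of "(+) a" borel borel ?C] by simp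
  have "{0..<1} - G' \<subseteq> (+) (1/2) -` ?C \<union> (+) (- 1/2) -` ?C"
  proof
    fix x assume x: "x \<in> {0..<1} - G'"
    show "x \<in> (+) (1/2) -` ?C \<union> (+) (- 1/2) -` ?C"
    proof (cases "x < 1/2")
      case True
      then have "frac (x + 1/2) = x + 1/2" using x by (simp add: frac_eq)
      then show ?thesis using x True by (auto simp: G'_def add.commute)
    next
      case False
      have "frac (x + 1/2) = frac (x - 1/2)"
      proof -
        have "x + 1/2 = (x - 1/2) + 1" by simp
        then show ?thesis by (metis frac_1_eq)
      qed
      also have "\<dots> = x - 1/2" using x False by (simp add: frac_eq)
      finally show ?thesis using x False by (auto simp: G'_def)
    qed
  qed
  then have "emeasure lborel ({0..<1} - G') \<le> emeasure lborel ((+) (1/2) -` ?C \<union> (+) (- 1/2) -` ?C)"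
    using m by (intro emeasure_mono) auto
  also have "\<dots> \<le> emeasure lborel ((+) (1/2) -` ?C) + emeasure lborel ((+) (- 1/2) -` ?C)"
    using m by (intro emeasure_subadditive) auto
  also have "\<dots> \<le> ennreal (\<delta> / 2) + ennreal (\<delta> / 2)" unfolding trans using G(3) by (intro add_mono)
  also have "\<dots> = ennreal \<delta>" using \<delta> by (simp flip: ennreal_plus)
  finally have meas: "emeasure lborel ({0..<1} - G') \<le> ennreal \<delta>" .
  have lim: "(\<lambda>n. orb \<alpha> L n x z) \<longlonglongrightarrow> 1" if x: "x \<in> G'" and z: "dist z 1 \<le> \<rho>" for x z
  proof -
    have "(\<lambda>n. orb \<alpha> L n (frac (x + 1/2)) (1 - z)) \<longlonglongrightarrow> 0"
      using x z by (intro G(4)) (auto simp: G'_def dist_norm norm_minus_commute)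
    moreover have "orb \<alpha> L n (frac (x + 1/2)) (1 - z) = orb \<alpha> L n (x + 1/2) (1 - z)" for n
      by (rule orb_cong) (simp add: frac_def)
    ultimately have "(\<lambda>n. 1 - orb \<alpha> L n x z) \<longlonglongrightarrow> 0" by (simp add: orb_half_shift[OF odd])
    from tendsto_diff[OF tendsto_const[of 1] this] show ?thesis by simp
  qed
  show ?thesis
    using G' G(2) meas lim by blast
qed

context skew_large
begin

text \<open>The radius R of the good set is unrelated to the value that is hit, so
  \<open>stable_set_pos_of_hit\<close> does not apply. Instead a point of modulus above
  \<open>10 / \<beta>\<close> is hit, the base follows a cylinder at \<open>x1\<close> for k steps
  until doubling has carried the modulus beyond R, and only then must the fibre be good.\<close>

lemma stable_set_Infty_pos:
  assumes \<epsilon>: "\<epsilon> > 0" and box: "0 < c - \<epsilon>" "c + \<epsilon> < 1" and D: "open D" "D \<noteq> {}"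
    and U: "open U" "\<And>x z. \<bar>x - c\<bar> < \<epsilon> \<Longrightarrow> z \<in> D \<Longrightarrow> (to_circle x, Fin z) \<in> U"
  shows "emeasure std_volume (U \<inter> stable_set \<alpha> L Infty) > 0"
proof -
  have Lp: "L > 0" using L by simp
  obtain G R where G: "G \<in> sets borel" "emeasure lborel ({0..<1} - G) \<le> ennreal (1/2)"
      "\<And>x z. x \<in> G \<Longrightarrow> R \<le> cmod z \<Longrightarrow> filterlim (\<lambda>n. orb \<alpha> L n x z) at_infinity sequentially"
    using basin_infinity_large[OF Lp a(1) less_imp_le[OF a(2)], of "1/2"] by auto
  have [measurable]: "G \<in> sets borel" by (rule G(1))
  have [measurable]: "frac \<in> borel_measurable (borel :: real measure)"
    unfolding frac_def by measurable
  let ?S = "10 / \<beta>"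
  have S: "?S \<ge> 20" using \<beta> by simp
  define w :: complex where "w = of_real (?S + 1)"
  have w: "cmod w = ?S + 1" using S by (simp add: w_def norm_of_real del: of_real_add)
  obtain N \<delta> where N: "\<delta> > 0" "\<And>v u. \<bar>v - x1\<bar> < \<delta> \<Longrightarrow> cmod u \<le> ?S + 1 \<Longrightarrow>
      \<exists>x z. \<bar>x - c\<bar> < \<epsilon> \<and> z \<in> D \<and> real L ^ N * x - v \<in> \<int> \<and> orb \<alpha> L N x z = u"
    using covers[OF \<epsilon> D, of "?S + 1" c] by blast
  obtain x z0 where x: "\<bar>x - c\<bar> < \<epsilon>" "z0 \<in> D" "real L ^ N * x - x1 \<in> \<int>" "orb \<alpha> L N x z0 = w"
    using N(2)[of x1 w] N(1) w by auto
  have "{w} \<subseteq> orb \<alpha> L N x ` D" using x by blast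
  then have "\<forall>\<^sub>F y in nhds x. {w} \<subseteq> orb \<alpha> L N y ` D"
    by (intro compact_subset_orb_image D) auto
  then obtain d0 where d0: "d0 > 0" "\<And>y. \<bar>y - x\<bar> < d0 \<Longrightarrow> w \<in> orb \<alpha> L N y ` D"
    unfolding eventually_nhds_metric dist_real_def by auto
  define d where "d = min d0 (\<epsilon> - \<bar>x - c\<bar>)"
  have d: "d > 0" "d \<le> d0" "d \<le> \<epsilon> - \<bar>x - c\<bar>" using d0 x by (auto simp: d_def)
  obtain k0 where k0: "R < 2 ^ k0" using real_arch_pow[of 2] by auto
  have dL: "d * real L ^ N > 0" using d L by simp
  obtain k where k: "k \<ge> k0" "\<And>y. y \<in> cyl L k x1 \<Longrightarrow> \<bar>y - x1\<bar> < d * real L ^ N"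
    using small_cyl[OF dL L2, of k0 x1] by blast
  have k2: "R \<le> 2 ^ k"
    using k0 power_increasing[OF k(1), of "2::real"] by linarith
  define M where "M = L ^ (N + k)"
  have M: "M > 0" "real M = real L ^ N * real L ^ k" using L by (auto simp: M_def power_add)
  obtain i where i: "real L ^ N * x - x1 = of_int i" using x(3) by (rule Ints_cases)
  define j where "j = int (L ^ k) * i + \<lfloor>real L ^ k * x1\<rfloor>"
  \<comment> \<open>The y whose base point at time N lies, up to an integer, in the cylinder of
    order k at \<open>x1\<close>. This is a cell of length 1/M mapped affinely onto a unit interval,
    so good fibres keep their proportion in it, and measure 1/2 is enough.\<close>
  define C where "C = {y. of_int j \<le> real M * y \<and> real M * y < of_int j + 1}"
  have C: "x1 + real L ^ N * (y - x) \<in> cyl L k x1" if "y \<in> C" for y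
  proof -
    have "real L ^ k * (x1 + real L ^ N * (y - x)) = real M * y - real L ^ k * (real L ^ N * x - x1)"
      by (simp add: M algebra_simps)
    also have "\<dots> = real M * y - of_int (int (L ^ k) * i)" by (simp add: i)
    finally have "\<lfloor>real L ^ k * (x1 + real L ^ N * (y - x))\<rfloor> = \<lfloor>real L ^ k * x1\<rfloor>"
      using that by (intro floor_unique) (auto simp: C_def j_def)
    then show ?thesis by (simp add: cyl_def)
  qed
  have near: "\<bar>y - x\<bar> < d" if "y \<in> C" for y
  proof -
    have "\<bar>real L ^ N * (y - x)\<bar> < d * real L ^ N" using k(2)[OF C[OF that]] by simp
    then show ?thesis using L by (simp add: abs_mult)
  qed
  have near_c: "\<bar>y - c\<bar> < \<epsilon>" "0 < y" "y < 1" if "y \<in> C" for y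
    using near[OF that] d(3) box by linarith+
  have j0: "0 \<le> j"
  proof -
    have y: "of_int j / real M \<in> C" using M(1) by (simp add: C_def)
    have "0 < of_int j / real M" by (rule near_c(2)[OF y])
    then show ?thesis using M(1) by (simp add: zero_less_divide_iff)
  qed
  have Cell: "C = unit_cell M (nat j)"
    using M(1) j0 by (auto simp: C_def unit_cell_def field_simps)
  define A where "A = {y. frac y \<in> G}"
  have A[measurable]: "A \<in> sets borel" unfolding A_def by measurable
  define X where "X = {y \<in> C. real M * y \<in> A}"
  have X[measurable]: "X \<in> sets borel" unfolding X_def Cell by measurable
  have "emeasure lborel X = (\<integral>\<^sup>+y. indicator X y \<partial>lborel)" by simp
  also have "\<dots> = (\<integral>\<^sup>+y. indicator A (real M * y) * indicator (unit_cell M (nat j)) y \<partial>lborel)"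
    by (intro nn_integral_cong) (auto simp: X_def Cell indicator_def)
  also have "\<dots> = ennreal (1 / real M) * (\<integral>\<^sup>+y. indicator A y * indicator {0..<1} y \<partial>lborel)"
    by (rule nn_integral_unit_cell[where H = "indicator A", OF M(1)]) (auto simp: A_def frac_def indicator_def)
  also have "(\<integral>\<^sup>+y. indicator A y * indicator {0..<1} y \<partial>lborel) = emeasure lborel (G \<inter> {0..<1})"
  proof -
    have "(\<integral>\<^sup>+y. indicator A y * indicator {0..<1} y \<partial>lborel) = (\<integral>\<^sup>+y. indicator (G \<inter> {0..<1}) y \<partial>lborel)"
      by (intro nn_integral_cong) (auto simp: A_def indicator_def frac_eq[THEN iffD2])
    then show ?thesis by simp
  qed
  finally have Xm: "emeasure lborel X = ennreal (1 / real M) * emeasure lborel (G \<inter> {0..<1})" .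
  have "emeasure lborel (G \<inter> {0..<1}) \<noteq> 0"
  proof
    assume 0: "emeasure lborel (G \<inter> {0..<1}) = 0"
    have "emeasure lborel {0..<1::real} \<le> emeasure lborel ((G \<inter> {0..<1}) \<union> ({0..<1} - G))"
      by (intro emeasure_mono) auto
    also have "\<dots> \<le> emeasure lborel (G \<inter> {0..<1}) + emeasure lborel ({0..<1} - G)"
      by (intro emeasure_subadditive) auto
    also have "\<dots> \<le> ennreal (1/2)" using 0 G(2) by simp
    finally have "ennreal 1 \<le> ennreal (1/2)" by simp
    then show False by (subst (asm) ennreal_le_iff) auto
  qed
  then have "emeasure lborel (G \<inter> {0..<1}) > 0" by (metis gr_zeroI)
  then have Xpos: "emeasure lborel X > 0"
    unfolding Xm ennreal_zero_less_mult_iff using M(1) by simp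
  show ?thesis
  proof (rule std_volume_pos[OF _ _ X Xpos])
    show "U \<inter> stable_set \<alpha> L Infty \<in> sets borel" using U(1) stable_set_measurable by auto
    show "X \<subseteq> {0..<1}" using near_c by (auto simp: X_def less_imp_le)
    fix y assume y: "y \<in> X"
    then have yC: "y \<in> C" "frac (real M * y) \<in> G" by (auto simp: X_def A_def)
    let ?V = "D \<inter> orb \<alpha> L N y -` (- cball 0 ?S)"
    have "open (orb \<alpha> L N y -` (- cball 0 ?S))"
      by (intro open_vimage open_Compl closed_cball) (intro continuous_intros)
    then have "open ?V" using D by (intro open_Int)
    moreover have "?V \<noteq> {}"
    proof -
      have "\<bar>y - x\<bar> < d0" using near[OF yC(1)] d by simp
      then obtain z where "z \<in> D" "orb \<alpha> L N y z = w" using d0(2) by force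
      then show ?thesis using w by auto
    qed
    moreover have "(to_circle y, Fin z) \<in> U \<inter> stable_set \<alpha> L Infty" if z: "z \<in> ?V" for z
    proof
      show "(to_circle y, Fin z) \<in> U" using U(2) near_c[OF yC(1)] z by auto
      let ?v = "x1 + real L ^ N * (y - x)"
      have yv: "real L ^ N * y - ?v \<in> \<int>" using x(3) by (simp add: algebra_simps)
      have zS: "?S \<le> cmod (orb \<alpha> L N y z)" using z by simp
      have "2 ^ k * cmod (orb \<alpha> L N y z) \<le> cmod (orb \<alpha> L k ?v (orb \<alpha> L N y z))"
        using zS a by (intro orb_far[OF \<beta>(1)] param_near_x1[OF C[OF yC(1)]]) auto
      also have "orb \<alpha> L k ?v (orb \<alpha> L N y z) = orb \<alpha> L (N + k) y z"
        by (rule orb_add_cong[OF yv, symmetric])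
      finally have "2 ^ k * cmod (orb \<alpha> L N y z) \<le> cmod (orb \<alpha> L (N + k) y z)" .
      moreover have "2 ^ k * 1 \<le> 2 ^ k * cmod (orb \<alpha> L N y z)"
        using zS S by (intro mult_left_mono) auto
      ultimately have "R \<le> cmod (orb \<alpha> L (N + k) y z)" using k2 by linarith
      from stable_set_Infty[OF G(3)[OF yC(2) this]]
      have "(to_circle (frac (real M * y)), Fin (orb \<alpha> L (N + k) y z)) \<in> stable_set \<alpha> L Infty" .
      then have "(to_circle (real L ^ (N + k) * y), Fin (orb \<alpha> L (N + k) y z)) \<in> stable_set \<alpha> L Infty"
        by (simp add: to_circle_frac M_def)
      then show "(to_circle y, Fin z) \<in> stable_set \<alpha> L Infty" by (rule stable_set_of_image)
    qed
    ultimately show "\<exists>V. open V \<and> V \<noteq> {} \<and> (\<forall>z\<in>V. (to_circle y, Fin z) \<in> U \<inter> stable_set \<alpha> L Infty)"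
      by blast
  qed
qed

lemma stable_set_pos:
  assumes good: "\<And>\<delta>. \<delta> > 0 \<Longrightarrow> \<exists>G\<in>sets borel. \<exists>\<rho>>0. emeasure lborel ({0..<1} - G) \<le> ennreal \<delta> \<and>
      (\<forall>x\<in>G. \<forall>z. cmod z \<le> \<rho> \<longrightarrow> (\<lambda>n. orb \<alpha> L n x z) \<longlonglongrightarrow> 0)"
    and U: "open U" "U \<noteq> {}" and p: "p \<in> {Fin 0, Fin 1, Infty}"
  shows "emeasure std_volume (U \<inter> stable_set \<alpha> L p) > 0"
proof -
  have Lp: "L > 0" using L by simp
  obtain c \<epsilon> D where B: "\<epsilon> > 0" "0 < c - \<epsilon>" "c + \<epsilon> < 1" "open D" "D \<noteq> {}"
      "\<And>x z. \<bar>x - c\<bar> < \<epsilon> \<Longrightarrow> z \<in> D \<Longrightarrow> (to_circle x, Fin z) \<in> U"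
    using open_box[OF U] by blast
  consider "p = Fin 0" | "p = Fin 1" | "p = Infty" using p by blast
  then show ?thesis
  proof cases
    case 1
    obtain x z n where h: "\<bar>x - c\<bar> < \<epsilon>" "z \<in> D" "orb \<alpha> L n x z = 0"
      using hits_0[OF B(1,4,5)] by blast
    show ?thesis
    proof (rule stable_set_pos_of_hit[OF Lp B(2-4) U(1) B(6) h(1,2)])
      fix \<delta> :: real assume "\<delta> > 0"
      from good[OF this] obtain G \<rho> where G: "G \<in> sets borel" "\<rho> > 0" "emeasure lborel ({0..<1} - G) \<le> ennreal \<delta>"
        "\<And>x z. x \<in> G \<Longrightarrow> cmod z \<le> \<rho> \<Longrightarrow> (\<lambda>n. orb \<alpha> L n x z) \<longlonglongrightarrow> 0" by blast
      have "(to_circle y, Fin v) \<in> stable_set \<alpha> L p" if "y \<in> G" "dist v (orb \<alpha> L n x z) \<le> \<rho>" for y v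
        using stable_set_Fin[OF G(4)[OF that(1), of v]] that(2) h(3) 1 by simp
      with G(1-3) show "\<exists>G\<in>sets borel. \<exists>\<rho>>0. emeasure lborel ({0..<1} - G) \<le> ennreal \<delta> \<and>
        (\<forall>y\<in>G. \<forall>v. dist v (orb \<alpha> L n x z) \<le> \<rho> \<longrightarrow> (to_circle y, Fin v) \<in> stable_set \<alpha> L p)" by blast
    qed
  next
    case 2
    obtain N d where "d > 0" "\<And>v w. \<bar>v - x1\<bar> < d \<Longrightarrow> cmod w \<le> 1 \<Longrightarrow>
        \<exists>x z. \<bar>x - c\<bar> < \<epsilon> \<and> z \<in> D \<and> real L ^ N * x - v \<in> \<int> \<and> orb \<alpha> L N x z = w"
      using covers[OF B(1,4,5), of 1 c] by blast
    from this(2)[of x1 1] this(1) obtain x z n where h: "\<bar>x - c\<bar> < \<epsilon>" "z \<in> D" "orb \<alpha> L n x z = 1" by auto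
    show ?thesis
    proof (rule stable_set_pos_of_hit[OF Lp B(2-4) U(1) B(6) h(1,2)])
      fix \<delta> :: real assume "\<delta> > 0"
      from basin_1_large[OF L(2) good this] obtain G \<rho> where G: "G \<in> sets borel" "\<rho> > 0" "emeasure lborel ({0..<1} - G) \<le> ennreal \<delta>"
        "\<And>x z. x \<in> G \<Longrightarrow> dist z 1 \<le> \<rho> \<Longrightarrow> (\<lambda>n. orb \<alpha> L n x z) \<longlonglongrightarrow> 1" by blast
      have "(to_circle y, Fin v) \<in> stable_set \<alpha> L p" if "y \<in> G" "dist v (orb \<alpha> L n x z) \<le> \<rho>" for y v
        using stable_set_Fin[OF G(4)[OF that(1), of v]] that(2) h(3) 2 by simp
      with G(1-3) show "\<exists>G\<in>sets borel. \<exists>\<rho>>0. emeasure lborel ({0..<1} - G) \<le> ennreal \<delta> \<and>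
        (\<forall>y\<in>G. \<forall>v. dist v (orb \<alpha> L n x z) \<le> \<rho> \<longrightarrow> (to_circle y, Fin v) \<in> stable_set \<alpha> L p)" by blast
    qed
  next
    case 3
    then show ?thesis using stable_set_Infty_pos[OF B(1-5) U(1) B(6)] by simp
  qed
qed

lemma skew_product_mixing: "topologically_mixing (skew_product \<alpha> L)"
  unfolding topologically_mixing_def
proof (intro allI impI, elim conjE)
  fix U V :: "(circle \<times> riemann_sphere) set"
  assume U: "open U" "U \<noteq> {}" and V: "open V" "V \<noteq> {}"
  obtain c \<epsilon> D where B: "\<epsilon> > 0" "open D" "D \<noteq> {}"
      "\<And>x z. \<bar>x - c\<bar> < \<epsilon> \<Longrightarrow> z \<in> D \<Longrightarrow> (to_circle x, Fin z) \<in> U"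
    using open_box[OF U] by blast
  obtain v \<epsilon>' D' where B': "\<epsilon>' > 0" "D' \<noteq> {}"
      "\<And>x z. \<bar>x - v\<bar> < \<epsilon>' \<Longrightarrow> z \<in> D' \<Longrightarrow> (to_circle x, Fin z) \<in> V"
    using open_box[OF V] by blast
  obtain w where w: "w \<in> D'" using B' by blast
  obtain N0 where N0: "\<And>n. n \<ge> N0 \<Longrightarrow>
      \<exists>x z. \<bar>x - c\<bar> < \<epsilon> \<and> z \<in> D \<and> real L ^ n * x - v \<in> \<int> \<and> orb \<alpha> L n x z = w"
    using mixes[OF B(1-3), of c v w] by blast
  show "\<exists>N. \<forall>n\<ge>N. (skew_product \<alpha> L ^^ n) ` U \<inter> V \<noteq> {}"
  proof (rule exI[of _ N0], intro allI impI)
    fix n assume "n \<ge> N0"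
    then obtain x z where x: "\<bar>x - c\<bar> < \<epsilon>" "z \<in> D" "real L ^ n * x - v \<in> \<int>" "orb \<alpha> L n x z = w"
      using N0 by blast
    have "to_circle (real L ^ n * x) = to_circle v" using x(3) by (simp only: to_circle_eq_iff)
    then have "(skew_product \<alpha> L ^^ n) (to_circle x, Fin z) = (to_circle v, Fin w)"
      using x(4) by (simp add: skew_product_funpow circle_expand_funpow fibre_iterate_Fin)
    moreover have "(to_circle v, Fin w) \<in> V" using B'(1,3) w by simp
    ultimately show "(skew_product \<alpha> L ^^ n) ` U \<inter> V \<noteq> {}" using B(4)[OF x(1,2)] by (metis IntI image_eqI empty_iff)
  qed
qed

end

section \<open>Passage from the circle to lifts and the theorem\<close>

lemma continuous_on_cos_2pi: "continuous_on UNIV cos_2pi"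
proof -
  have "open (cos_2pi -` S)" if "open S" for S
  proof -
    have "to_circle -` (cos_2pi -` S) = (\<lambda>x. cos (2 * pi * x)) -` S" by (auto simp: cos_2pi.abs_eq)
    moreover have "open ((\<lambda>x. cos (2 * pi * x)) -` S)" by (rule open_vimage[OF that]) (intro continuous_intros)
    ultimately show ?thesis by (simp add: open_circle_def)
  qed
  then show ?thesis by (simp add: continuous_on_open_vimage)
qed

lemma integral_circle_lebesgue:
  "(LINT u|circle_lebesgue. ln (cmod (1 + \<alpha> * complex_of_real (cos_2pi u)))) =
     integral\<^sup>L unit_measure (\<lambda>x. ln (cmod (1 + param \<alpha> x)))"
proof -
  have [measurable]: "cos_2pi \<in> borel_measurable borel"
    by (rule borel_measurable_continuous_onI[OF continuous_on_cos_2pi])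
  have "to_circle \<in> measurable unit_measure borel" by (intro measurable_restrict_space1) simp
  then show ?thesis
    unfolding circle_lebesgue_def
    by (subst integral_distr) (auto simp: param_def cos_2pi.abs_eq)
qed

theorem theorem2p8:
  fixes \<alpha> :: complex and u0 u1 :: circle
  assumes "0 < cmod \<alpha>" and "cmod \<alpha> < 1"
    and "(LINT u|circle_lebesgue. ln (cmod (1 + \<alpha> * complex_of_real (cos_2pi u)))) =
           ln (cmod ((1 + csqrt (1 - \<alpha>\<^sup>2)) / 2))"
    and "ln (cmod ((1 + csqrt (1 - \<alpha>\<^sup>2)) / 2)) < 0"
    and "ln (cmod (deriv (fibre_poly \<alpha> u0) 0)) < 0"
    and "ln (cmod (deriv (fibre_poly \<alpha> u0) 1)) > 0"
    and "ln (cmod (deriv (fibre_poly \<alpha> u1) 0)) > 0"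
    and "ln (cmod (deriv (fibre_poly \<alpha> u1) 1)) < 0"
    and "\<forall>p\<in>{0, 1}. ln (cmod (deriv (fibre_poly \<alpha> u0) p)) /
                      ln (cmod (deriv (fibre_poly \<alpha> u1) p)) \<notin> \<rat>"
    and "\<alpha> \<notin> \<real> \<longrightarrow>
           (\<forall>p\<in>{0, 1}. incommensurable (Arg (deriv (fibre_poly \<alpha> u0) p))
                                         (Arg (deriv (fibre_poly \<alpha> u1) p)) (2 * pi))"
  shows "\<forall>\<^sub>F L in sequentially.
           1 < L \<and> odd L \<and> circle_expand L u0 = u0 \<and> circle_expand L u1 = u1 \<longrightarrow>
             ((\<forall>p\<in>{Fin 0, Fin 1, Infty}.
                 restricted_support std_volume (stable_set \<alpha> L p) = UNIV) \<and>
              (\<forall>p\<in>{Fin 0, Fin 1, Infty}.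
                 metric_attractor std_volume (skew_product \<alpha> L) (UNIV \<times> {p})) \<and>
              intermingled std_volume (stable_set \<alpha> L ` {Fin 0, Fin 1, Infty})) \<and>
             topologically_mixing (skew_product \<alpha> L)"
proof -
  obtain x0 where u0: "0 \<le> x0" "x0 < 1" "u0 = to_circle x0" by (rule to_circle_cases)
  obtain x1 where u1: "0 \<le> x1" "x1 < 1" "u1 = to_circle x1" by (rule to_circle_cases)
  have gt1: "1 < r" if "0 < ln r" "0 \<le> r" for r :: real
    using that by (cases "r = 0") auto
  have neg: "integral\<^sup>L unit_measure (\<lambda>x. ln (cmod (1 + param \<alpha> x))) < 0"
    using assms(3,4) integral_circle_lebesgue[of \<alpha>] by simp
  interpret skew_system \<alpha> x0 x1
  proof
    show "1 < cmod (1 - param \<alpha> x0)"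
      using gt1[OF assms(6)] by (simp add: deriv_fibre_poly_1 u0(3) cos_2pi.abs_eq param_def)
    show "1 < cmod (1 + param \<alpha> x1)"
      using gt1[OF assms(7)] by (simp add: deriv_fibre_poly_0 u1(3) cos_2pi.abs_eq param_def)
  qed (use assms(1,2) u0 u1 in auto)
  have "\<forall>\<^sub>F L in sequentially. L \<ge> 1000" by (rule eventually_ge_at_top)
  moreover have "\<forall>\<^sub>F L in sequentially. real L \<ge> 7 / \<beta>"
    using filterlim_real_sequentially unfolding filterlim_at_top by blast
  \<comment> \<open>The escape radius depends on \<open>\<beta>\<close> and not on \<open>L\<close>,
    so the thresholds for \<open>L\<close> can be combined.\<close>
  moreover have "0 \<le> 10 / \<beta>" using \<beta> by simp
  note escape[OF this]
  moreover note basin_0_large[OF assms(2) neg]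
  ultimately show ?thesis
  proof eventually_elim
    case (elim L)
    show ?case
    proof (rule impI, elim conjE)
      assume odd: "odd L" and fp: "circle_expand L u0 = u0" "circle_expand L u1 = u1"
      have fx: "real L * x0 - x0 \<in> \<int>" "real L * x1 - x1 \<in> \<int>"
        using fp by (simp_all add: u0(3) u1(3) circle_expand_fixed_iff)
      interpret skew_large \<alpha> x0 x1 L
      proof
        show "7 / real L \<le> \<beta>" using elim(1,2) \<beta>(1) by (simp add: field_simps)
      qed (use elim odd fx in auto)
      have pos: "emeasure std_volume (U \<inter> stable_set \<alpha> L p) > 0"
        if "open U" "U \<noteq> {}" "p \<in> {Fin 0, Fin 1, Infty}" for U p
        using stable_set_pos[OF _ that] elim(4) by blast
      have "restricted_support std_volume (stable_set \<alpha> L p) = UNIV" if "p \<in> {Fin 0, Fin 1, Infty}" for p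
        using pos[OF _ _ that] by (auto simp: restricted_support_def)
      moreover have "metric_attractor std_volume (skew_product \<alpha> L) (UNIV \<times> {p})" if "p \<in> {Fin 0, Fin 1, Infty}" for p
        using pos[OF open_UNIV _ that] by (intro metric_attractorI[OF L2]) simp
      moreover have "intermingled std_volume (stable_set \<alpha> L ` {Fin 0, Fin 1, Infty})"
        unfolding intermingled_def using pos by blast
      ultimately show "((\<forall>p\<in>{Fin 0, Fin 1, Infty}. restricted_support std_volume (stable_set \<alpha> L p) = UNIV) \<and>
          (\<forall>p\<in>{Fin 0, Fin 1, Infty}. metric_attractor std_volume (skew_product \<alpha> L) (UNIV \<times> {p})) \<and>
          intermingled std_volume (stable_set \<alpha> L ` {Fin 0, Fin 1, Infty})) \<and>
          topologically_mixing (skew_product \<alpha> L)"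
        using skew_product_mixing by blast
    qed
  qed
qed

end
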